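(* For every real number $\varepsilon>0$ there is a real constant $c=c(\varepsilon)>0$ (depending only on $\varepsilon$) such that the following holds. Let $a=2b$ be a positive even integer such that there exists an $\varepsilon$-expander belonging to $\mathfrak{B}_a$, and let $n=n_1\cdots n_a$, where each $n_i$ is a product of two distinct primes $\ge 5$ and the products $n_1\cdots n_b$ and $n_{b+1}\cdots n_{2b}$ are coprime. Then there exists a circulant graph of order $n$ whose Weisfeiler-Leman dimension is at least $\lfloor c\sqrt{a}\rfloor$.
   Context: $\mathfrak{B}_a$ is the set of all (simple, undirected) bipartite cubic $3$-connected graphs with $a$ vertices. A graph is an $\varepsilon$-expander if for every vertex subset $\Delta$ containing at most half of the vertices, $|\partial\Delta|\ge\varepsilon|\Delta|$, where $\partial\Delta$ is the set of vertices outside $\Delta$ adjacent to at least one vertex of $\Delta$. Graphs may be directed or undirected. For a group $G$ and $X\subseteq G$, the Cayley graph $\mathrm{Cay}(G,X)$ has vertex set $G$ and arcs $(x,y)$ with $yx^{-1}\in X$. A circulant graph is a Cayley graph of a cyclic group. $m$-dimensional Weisfeiler-Leman ($m$-dim WL) algorithm, $m\ge 2$: for a graph with vertex set $\Omega$ and arc set $E$, the initial color of $x\in\Omega^m$ encodes, for all $1\le i,j\le m$, whether $x_i=x_j$ and whether $(x_i,x_j)\in E$. In each step the color $c(x)$ is replaced by the pair consisting of $c(x)$ and the multiset, over $\alpha\in\Omega$, of the tuples $(c(x_{1\leftarrow\alpha}),\ldots,c(x_{m\leftarrow\alpha}))$, where $x_{i\leftarrow\alpha}$ is $x$ with the $i$-th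 entry replaced by $\alpha$; this is repeated until the partition of $\Omega^m$ into color classes stabilizes. For $m=1$ the algorithm is the usual (naive) vertex color refinement. Two graphs are $\mathrm{WL}_m$-equivalent if, when the algorithm is run in parallel on both, every color occurs equally often in both. The Weisfeiler-Leman dimension of a graph $\mathcal{G}$ is the smallest positive integer $m$ such that every graph $\mathrm{WL}_m$-equivalent to $\mathcal{G}$ is isomorphic to $\mathcal{G}$. *)

theory Defs
  imports
    Complex_Main
    "HOL-Library.Multiset"
    "HOL-Algebra.Elementary_Groups"
    "Graph_Theory.Digraph_Isomorphism"
    "Graph_Theory.Pair_Digraph"
    "HOL-Computational_Algebra.Primes"
begin

text \<open>
  A graph (directed or undirected) is a finite vertex set with a set of arcs, i.e. a
  \<^locale>\<open>pair_fin_digraph\<close>; loops are not excluded, as a Cayley graph has them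
  when the connection set contains the identity. Simple undirected graphs are the symmetric
  loopless ones, i.e. \<^locale>\<open>pair_graph\<close>.
\<close>

section \<open>Bipartite cubic 3-connected graphs and expanders\<close>

definition bipartite :: "'a pair_pre_digraph \<Rightarrow> bool" where
  "bipartite G \<longleftrightarrow> (\<exists>U W. U \<union> W = pverts G \<and> U \<inter> W = {} \<and>
     (\<forall>(u, v) \<in> parcs G. (u \<in> U \<and> v \<in> W) \<or> (u \<in> W \<and> v \<in> U)))"

text \<open>As an edge is a pair of opposite arcs, the degree of a vertex is its out-degree.\<close>

definition cubic :: "'a pair_pre_digraph \<Rightarrow> bool" where
  "cubic G \<longleftrightarrow> (\<forall>v \<in> pverts G. out_degree (with_proj G) v = 3)"

definition vertex_connected :: "nat \<Rightarrow> 'a pair_pre_digraph \<Rightarrow> bool" where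
  "vertex_connected k G \<longleftrightarrow> k < card (pverts G) \<and>
     (\<forall>S \<subseteq> pverts G. card S < k \<longrightarrow> connected (with_proj G \<restriction> (pverts G - S)))"

definition bip_cubic_3conn :: "nat \<Rightarrow> 'a pair_pre_digraph set" where
  "bip_cubic_3conn a = {G. pair_graph G \<and> card (pverts G) = a \<and>
     bipartite G \<and> cubic G \<and> vertex_connected 3 G}"

definition vertex_boundary :: "'a pair_pre_digraph \<Rightarrow> 'a set \<Rightarrow> 'a set" where
  "vertex_boundary G D = {v \<in> pverts G - D. \<exists>u \<in> D. (u, v) \<in> parcs G}"

definition expander :: "real \<Rightarrow> 'a pair_pre_digraph \<Rightarrow> bool" where
  "expander \<epsilon> G \<longleftrightarrow> (\<forall>D \<subseteq> pverts G. 2 * card D \<le> card (pverts G) \<longrightarrow>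
     real (card (vertex_boundary G D)) \<ge> \<epsilon> * real (card D))"

section \<open>Circulant graphs\<close>

definition cayley_graph :: "'a monoid \<Rightarrow> 'a set \<Rightarrow> 'a pair_pre_digraph" where
  "cayley_graph G X = \<lparr> pverts = carrier G,
     parcs = {(x, y). x \<in> carrier G \<and> y \<in> carrier G \<and> y \<otimes>\<^bsub>G\<^esub> inv\<^bsub>G\<^esub> x \<in> X} \<rparr>"

definition circulant_graph :: "'a pair_pre_digraph \<Rightarrow> bool" where
  "circulant_graph \<Gamma> \<longleftrightarrow>
     (\<exists>G X. group G \<and> cyclic_group G \<and> X \<subseteq> carrier G \<and> \<Gamma> = cayley_graph G X)"

section \<open>The Weisfeiler-Leman algorithm\<close>

text \<open>
  Colors are names built up along the run, so that colors of different graphs can be compared.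
  The last constructor is for naive color refinement: the previous color of a vertex, and the
  multisets of colors of its out-neighbors and of its in-neighbors.
\<close>

datatype wl_col =
    Atomic "(bool \<times> bool) list list"
  | Refined wl_col "wl_col list multiset"
  | Naive_Refined wl_col "wl_col multiset" "wl_col multiset"

definition tuples :: "nat \<Rightarrow> 'a pair_pre_digraph \<Rightarrow> 'a list set" where
  "tuples m G = {x. length x = m \<and> set x \<subseteq> pverts G}"

definition atomic_col :: "'a pair_pre_digraph \<Rightarrow> 'a list \<Rightarrow> wl_col" where
  "atomic_col G x = Atomic (map (\<lambda>u. map (\<lambda>v. (u = v, (u, v) \<in> parcs G)) x) x)"

definition refine_col :: "'a pair_pre_digraph \<Rightarrow> ('a list \<Rightarrow> wl_col) \<Rightarrow> 'a list \<Rightarrow> wl_col" where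
  "refine_col G c x = Refined (c x)
     {# map (\<lambda>i. c (x[i := \<alpha>])) [0..<length x]. \<alpha> \<in># mset_set (pverts G) #}"

definition naive_refine_col ::
    "'a pair_pre_digraph \<Rightarrow> ('a list \<Rightarrow> wl_col) \<Rightarrow> 'a list \<Rightarrow> wl_col" where
  "naive_refine_col G c x = Naive_Refined (c x)
     {# c [w]. w \<in># mset_set {w \<in> pverts G. (hd x, w) \<in> parcs G} #}
     {# c [w]. w \<in># mset_set {w \<in> pverts G. (w, hd x) \<in> parcs G} #}"

text \<open>The color of an \<open>m\<close>-tuple after \<open>r\<close> rounds of the \<open>m\<close>-dimensional algorithm.\<close>

primrec wl_color :: "nat \<Rightarrow> 'a pair_pre_digraph \<Rightarrow> nat \<Rightarrow> 'a list \<Rightarrow> wl_col" where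
  "wl_color m G 0 = atomic_col G"
| "wl_color m G (Suc r) =
     (if m = 1 then naive_refine_col G (wl_color m G r) else refine_col G (wl_color m G r))"

text \<open>
  Running the algorithm in parallel on two graphs means to color the disjoint union of their sets
  of \<open>m\<close>-tuples; it stops when the partition of this union does not get finer any more.
  (Stopping when each of the two partitions is stable on its own would not do: for \<open>m = 1\<close> all
  loopless regular graphs of the same order would be equivalent, whatever their degrees.)
\<close>

definition wl_stable :: "nat \<Rightarrow> 'a pair_pre_digraph \<Rightarrow> 'b pair_pre_digraph \<Rightarrow> nat \<Rightarrow> bool" where
  "wl_stable m G H r \<longleftrightarrow>
     (let col = (\<lambda>r. case_sum (wl_color m G r) (wl_color m H r)) in
      \<forall>s \<in> tuples m G <+> tuples m H. \<forall>t \<in> tuples m G <+> tuples m H.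
        col r s = col r t \<longrightarrow> col (Suc r) s = col (Suc r) t)"

definition wl_rounds :: "nat \<Rightarrow> 'a pair_pre_digraph \<Rightarrow> 'b pair_pre_digraph \<Rightarrow> nat" where
  "wl_rounds m G H = (LEAST r. wl_stable m G H r)"

definition wl_equivalent ::
    "nat \<Rightarrow> 'a pair_pre_digraph \<Rightarrow> 'b pair_pre_digraph \<Rightarrow> bool" where
  "wl_equivalent m G H \<longleftrightarrow> (let r = wl_rounds m G H in
     \<forall>c. card {x \<in> tuples m G. wl_color m G r x = c} =
         card {x \<in> tuples m H. wl_color m H r x = c})"

text \<open>
  Every finite graph is isomorphic to one whose vertices are natural numbers, so the restriction
  of the type of \<open>H\<close> is harmless.
\<close>

definition wl_identifies :: "nat \<Rightarrow> 'a pair_pre_digraph \<Rightarrow> bool" where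
  "wl_identifies m G \<longleftrightarrow> (\<forall>H :: nat pair_pre_digraph.
     pair_fin_digraph H \<and> wl_equivalent m G H \<longrightarrow> digraph_iso (with_proj G) (with_proj H))"

text \<open>
  The minimum exists for every finite graph \<open>G\<close>: if \<open>m\<close> is the number of vertices, the atomic
  color of a tuple listing all vertices determines \<open>G\<close> up to isomorphism.
\<close>

definition wl_dimension :: "'a pair_pre_digraph \<Rightarrow> nat" where
  "wl_dimension G = (LEAST m. 1 \<le> m \<and> wl_identifies m G)"

end

theory Submission
  imports Defs "HOL-Number_Theory.Cong"
begin

text \<open>
  The circulant graph encodes a Cai--Fuerer--Immerman graph. Write the cyclic group of order \<open>n\<close> as
  \<open>A \<times> B\<close>, where \<open>A\<close> and \<open>B\<close> have order \<open>n\<^sub>1\<cdots>n\<^sub>b\<close> and \<open>n\<^sub>b\<^sub>+\<^sub>1\<cdots>n\<^sub>2\<^sub>b\<close>, and regard the elements of each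
  factor as words of mixed radix digits. Whether there is an arc between two elements depends only
  on the positions at which their \<open>A\<close>-parts and their \<open>B\<close>-parts first differ and on the leading
  digits of the two differences. A digit in \<open>\<int>/pq\<close> carries three signs: the signs modulo \<open>p\<close> and
  modulo \<open>q\<close>, and their product, and the group \<open>{\<plusminus>1}\<^sup>2\<close> acts on them with an even number of changes.
  So the positions in \<open>A\<close> serve as the vertices, and the positions in \<open>B\<close> as the edges, of a cubic
  base graph, and arcs encode equations between signs. Twisting one equation gives a graph which is
  not isomorphic to the original one, since the positions can be recovered by counting neighbors,
  and then the product of all equations yields \<open>1 = -1\<close>.

  In the pebble game on the two graphs, \<open>m\<close> elements of \<open>A\<close> branch at at most \<open>m\<close> positions, because
  the positions of first difference form an ultrametric. So the \<open>m\<close> pebbles fix at most \<open>2m\<close> nodes of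
  the base graph, and Duplicator can hide the twist elsewhere. As base graph a toroidal wall with
  \<open>h\<close> rows and \<open>h\<close> columns will do, \<open>h\<close> being of order \<open>\<surd>b\<close>: as long as \<open>2m + 2 < h\<close> there are a row
  and a column without fixed nodes, and the twist can be moved from one free row to any other
  along a free column.
\<close>

section \<open>Weisfeiler-Leman equivalence from a pebble game strategy\<close>

lemma tuples_finite: "finite (pverts G) \<Longrightarrow> finite (tuples m G)"
  using finite_lists_length_eq[of "pverts G" m] unfolding tuples_def
  by (simp add: conj_commute)

lemma card_tuples: "finite (pverts G) \<Longrightarrow> card (tuples m G) = card (pverts G) ^ m"
  using card_lists_length_eq[of "pverts G" m] unfolding tuples_def
  by (simp add: conj_commute)

lemma tuples_Suc: "tuples (Suc k) G = (\<lambda>(v, x). v # x) ` (pverts G \<times> tuples k G)"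
  by (auto simp: tuples_def length_Suc_conv image_iff)

text \<open>Every refined color keeps the previous color as its first component, so the atomic color
  can be read off from any later one.\<close>

lemma wl_color_eq_imp_atomic_eq:
  "wl_color m G r x = wl_color m H r y \<Longrightarrow> atomic_col G x = atomic_col H y"
  by (induction r) (auto simp: naive_refine_col_def refine_col_def split: if_splits)

lemma map_eq_map_iff:
  "length x = length y \<Longrightarrow> map f x = map g y \<longleftrightarrow> (\<forall>i<length x. f (x ! i) = g (y ! i))"
  by (auto simp: list_eq_iff_nth_eq)

lemma atomic_col_eq_iff:
  "atomic_col G x = atomic_col H y \<longleftrightarrow> length x = length y \<and>
     (\<forall>i<length x. \<forall>j<length x. (x ! i = x ! j \<longleftrightarrow> y ! i = y ! j) \<and>
        ((x ! i, x ! j) \<in> parcs G \<longleftrightarrow> (y ! i, y ! j) \<in> parcs H))"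
proof (cases "length x = length y")
  case True
  show ?thesis
    unfolding atomic_col_def wl_col.inject map_eq_map_iff[OF True] prod.inject using True by blast
next
  case False
  then show ?thesis by (auto simp: atomic_col_def dest: map_eq_imp_length_eq)
qed

text \<open>Arcs are pairs of vertices here, so \<open>f\<close> also determines the arc map that
  \<open>digraph_isomorphism\<close> asks for.\<close>

lemma digraph_iso_with_projI:
  assumes wf: "pair_wf_digraph G" "pair_wf_digraph H"
    and f: "bij_betw f (pverts G) (pverts H)"
    and arcs: "\<And>u v. u \<in> pverts G \<Longrightarrow> v \<in> pverts G \<Longrightarrow>
      (u, v) \<in> parcs G \<longleftrightarrow> (f u, f v) \<in> parcs H"
  shows "digraph_iso (with_proj G) (with_proj H)"
proof -
  interpret G: pair_wf_digraph G by fact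
  interpret H: pair_wf_digraph H by fact
  let ?h = "\<lparr>iso_verts = f, iso_arcs = map_prod f f, iso_head = snd, iso_tail = fst\<rparr>"
  have inj: "inj_on f (pverts G)" and img: "f ` pverts G = pverts H"
    using f by (auto simp: bij_betw_def)
  have "inj_on (map_prod f f) (parcs G)"
    using inj by (intro inj_onI) (force dest: inj_onD G.in_arcsD1 G.in_arcsD2)
  then have 1: "pre_digraph.digraph_isomorphism (with_proj G) ?h"
    using inj G.wf_digraph_axioms by (auto simp: pre_digraph.digraph_isomorphism_def)
  have "map_prod f f ` parcs G = parcs H"
  proof (intro equalityI subsetI)
    fix e assume "e \<in> map_prod f f ` parcs G"
    then show "e \<in> parcs H" using arcs by (auto dest: G.in_arcsD1 G.in_arcsD2)
  next
    fix e assume e: "e \<in> parcs H"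
    obtain u v where uv: "e = (u, v)" by force
    with e have "u \<in> f ` pverts G" "v \<in> f ` pverts G"
      using img H.in_arcsD1 H.in_arcsD2 by auto
    then obtain u' v' where "u' \<in> pverts G" "v' \<in> pverts G" "u = f u'" "v = f v'" by auto
    with e uv arcs show "e \<in> map_prod f f ` parcs G" by force
  qed
  with img have "with_proj H = app_iso ?h (with_proj G)"
    by (simp add: app_iso_def with_proj_def)
  with 1 show ?thesis unfolding digraph_iso_def by blast
qed

lemma digraph_iso_with_projD:
  assumes "digraph_iso (with_proj G) (with_proj H)"
  obtains f where "bij_betw f (pverts G) (pverts H)"
    and "\<And>u v. u \<in> pverts G \<Longrightarrow> v \<in> pverts G \<Longrightarrow>
      (u, v) \<in> parcs G \<longleftrightarrow> (f u, f v) \<in> parcs H"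
proof -
  obtain h where h: "pre_digraph.digraph_isomorphism (with_proj G) h"
    and H: "with_proj H = app_iso h (with_proj G)"
    using assms unfolding digraph_iso_def by blast
  have wf: "wf_digraph (with_proj G)" and inj: "inj_on (iso_verts h) (pverts G)"
    and ht: "\<And>e. e \<in> parcs G \<Longrightarrow> iso_verts h (fst e) = iso_tail h (iso_arcs h e)"
      "\<And>e. e \<in> parcs G \<Longrightarrow> iso_verts h (snd e) = iso_head h (iso_arcs h e)"
    using h by (auto simp: pre_digraph.digraph_isomorphism_def)
  have vH: "pverts H = iso_verts h ` pverts G" and aH: "parcs H = iso_arcs h ` parcs G"
    and t: "iso_tail h = fst" "iso_head h = snd"
    using H by (auto simp: app_iso_def with_proj_def)
  have ia: "iso_arcs h e = (iso_verts h (fst e), iso_verts h (snd e))" if "e \<in> parcs G" for e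
    using ht[OF that] t by simp
  show ?thesis
  proof
    show "bij_betw (iso_verts h) (pverts G) (pverts H)"
      using inj vH by (simp add: bij_betw_def)
    fix u v assume uv: "u \<in> pverts G" "v \<in> pverts G"
    show "(u, v) \<in> parcs G \<longleftrightarrow> (iso_verts h u, iso_verts h v) \<in> parcs H"
    proof
      assume "(u, v) \<in> parcs G"
      then show "(iso_verts h u, iso_verts h v) \<in> parcs H"
        using ia aH by (metis fst_conv image_eqI snd_conv)
    next
      assume "(iso_verts h u, iso_verts h v) \<in> parcs H"
      then obtain e where e: "e \<in> parcs G"
        "iso_verts h (fst e) = iso_verts h u" "iso_verts h (snd e) = iso_verts h v"
        using ia aH by auto
      have "fst e \<in> pverts G" "snd e \<in> pverts G"
        using wf e(1) wf_digraph.tail_in_verts wf_digraph.head_in_verts by fastforce+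
      with e uv inj have "fst e = u" "snd e = v" by (auto dest: inj_onD)
      with e(1) show "(u, v) \<in> parcs G" by (metis prod.collapse)
    qed
  qed
qed

section \<open>Existence of the dimension\<close>

lemma wl_equivalent_card:
  assumes fin: "finite (pverts G)" "finite (pverts H)" and m: "m \<ge> 1"
    and eq: "wl_equivalent m G H"
  shows "card (pverts G) = card (pverts H)"
proof -
  define r where "r = wl_rounds m G H"
  let ?C = "wl_color m G r ` tuples m G \<union> wl_color m H r ` tuples m H"
  have cnt: "card {x \<in> tuples m G. wl_color m G r x = c} =
      card {x \<in> tuples m H. wl_color m H r x = c}" for c
    using eq by (simp add: wl_equivalent_def r_def Let_def)
  have finT: "finite (tuples m G)" "finite (tuples m H)" "finite ?C"
    using fin by (auto intro: tuples_finite)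
  \<comment> \<open>Summing the equal counts over all colors shows that both graphs have the same
    number of \<open>m\<close>-tuples, and \<open>m \<ge> 1\<close> permits taking the root.\<close>
  have "card (tuples m G) = (\<Sum>c\<in>?C. card {x \<in> tuples m G. wl_color m G r x = c})"
    using sum.group[OF finT(1) finT(3), of "wl_color m G r" "\<lambda>_. 1::nat"] by auto
  also have "\<dots> = (\<Sum>c\<in>?C. card {x \<in> tuples m H. wl_color m H r x = c})"
    using cnt by simp
  also have "\<dots> = card (tuples m H)"
    using sum.group[OF finT(2) finT(3), of "wl_color m H r" "\<lambda>_. 1::nat"] by auto
  finally have "card (pverts G) ^ m = card (pverts H) ^ m"
    using fin by (simp add: card_tuples)
  then show ?thesis using m by (simp add: power_eq_iff_eq_base)
qed

text \<open>A tuple \<open>x\<close> listing all vertices of \<open>G\<close> has a partner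
  \<open>y\<close> over \<open>H\<close> of the same color, since the color of \<open>x\<close>
  occurs equally often in \<open>H\<close>. Equality of the atomic colors then says that
  \<open>x ! i \<mapsto> y ! i\<close> is an isomorphism.\<close>

lemma wl_identifies_card:
  fixes G :: "'a pair_pre_digraph"
  assumes G: "pair_fin_digraph G" and ne: "pverts G \<noteq> {}"
  shows "wl_identifies (card (pverts G)) G"
  unfolding wl_identifies_def
proof (intro allI impI, elim conjE)
  fix H :: "nat pair_pre_digraph"
  assume H: "pair_fin_digraph H" and eq: "wl_equivalent (card (pverts G)) G H"
  interpret G: pair_fin_digraph G by fact
  interpret H: pair_fin_digraph H by fact
  let ?m = "card (pverts G)"
  define r where "r = wl_rounds ?m G H"
  have fin: "finite (pverts G)" "finite (pverts H)"
    using G.pair_finite_verts H.pair_finite_verts by auto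
  have m: "?m \<ge> 1" using fin ne by (simp add: Suc_leI card_gt_0_iff)
  have card_eq: "?m = card (pverts H)" using wl_equivalent_card[OF fin m eq] .
  obtain x where x: "set x = pverts G" "distinct x" "length x = ?m"
    using fin(1) finite_distinct_list distinct_card by metis
  then have "x \<in> {z \<in> tuples ?m G. wl_color ?m G r z = wl_color ?m G r x}"
    by (auto simp: tuples_def)
  then have "card {z \<in> tuples ?m G. wl_color ?m G r z = wl_color ?m G r x} > 0"
    using tuples_finite[OF fin(1), of ?m] by (auto simp: card_gt_0_iff)
  then have "card {z \<in> tuples ?m H. wl_color ?m H r z = wl_color ?m G r x} > 0"
    using eq by (simp add: wl_equivalent_def r_def Let_def)
  then obtain y where y: "y \<in> tuples ?m H" "wl_color ?m G r x = wl_color ?m H r y"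
    by (metis (mono_tags, lifting) card_gt_0_iff empty_Collect_eq)
  have len: "length x = length y"
    and xy: "\<And>i j. i < ?m \<Longrightarrow> j < ?m \<Longrightarrow> (x ! i = x ! j \<longleftrightarrow> y ! i = y ! j) \<and>
        ((x ! i, x ! j) \<in> parcs G \<longleftrightarrow> (y ! i, y ! j) \<in> parcs H)"
    using wl_color_eq_imp_atomic_eq[OF y(2)] x(3) by (auto simp: atomic_col_eq_iff)
  have dy: "distinct y"
    using xy x(2,3) len unfolding distinct_conv_nth by metis
  have sy: "set y = pverts H"
    using y(1) dy card_eq fin(2) by (intro card_subset_eq) (auto simp: tuples_def distinct_card)
  have bx: "bij_betw (nth x) {..<?m} (pverts G)"
    using x bij_betw_nth[OF x(2), of "{..<?m}"] by auto
  have by': "bij_betw (nth y) {..<?m} (pverts H)"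
    using sy dy len x(3) bij_betw_nth[OF dy, of "{..<?m}"] by auto
  define f where "f = nth y \<circ> the_inv_into {..<?m} (nth x)"
  have f: "bij_betw f (pverts G) (pverts H)"
    unfolding f_def using bij_betw_trans[OF bij_betw_the_inv_into[OF bx] by'] .
  have fx: "f (x ! i) = y ! i" if "i < ?m" for i
    using that bx by (simp add: f_def bij_betw_def the_inv_into_f_f)
  show "digraph_iso (with_proj G) (with_proj H)"
  proof (rule digraph_iso_with_projI[OF _ _ f])
    show "pair_wf_digraph G" "pair_wf_digraph H" by unfold_locales
    fix u v assume "u \<in> pverts G" "v \<in> pverts G"
    then obtain i j where "i < ?m" "j < ?m" "u = x ! i" "v = x ! j"
      using x by (metis in_set_conv_nth)
    then show "(u, v) \<in> parcs G \<longleftrightarrow> (f u, f v) \<in> parcs H"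
      using fx xy by metis
  qed
qed

text \<open>The minimum in \<open>wl_dimension\<close> is attained, with the number of vertices as a
  witness; so a bound for all identifying \<open>m\<close> is a bound for the dimension.\<close>

lemma wl_dimension_geI:
  assumes "pair_fin_digraph G" "pverts G \<noteq> {}"
    and "\<And>m. 1 \<le> m \<Longrightarrow> wl_identifies m G \<Longrightarrow> k \<le> m"
  shows "k \<le> wl_dimension G"
proof -
  interpret pair_fin_digraph G by fact
  have "1 \<le> card (pverts G)"
    using assms(2) pair_finite_verts by (simp add: Suc_leI card_gt_0_iff)
  with wl_identifies_card[OF assms(1,2)]
  have "1 \<le> wl_dimension G \<and> wl_identifies (wl_dimension G) G"
    unfolding wl_dimension_def by (intro LeastI[of "\<lambda>m. 1 \<le> m \<and> wl_identifies m G"]) auto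
  with assms(3) show ?thesis by auto
qed

text \<open>
  A winning strategy of Duplicator in the bijective \<open>(m + 1)\<close>-pebble game, with the positions
  recorded as partial isomorphisms \<open>f\<close> with domain \<open>X\<close>.
\<close>

locale pebble_strategy =
  fixes G :: "'a pair_pre_digraph" and H :: "'b pair_pre_digraph"
    and m :: nat and Good :: "('a \<Rightarrow> 'b) \<Rightarrow> 'a set \<Rightarrow> bool"
  assumes finG: "finite (pverts G)" and finH: "finite (pverts H)" and m1: "1 \<le> m"
    and partial_iso: "Good f X \<Longrightarrow> u \<in> X \<Longrightarrow> v \<in> X \<Longrightarrow> 
      f u \<in> pverts H \<and> (u = v \<longleftrightarrow> f u = f v) \<and> ((u, v) \<in> parcs G \<longleftrightarrow> (f u, f v) \<in> parcs H)"
    and good_subset: "Good f X \<Longrightarrow> Y \<subseteq> X \<Longrightarrow> Good f Y"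
    and extend: "Good f X \<Longrightarrow> finite X \<Longrightarrow> X \<subseteq> pverts G \<Longrightarrow> card X \<le> m \<Longrightarrow>
      \<exists>g. bij_betw g (pverts G) (pverts H) \<and>
        (\<forall>v\<in>pverts G. \<exists>f'. Good f' (insert v X) \<and> f' v = g v \<and> (\<forall>x\<in>X. f' x = f x))"
    and start: "\<exists>f. Good f {}"
begin

section \<open>From a strategy to equal color counts\<close>

definition pos :: "'a list \<Rightarrow> 'b list \<Rightarrow> bool" where
  "pos x y \<longleftrightarrow> set x \<subseteq> pverts G \<and> (\<exists>f. Good f (set x) \<and> y = map f x)"

text \<open>Any pair of tuples whose matched entries come from \<open>x\<close>, \<open>y\<close> or
  the new pair \<open>(v, g v)\<close> is again a position. This one form covers replacing an entry,
  prepending an entry and, for \<open>m = 1\<close>, pairing a vertex with a possible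
  neighbor.\<close>

lemma pos_extend:
  assumes "pos x y" "length x \<le> m"
  obtains g where "bij_betw g (pverts G) (pverts H)"
    and "\<And>v x' y'. v \<in> pverts G \<Longrightarrow> set (zip x' y') \<subseteq> insert (v, g v) (set (zip x y)) \<Longrightarrow>
           length x' = length y' \<Longrightarrow> pos x' y'"
proof -
  obtain f where f: "Good f (set x)" "y = map f x" and x: "set x \<subseteq> pverts G"
    using assms(1) by (auto simp: pos_def)
  have "card (set x) \<le> m" using assms(2) card_length le_trans by blast
  then obtain g where g: "bij_betw g (pverts G) (pverts H)"
    and ext: "\<forall>v\<in>pverts G. \<exists>f'. Good f' (insert v (set x)) \<and> f' v = g v \<and> (\<forall>x\<in>set x. f' x = f x)"
    using extend[OF f(1) _ x] by auto
  show ?thesis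
  proof
    show "bij_betw g (pverts G) (pverts H)" by fact
    fix v x' y' assume v: "v \<in> pverts G"
      and sub: "set (zip x' y') \<subseteq> insert (v, g v) (set (zip x y))"
      and len: "length x' = length (y' :: 'b list)"
    obtain f' where f': "Good f' (insert v (set x))" "f' v = g v" "\<And>a. a \<in> set x \<Longrightarrow> f' a = f a"
      using ext v by blast
    have z: "set (zip x y) = {(a, f a) |a. a \<in> set x}"
      unfolding f(2) by (auto simp: set_zip in_set_conv_nth)
    have nth: "(x' ! i, y' ! i) \<in> insert (v, g v) {(a, f a) |a. a \<in> set x}" if "i < length x'" for i
      using that sub len z by (auto simp: set_zip)
    have 1: "x' ! i \<in> insert v (set x) \<and> y' ! i = f' (x' ! i)" if "i < length x'" for i
      using nth[OF that] f'(2,3) by auto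
    then have "set x' \<subseteq> insert v (set x)" by (metis in_set_conv_nth subsetI)
    moreover have "y' = map f' x'" using 1 len by (auto simp: list_eq_iff_nth_eq)
    ultimately show "pos x' y'"
      unfolding pos_def using good_subset[OF f'(1)] v x by blast
  qed
qed

lemma pos_atomic: "pos x y \<Longrightarrow> atomic_col G x = atomic_col H y"
  unfolding pos_def atomic_col_eq_iff using partial_iso by (auto 0 3)

text \<open>Induction on the rounds: Duplicator's bijection \<open>g\<close> carries the multiset
  over \<open>G\<close> to the multiset over \<open>H\<close>, because the tuples it matches are
  positions and so had equal colors one round earlier.\<close>

lemma pos_color: "pos x y \<Longrightarrow> length x = m \<Longrightarrow> wl_color m G r x = wl_color m H r y"
proof (induction r arbitrary: x y)
  case 0
  then show ?case by (simp add: pos_atomic)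
next
  case (Suc r)
  have len: "length y = m" using Suc.prems by (auto simp: pos_def)
  obtain g where g: "bij_betw g (pverts G) (pverts H)"
    and ext: "\<And>v x' y'. v \<in> pverts G \<Longrightarrow> set (zip x' y') \<subseteq> insert (v, g v) (set (zip x y)) \<Longrightarrow>
           length x' = length y' \<Longrightarrow> pos x' y'"
    using pos_extend[OF Suc.prems(1)] Suc.prems(2) by blast
  have gm: "mset_set (pverts H) = image_mset g (mset_set (pverts G))"
    using g by (metis bij_betw_def image_mset_mset_set)
  have IH: "wl_color m G r x = wl_color m H r y" by (rule Suc.IH) fact+
  show ?case
  proof (cases "m = 1")
    case True
    obtain a where a: "x = [a]" using Suc.prems(2) True by (metis One_nat_def length_0_conv length_Suc_conv)
    obtain b where b: "y = [b]" using len True by (metis One_nat_def length_0_conv length_Suc_conv)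
    have col: "wl_color m G r [v] = wl_color m H r [g v]" if "v \<in> pverts G" for v
      by (rule Suc.IH, rule ext[OF that]) (auto simp: True)
    have arcs: "((a, v) \<in> parcs G \<longleftrightarrow> (b, g v) \<in> parcs H) \<and> ((v, a) \<in> parcs G \<longleftrightarrow> (g v, b) \<in> parcs H)"
      if "v \<in> pverts G" for v
    proof -
      \<comment> \<open>Single entries do not show adjacency; the second pebble, which the game for
        \<open>m = 1\<close> also has, supplies it.\<close>
      have "pos [a, v] [b, g v]" by (rule ext[OF that]) (auto simp: a b)
      from pos_atomic[OF this] show ?thesis by (auto simp: atomic_col_def)
    qed
    have inj: "inj_on g (pverts G)" and img: "g ` pverts G = pverts H"
      using g by (auto simp: bij_betw_def)
    have out: "{w \<in> pverts H. (b, w) \<in> parcs H} = g ` {w \<in> pverts G. (a, w) \<in> parcs G}"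
      and inn: "{w \<in> pverts H. (w, b) \<in> parcs H} = g ` {w \<in> pverts G. (w, a) \<in> parcs G}"
      unfolding img[symmetric] using arcs by auto
    have m: "mset_set (g ` S) = image_mset g (mset_set S)" if "S \<subseteq> pverts G" for S
      using inj_on_subset[OF inj that] by (simp add: image_mset_mset_set)
    have e: "image_mset (\<lambda>w. wl_color m H r [w]) (mset_set (g ` S)) =
        image_mset (\<lambda>w. wl_color m G r [w]) (mset_set S)" if "S \<subseteq> pverts G" for S
      unfolding m[OF that] using col that finite_subset[OF that finG]
      by (auto simp: image_mset.compositionality intro!: image_mset_cong)
    have l: "list.hd x = a" "list.hd y = b" using a b by auto
    show ?thesis
      unfolding wl_color.simps if_P[OF True] naive_refine_col_def l out inn
      using IH by (simp add: e)
  next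
    case False
    have "map (\<lambda>i. wl_color m G r (x[i := v])) [0..<length x] =
        map (\<lambda>i. wl_color m H r (y[i := g v])) [0..<length y]" if v: "v \<in> pverts G" for v
    proof -
      have "pos (x[i := v]) (y[i := g v])" for i
      proof (rule ext[OF v])
        show "set (zip (x[i := v]) (y[i := g v])) \<subseteq> insert (v, g v) (set (zip x y))"
          using set_update_subset_insert[of "zip x y" i "(v, g v)"] by (simp add: update_zip)
      qed (use len Suc.prems in auto)
      then show ?thesis using len Suc.prems(2) Suc.IH by simp
    qed
    then have "{#map (\<lambda>i. wl_color m G r (x[i := \<alpha>])) [0..<length x]. \<alpha> \<in># mset_set (pverts G)#} =
       {#map (\<lambda>i. wl_color m H r (y[i := \<alpha>])) [0..<length y]. \<alpha> \<in># mset_set (pverts H)#}"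
      unfolding gm using finG by (auto simp: image_mset.compositionality intro!: image_mset_cong)
    then show ?thesis using False IH by (simp add: refine_col_def)
  qed
qed

text \<open>Comparing color counts takes one bijection between all tuples. It is assembled entry by
  entry, the bijection used for the head depending on the tail.\<close>

lemma pos_bij:
  "k \<le> m \<Longrightarrow> \<exists>F. bij_betw F (tuples k G) (tuples k H) \<and> (\<forall>x\<in>tuples k G. pos x (F x))"
proof (induction k)
  case 0
  have "pos [] []" using start by (auto simp: pos_def)
  then show ?case by (intro exI[of _ "\<lambda>_. []"]) (auto simp: tuples_def bij_betw_def inj_on_def)
next
  case (Suc k)
  then obtain F where F: "bij_betw F (tuples k G) (tuples k H)"
    and p: "\<And>x. x \<in> tuples k G \<Longrightarrow> pos x (F x)" by auto
  have "\<exists>g. bij_betw g (pverts G) (pverts H) \<and> (\<forall>v\<in>pverts G. pos (v # x) (g v # F x))"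
    if x: "x \<in> tuples k G" for x
  proof -
    have "length (F x) = length x" using p[OF x] by (auto simp: pos_def)
    moreover have "length x \<le> m" using x Suc.prems by (simp add: tuples_def)
    ultimately obtain h where "bij_betw h (pverts G) (pverts H)"
      and "\<And>v x' y'. v \<in> pverts G \<Longrightarrow> set (zip x' y') \<subseteq> insert (v, h v) (set (zip x (F x))) \<Longrightarrow>
           length x' = length y' \<Longrightarrow> pos x' y'"
      using pos_extend[OF p[OF x]] by blast
    with \<open>length (F x) = length x\<close> show ?thesis by (intro exI[of _ h]) simp
  qed
  then obtain g where g: "\<And>x. x \<in> tuples k G \<Longrightarrow> bij_betw (g x) (pverts G) (pverts H)"
    and gp: "\<And>x v. x \<in> tuples k G \<Longrightarrow> v \<in> pverts G \<Longrightarrow> pos (v # x) (g x v # F x)"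
    by metis
  define F' where "F' = (\<lambda>l. g (tl l) (list.hd l) # F (tl l))"
  have "inj_on F' (tuples (Suc k) G)"
  proof (rule inj_onI)
    fix s t assume "s \<in> tuples (Suc k) G" "t \<in> tuples (Suc k) G" and eq: "F' s = F' t"
    then obtain v x w y where st: "s = v # x" "t = w # y"
      and vw: "v \<in> pverts G" "w \<in> pverts G" and xy: "x \<in> tuples k G" "y \<in> tuples k G"
      by (auto simp: tuples_Suc)
    have "F x = F y" using eq by (simp add: st F'_def)
    with F xy have "x = y" by (auto simp: bij_betw_def dest: inj_onD)
    moreover from this have "v = w"
      using eq g[OF xy(1)] vw by (auto simp: st F'_def bij_betw_def dest: inj_onD)
    ultimately show "s = t" by (simp add: st)
  qed
  moreover have "F' ` tuples (Suc k) G = tuples (Suc k) H"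
  proof (intro equalityI subsetI)
    fix y assume "y \<in> F' ` tuples (Suc k) G"
    then obtain v x where "v \<in> pverts G" "x \<in> tuples k G" "y = g x v # F x"
      by (auto simp: tuples_Suc F'_def)
    moreover from this have "g x v \<in> pverts H" "F x \<in> tuples k H"
      using F g by (auto simp: bij_betw_def)
    ultimately show "y \<in> tuples (Suc k) H" by (auto simp: tuples_Suc)
  next
    fix y assume "y \<in> tuples (Suc k) H"
    then obtain w z where y: "y = w # z" "w \<in> pverts H" "z \<in> tuples k H" by (auto simp: tuples_Suc)
    then obtain x where x: "x \<in> tuples k G" "F x = z" using F by (metis bij_betw_iff_bijections)
    then obtain v where v: "v \<in> pverts G" "g x v = w" using g y(2) by (force simp: bij_betw_def)
    show "y \<in> F' ` tuples (Suc k) G"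
      using x v y by (intro image_eqI[of _ _ "v # x"]) (auto simp: F'_def tuples_Suc)
  qed
  ultimately show ?case
    using gp by (intro exI[of _ F']) (auto simp: bij_betw_def tuples_Suc F'_def)
qed

text \<open>The counts agree after every number of rounds, in particular after the one at which the
  parallel run stops.\<close>

theorem equivalent: "wl_equivalent m G H"
proof -
  obtain F where F: "bij_betw F (tuples m G) (tuples m H)"
    and p: "\<And>x. x \<in> tuples m G \<Longrightarrow> pos x (F x)" using pos_bij[of m] by auto
  have "card {x \<in> tuples m G. wl_color m G r x = c} = card {x \<in> tuples m H. wl_color m H r x = c}"
    for r c
  proof (rule bij_betw_same_card)
    have "wl_color m G r x = wl_color m H r (F x)" if "x \<in> tuples m G" for x
      using pos_color[OF p[OF that]] that by (simp add: tuples_def)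
    then show "bij_betw F {x \<in> tuples m G. wl_color m G r x = c} {x \<in> tuples m H. wl_color m H r x = c}"
      by (intro bij_betw_Collect[OF F]) simp
  qed
  then show ?thesis by (simp add: wl_equivalent_def)
qed

end

section \<open>Leading digits in mixed radix systems\<close>

text \<open>A sign on residues modulo an odd \<open>m\<close>, positive on the lower half. What
  matters is that it is odd away from 0 and equals 1 at 1.\<close>

definition sg :: "int \<Rightarrow> int \<Rightarrow> int" where
  "sg m t = (if 2 * (t mod m) < m then 1 else -1)"

lemma sg_cong: "[t = t'] (mod m) \<Longrightarrow> sg m t = sg m t'"
  by (simp add: sg_def cong_def)

lemma sg_cases: "sg m t = 1 \<or> sg m t = -1"
  by (simp add: sg_def)

lemma sg_minus:
  assumes "odd m" "m > 0" "\<not> m dvd t"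
  shows "sg m (- t) = - sg m t"
proof -
  have "(- t) mod m = m - t mod m" using assms(3) by (simp add: zmod_zminus1_eq_if mod_eq_0_iff_dvd)
  moreover have "2 * (t mod m) \<noteq> m" using assms(1) by (metis even_mult_iff even_numeral)
  ultimately show ?thesis by (simp add: sg_def)
qed

lemma sg_one: "m \<ge> 3 \<Longrightarrow> sg m 1 = 1"
  by (simp add: sg_def)

section \<open>Residue classes and the Chinese remainder theorem\<close>

lemma crt_int:
  fixes a b m n :: int
  assumes "coprime m n"
  obtains x where "[x = a] (mod m)" "[x = b] (mod n)"
  using binary_chinese_remainder_int[OF assms] by blast

lemma card_residue_class:
  fixes n P x :: int
  assumes "P > 0" "P dvd n" "n > 0"
  shows "int (card {z \<in> {0..<n}. P dvd z - x}) = n div P"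
proof -
  obtain k where k: "n = P * k" using assms(2) by auto
  have kpos: "k > 0" using assms k by (simp add: zero_less_mult_iff)
  have "bij_betw (\<lambda>i. x mod P + P * i) {0..<k} {z \<in> {0..<n}. P dvd z - x}"
  proof (rule bij_betw_byWitness[where f' = "\<lambda>z. z div P"])
    show "\<forall>a\<in>{0..<k}. (x mod P + P * a) div P = a"
      using assms(1) by simp
    show "\<forall>a'\<in>{z \<in> {0..<n}. P dvd z - x}. x mod P + P * (a' div P) = a'"
    proof
      fix z assume "z \<in> {z \<in> {0..<n}. P dvd z - x}"
      then have "z mod P = x mod P" by (simp add: mod_eq_dvd_iff)
      then show "x mod P + P * (z div P) = z" by (metis add.commute mult_div_mod_eq)
    qed
    show "(\<lambda>i. x mod P + P * i) ` {0..<k} \<subseteq> {z \<in> {0..<n}. P dvd z - x}"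
    proof clarify
      fix i assume i: "i \<in> {0..<k}"
      have "x mod P < P" "0 \<le> x mod P" using assms(1) by auto
      moreover have "P * i \<ge> 0" using i assms(1) by simp
      moreover have "P * (i + 1) \<le> P * k" using i assms(1) by (intro mult_left_mono) auto
      ultimately have "x mod P + P * i \<in> {0..<n}" by (simp add: k distrib_left)
      moreover have "P dvd x mod P + P * i - x"
      proof -
        have "x mod P + P * i - x = P * (i - x div P)"
          by (simp add: right_diff_distrib minus_mult_div_eq_mod [symmetric])
        then show ?thesis by simp
      qed
      ultimately show "x mod P + P * i \<in> {0..<n} \<and> P dvd x mod P + P * i - x" by simp
    qed
    show "(\<lambda>z. z div P) ` {z \<in> {0..<n}. P dvd z - x} \<subseteq> {0..<k}"
    proof clarify
      fix z assume z: "z \<in> {0..<n}"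
      have "P * (z div P) \<le> z" using assms(1) by (simp add: minus_mod_eq_mult_div [symmetric])
      also have "z < P * k" using z k by simp
      finally show "z div P \<in> {0..<k}" using z assms(1) by (simp add: pos_imp_zdiv_nonneg_iff)
    qed
  qed
  then have "card {z \<in> {0..<n}. P dvd z - x} = nat k"
    using bij_betw_same_card by fastforce
  then show ?thesis using k kpos assms(1) by simp
qed

text \<open>Say \<open>p\<close> does not divide \<open>t\<close>. A number divisible by
  \<open>p\<close> then differs from \<open>t\<close> modulo \<open>p\<close>. Modulo
  \<open>q\<close> it may be prescribed as 1, 2 or 3, which are nonzero and distinct as
  \<open>q \<ge> 5\<close>, and at most one of them is congruent to \<open>t\<close>. The two others
  give \<open>u\<close> and \<open>v\<close>.\<close>

lemma two_nonunits:
  fixes p q t :: int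
  assumes "coprime p q" "5 \<le> p" "5 \<le> q" "\<not> p * q dvd t"
  obtains u v where "\<not> p * q dvd u - v" 
    "\<And>x. x \<in> {u, v} \<Longrightarrow> \<not> p * q dvd x \<and> (p dvd x \<or> q dvd x) \<and> \<not> p dvd x - t \<and> \<not> q dvd x - t"
proof -
  have *: "\<exists>u v. \<not> p * q dvd u - v \<and> (\<forall>x\<in>{u, v}. \<not> p * q dvd x \<and> (p dvd x \<or> q dvd x) \<and> \<not> p dvd x - t \<and> \<not> q dvd x - t)"
    if pq: "coprime p q" "5 \<le> q" "\<not> p dvd t" for p q :: int
  proof -
    have small: "\<not> q dvd a - b" if "a \<noteq> b" "a \<in> {0, 1, 2, 3}" "b \<in> {0, 1, 2, 3}" for a b
    proof
      assume "q dvd a - b"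
      moreover have "a - b \<noteq> 0" "\<bar>a - b\<bar> < q" using that pq(2) by auto
      ultimately show False using zdvd_not_zless[of "\<bar>a - b\<bar>" q] by auto
    qed
    have "\<exists>a b. a \<noteq> b \<and> a \<in> {1, 2, 3} \<and> b \<in> {1, 2, 3} \<and> \<not> q dvd a - t \<and> \<not> q dvd b - t"
    proof -
      have "\<not> (q dvd a - t \<and> q dvd b - t)" if "a \<noteq> b" "a \<in> {1, 2, 3}" "b \<in> {1, 2, 3}" for a b
      proof
        assume "q dvd a - t \<and> q dvd b - t"
        then have "q dvd (a - t) - (b - t)" using dvd_diff by blast
        then show False using small[of a b] that by auto
      qed
      from this[of 1 2] this[of 1 3] this[of 2 3]
      have "(\<not> q dvd 1 - t \<and> \<not> q dvd 2 - t) \<or> (\<not> q dvd 1 - t \<and> \<not> q dvd 3 - t) \<or>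
            (\<not> q dvd 2 - t \<and> \<not> q dvd 3 - t)" by auto
      then show ?thesis
      proof (elim disjE)
        assume "\<not> q dvd 1 - t \<and> \<not> q dvd 2 - t"
        then show ?thesis by (intro exI[of _ 1] exI[of _ 2]) simp
      next
        assume "\<not> q dvd 1 - t \<and> \<not> q dvd 3 - t"
        then show ?thesis by (intro exI[of _ 1] exI[of _ 3]) simp
      next
        assume "\<not> q dvd 2 - t \<and> \<not> q dvd 3 - t"
        then show ?thesis by (intro exI[of _ 2] exI[of _ 3]) simp
      qed
    qed
    then obtain a b where ab: "a \<noteq> b" "a \<in> {1, 2, 3}" "b \<in> {1, 2, 3}" "\<not> q dvd a - t" "\<not> q dvd b - t"
      by blast
    obtain u where u: "[u = 0] (mod p)" "[u = a] (mod q)" using crt_int[OF pq(1)] .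
    obtain v where v: "[v = 0] (mod p)" "[v = b] (mod q)" using crt_int[OF pq(1)] .
    have P: "\<not> p * q dvd x \<and> (p dvd x \<or> q dvd x) \<and> \<not> p dvd x - t \<and> \<not> q dvd x - t"
      if x: "[x = 0] (mod p)" "[x = c] (mod q)" "c \<in> {1, 2, 3}" "\<not> q dvd c - t" for x c
    proof -
      have px: "p dvd x" using x(1) by (simp add: cong_0_iff)
      have "\<not> q dvd x" using x(2) small[of c 0] x(3) by (auto simp: cong_dvd_iff)
      moreover have "\<not> p dvd x - t" using px pq(3) by (simp add: dvd_diff_right_iff)
      moreover have "\<not> q dvd x - t"
        using x(2,4) cong_dvd_iff[of "x - t" "c - t" q] cong_diff[OF x(2) cong_refl[of t]] by simp
      ultimately show ?thesis using px by (auto dest: dvd_mult_right)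
    qed
    have "\<not> q dvd u - v"
    proof -
      have "[u - v = a - b] (mod q)" using cong_diff[OF u(2) v(2)] .
      then show ?thesis using small[of a b] ab by (auto simp: cong_dvd_iff)
    qed
    then have "\<not> p * q dvd u - v" by (auto dest: dvd_mult_right)
    with P[OF u ab(2,4)] P[OF v ab(3,5)] show ?thesis by blast
  qed
  have "\<not> p dvd t \<or> \<not> q dvd t" using assms(1,4) by (auto intro: divides_mult)
  then show ?thesis
  proof
    assume "\<not> p dvd t"
    from *[OF assms(1,3) this] show ?thesis using that by blast
  next
    assume "\<not> q dvd t"
    from *[OF _ assms(2) this] assms(1) show ?thesis
      using that by (auto simp: coprime_commute mult.commute) 
  qed
qed

text \<open>
  A chain of moduli \<open>Pr 0 dvd Pr 1 dvd \<dots> dvd Pr k\<close> is a mixed radix system. The leading digit of the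
  difference of two numbers needs no carries, which is what makes the following relations
  invariant under translations and under very local changes of digits.
\<close>

locale ladder =
  fixes G :: int and k :: nat and p q :: "nat \<Rightarrow> int"
  assumes G_pos: "G > 0"
    and pq: "\<And>i. i < k \<Longrightarrow> 5 \<le> p i \<and> 5 \<le> q i \<and> odd (p i) \<and> odd (q i) \<and> coprime (p i) (q i)"
begin

section \<open>Levels, leading digits and their signs\<close>

definition Pr :: "nat \<Rightarrow> int" where "Pr i = G * (\<Prod>t<i. p t * q t)"
text \<open>The position of the leading digit. A difference has no level below \<open>k\<close>
  exactly if \<open>G\<close> does not divide it or \<open>Pr k\<close> does.\<close>

definition lev :: "nat \<Rightarrow> int \<Rightarrow> bool" where "lev i d \<longleftrightarrow> Pr i dvd d \<and> \<not> Pr (Suc i) dvd d"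
definition dig :: "nat \<Rightarrow> int \<Rightarrow> int" where "dig i d = d div Pr i"
text \<open>Both signs of the leading digit are meaningful: it is nonzero modulo each factor, so
  that both signs change under \<open>d \<mapsto> - d\<close>.\<close>

definition unit :: "nat \<Rightarrow> int \<Rightarrow> bool" where
  "unit i d \<longleftrightarrow> Pr i dvd d \<and> \<not> p i dvd dig i d \<and> \<not> q i dvd dig i d"
definition s1 :: "nat \<Rightarrow> int \<Rightarrow> int" where "s1 i d = sg (p i) (dig i d)"
definition s2 :: "nat \<Rightarrow> int \<Rightarrow> int" where "s2 i d = sg (q i) (dig i d)"

lemma Pr_0: "Pr 0 = G" and Pr_Suc: "Pr (Suc i) = Pr i * (p i * q i)"
  by (simp_all add: Pr_def)

lemma Pr_pos: "i \<le> k \<Longrightarrow> Pr i > 0"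
proof (induction i)
  case 0
  then show ?case using G_pos by (simp add: Pr_0)
next
  case (Suc i)
  then have "0 < p i" "0 < q i" using pq[of i] by auto
  with Suc show ?case by (simp add: Pr_Suc)
qed

lemma Pr_dvd: "i \<le> j \<Longrightarrow> Pr i dvd Pr j"
  by (induction rule: dec_induct) (auto simp: Pr_Suc intro: dvd_mult2)

lemma Pr_dvd_trans: "i \<le> j \<Longrightarrow> Pr j dvd d \<Longrightarrow> Pr i dvd d"
  using Pr_dvd dvd_trans by blast

lemma lev_unique: "lev i d \<Longrightarrow> lev j d \<Longrightarrow> i = j"
  unfolding lev_def by (metis Pr_dvd_trans Suc_leI linorder_neqE_nat)

lemma lev_cong: "Pr (Suc i) dvd d - d' \<Longrightarrow> lev i d \<longleftrightarrow> lev i d'"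
  unfolding lev_def using Pr_dvd_trans[of i "Suc i" "d - d'"]
  by (metis dvd_diff_commute dvd_diff_left_iff  diff_add_cancel dvd_add_right_iff le_SucI order_refl)

lemma Pr_dig: "Pr i dvd d \<Longrightarrow> d = Pr i * dig i d"
  by (simp add: dig_def)

lemma dig_mult: "i \<le> k \<Longrightarrow> dig i (Pr i * u) = u"
  using Pr_pos[of i] by (simp add: dig_def)

lemma dig_diff: "Pr i dvd d \<Longrightarrow> Pr i dvd d' \<Longrightarrow> dig i (d - d') = dig i d - dig i d'"
  unfolding dig_def by (rule div_diff)

lemma Pr_Suc_dvd_iff: "i < k \<Longrightarrow> Pr i dvd d \<Longrightarrow> Pr (Suc i) dvd d \<longleftrightarrow> p i * q i dvd dig i d"
  using Pr_pos[of i] Pr_dig[of i d] by (metis Pr_Suc dvd_mult_cancel_left less_imp_le less_irrefl)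

lemma unit_lev: "i < k \<Longrightarrow> unit i d \<Longrightarrow> lev i d"
  unfolding unit_def lev_def using Pr_Suc_dvd_iff by (metis dvd_mult_left)

lemma dig_cong:
  assumes "i < k" "Pr i dvd d" "Pr (Suc i) dvd d - d'"
  shows "Pr i dvd d'" "p i * q i dvd dig i d - dig i d'"
proof -
  have *: "Pr i dvd d - d'" using Pr_dvd_trans[of i "Suc i"] assms(3) by simp
  then show d': "Pr i dvd d'" using assms(2) by (simp add: dvd_diff_right_iff)
  show "p i * q i dvd dig i d - dig i d'"
    using Pr_Suc_dvd_iff[OF assms(1) *] assms(3) dig_diff[OF assms(2) d'] by simp
qed

text \<open>A multiple of \<open>Pr (Suc i)\<close> changes the quotient by \<open>Pr i\<close> by a
  multiple of \<open>p i * q i\<close>, which neither residue sees.\<close>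

lemma unit_signs_cong:
  assumes "i < k" "unit i d" "Pr (Suc i) dvd d - d'"
  shows "unit i d'" "s1 i d' = s1 i d" "s2 i d' = s2 i d"
proof -
  have d: "Pr i dvd d" using assms(2) by (simp add: unit_def)
  have d': "Pr i dvd d'" and *: "p i * q i dvd dig i d - dig i d'"
    using dig_cong[OF assms(1) d assms(3)] by auto
  have "p i dvd dig i d - dig i d'" "q i dvd dig i d - dig i d'"
    using * by (auto dest: dvd_mult_left dvd_mult_right)
  then have c: "[dig i d' = dig i d] (mod p i)" "[dig i d' = dig i d] (mod q i)"
    by (simp_all add: cong_iff_dvd_diff dvd_diff_commute)
  show "unit i d'" using assms(2) d' c by (simp add: unit_def cong_dvd_iff)
  show "s1 i d' = s1 i d" "s2 i d' = s2 i d" using c by (auto simp: s1_def s2_def intro: sg_cong)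
qed

lemma unit_cong: "i < k \<Longrightarrow> Pr (Suc i) dvd d - d' \<Longrightarrow> unit i d \<longleftrightarrow> unit i d'"
  using unit_signs_cong(1) by (metis dvd_diff_commute)

lemma dig_minus: "Pr i dvd d \<Longrightarrow> dig i (- d) = - dig i d"
  unfolding dig_def by (simp add: dvd_neg_div)

lemma unit_minus: "unit i (- d) \<longleftrightarrow> unit i d"
  unfolding unit_def using dig_minus by auto

lemma s1_minus: "i < k \<Longrightarrow> unit i d \<Longrightarrow> s1 i (- d) = - s1 i d"
  using pq[of i] by (auto simp: s1_def unit_def dig_minus intro!: sg_minus)

lemma s2_minus: "i < k \<Longrightarrow> unit i d \<Longrightarrow> s2 i (- d) = - s2 i d"
  using pq[of i] by (auto simp: s2_def unit_def dig_minus intro!: sg_minus)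

lemma s1_sq: "s1 i d * s1 i d = 1" and s2_sq: "s2 i d * s2 i d = 1"
  using sg_cases by (auto simp: s1_def s2_def sg_def)

lemma unit_Pr:
  assumes "i < k"
  shows "unit i (Pr i)" "s1 i (Pr i) = 1" "s2 i (Pr i) = 1"
proof -
  have "dig i (Pr i) = 1" using dig_mult[of i 1] assms by simp
  then show "unit i (Pr i)" "s1 i (Pr i) = 1" "s2 i (Pr i) = 1"
    using pq[OF assms] by (auto simp: unit_def s1_def s2_def sg_one zdvd1_eq)
qed

section \<open>Recovering the chain of moduli by counting\<close>

definition Q :: "int \<Rightarrow> bool" where "Q d \<longleftrightarrow> (\<exists>i<k. unit i d)"

lemma Q_at_lev: "i < k \<Longrightarrow> lev i d \<Longrightarrow> Q d \<longleftrightarrow> unit i d"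
  unfolding Q_def using unit_lev lev_unique by blast

text \<open>If \<open>G\<close> does not divide \<open>x - y\<close>, the elements close to
  \<open>x + Pr 0\<close> are in relation \<open>Q\<close> with \<open>x\<close> but not with
  \<open>y\<close>, and vice versa. Otherwise let \<open>j\<close> be the level of
  \<open>x - y\<close>; by \<open>two_nonunits\<close> there are two digits \<open>c\<close> such
  that \<open>z = x + Pr j * c\<close> has a leading digit that is a nonunit relative to
  \<open>x\<close> and a unit relative to \<open>y\<close>.\<close>

lemma Q_separating_classes:
  assumes "i \<le> k" "\<not> Pr i dvd x - y" "0 < i"
  obtains j a b where "j < i" "\<not> Pr (Suc j) dvd a - b"
    "\<And>z. Pr (Suc j) dvd z - a \<or> Pr (Suc j) dvd z - b \<Longrightarrow> Q (z - x) \<noteq> Q (z - y)"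
proof (cases "Pr 0 dvd x - y")
  case False
  have k: "0 < k" using assms by simp
  have *: "Q (z - x) \<and> \<not> Q (z - y)" if z: "Pr (Suc 0) dvd z - (x + Pr 0)" and xy: "\<not> Pr 0 dvd x - y" for x y z
  proof -
    have "Pr (Suc 0) dvd Pr 0 - (z - x)" using z by (metis add_diff_eq diff_add_eq dvd_diff_commute diff_diff_eq2 add.commute)
    then have u: "unit 0 (z - x)" using unit_signs_cong(1)[OF k unit_Pr(1)[OF k]] by blast
    have "\<not> unit i (z - y)" for i
    proof
      assume "unit i (z - y)"
      then have "Pr 0 dvd z - y" unfolding unit_def using Pr_dvd_trans by blast
      moreover have "Pr 0 dvd z - x" using u by (simp add: unit_def)
      ultimately have "Pr 0 dvd (z - y) - (z - x)" by (rule dvd_diff)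
      then show False using xy by simp
    qed
    with u k show ?thesis unfolding Q_def by blast
  qed
  show ?thesis
  proof (rule that[of 0 "x + Pr 0" "y + Pr 0"])
    show "\<not> Pr (Suc 0) dvd x + Pr 0 - (y + Pr 0)"
      using False Pr_dvd_trans[of 0 "Suc 0" "x - y"] by auto
    fix z assume "Pr (Suc 0) dvd z - (x + Pr 0) \<or> Pr (Suc 0) dvd z - (y + Pr 0)"
    then show "Q (z - x) \<noteq> Q (z - y)"
      using *[of z x y] *[of z y x] False by (auto simp: dvd_diff_commute)
  qed (use assms in auto)
next
  case True
  \<comment> \<open>The greatest \<open>j\<close> for which \<open>Pr j\<close> divides
    \<open>x - y\<close> is the level of \<open>x - y\<close>, as \<open>Pr i\<close> does not
    divide it.\<close>
  define j where "j = (GREATEST j. j \<le> i \<and> Pr j dvd x - y)"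
  have j: "j \<le> i \<and> Pr j dvd x - y"
    unfolding j_def by (rule GreatestI_nat[of _ 0 i]) (use True in auto)
  have jmax: "m \<le> j" if "m \<le> i" "Pr m dvd x - y" for m
    unfolding j_def by (rule Greatest_le_nat[of _ _ i]) (use that in auto)
  have ji: "j < i" using j assms(2) by (cases "j = i") auto
  have jk: "j < k" using ji assms(1) by simp
  have nj: "\<not> Pr (Suc j) dvd x - y" using jmax[of "Suc j"] ji by auto
  have dj: "Pr j dvd y - x" using j by (simp add: dvd_diff_commute)
  define t where "t = dig j (y - x)"
  have "\<not> p j * q j dvd t"
    using Pr_Suc_dvd_iff[OF jk dj] nj by (simp add: t_def dvd_diff_commute)
  then obtain u v where uv: "\<not> p j * q j dvd u - v"
    "\<And>c. c \<in> {u, v} \<Longrightarrow> \<not> p j * q j dvd c \<and> (p j dvd c \<or> q j dvd c) \<and> \<not> p j dvd c - t \<and> \<not> q j dvd c - t"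
    using two_nonunits[of "p j" "q j" t] pq[OF jk] by blast
  have *: "Q (z - x) \<noteq> Q (z - y)" if c: "c \<in> {u, v}" and z: "Pr (Suc j) dvd z - (x + Pr j * c)" for c z
  proof -
    have jc: "Pr j dvd Pr j * c" "dig j (Pr j * c) = c" using jk by (auto simp: dig_mult)
    have zx: "Pr (Suc j) dvd Pr j * c - (z - x)"
      using z by (metis diff_diff_eq dvd_diff_commute)
    have "lev j (Pr j * c)" using Pr_Suc_dvd_iff[OF jk jc(1)] jc uv(2)[OF c] by (simp add: lev_def)
    moreover have "\<not> unit j (Pr j * c)" using jc uv(2)[OF c] by (auto simp: unit_def)
    ultimately have 1: "\<not> Q (z - x)"
      using lev_cong[OF zx] unit_cong[OF jk zx] Q_at_lev[OF jk] by blast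
    have e: "(Pr j * c - (y - x)) - (z - y) = Pr j * c - (z - x)" by simp
    have zy: "Pr (Suc j) dvd (Pr j * c - (y - x)) - (z - y)" unfolding e by (rule zx)
    have "dig j (Pr j * c - (y - x)) = c - t"
      using dig_diff[OF jc(1) dj] jc by (simp add: t_def)
    then have "unit j (Pr j * c - (y - x))"
      using uv(2)[OF c] jc(1) dj unfolding unit_def by (metis dvd_diff)
    then have "unit j (z - y)" using unit_cong[OF jk zy] by blast
    with 1 jk show ?thesis unfolding Q_def by blast
  qed
  show ?thesis
  proof (rule that[OF ji, of "x + Pr j * u" "x + Pr j * v"])
    have "dig j (Pr j * (u - v)) = u - v" using jk by (simp add: dig_mult)
    then show "\<not> Pr (Suc j) dvd x + Pr j * u - (x + Pr j * v)"
      using Pr_Suc_dvd_iff[OF jk, of "Pr j * (u - v)"] uv(1) by (simp add: right_diff_distrib)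
  qed (use * in blast)
qed

text \<open>\<open>Q\<close> hides the level of a difference; it is recovered here from the number
  of \<open>z\<close> that tell \<open>x\<close> and \<open>y\<close> apart. If \<open>Pr i\<close>
  divides \<open>x - y\<close>, all of them lie in one class modulo \<open>Pr i\<close>. Otherwise
  they include two disjoint classes modulo some \<open>Pr (Suc j)\<close> with
  \<open>Suc j \<le> i\<close>, which is at least twice as many.\<close>

lemma level_by_counting:
  assumes "0 < i" "i \<le> k" "Pr k dvd n" "n > 0"
  shows "Pr i dvd x - y \<longleftrightarrow> int (card {z \<in> {0..<n}. Q (z - x) \<noteq> Q (z - y)}) \<le> n div Pr i"
proof
  have dvd_n: "Pr j dvd n" if "j \<le> k" for j using Pr_dvd[OF that] assms(3) dvd_trans by blast
  { assume xy: "Pr i dvd x - y"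
    have "{z \<in> {0..<n}. Q (z - x) \<noteq> Q (z - y)} \<subseteq> {z \<in> {0..<n}. Pr i dvd z - x}"
    proof (clarify, rule ccontr)
      fix z assume "Q (z - x) \<noteq> Q (z - y)" and nz: "\<not> Pr i dvd z - x"
      have "(z - y) - (z - x) = x - y" by simp
      with xy have nz': "\<not> Pr i dvd z - y" using nz by (metis dvd_diff_right_iff dvd_diff_commute dvd_diff_left_iff)
      have "unit j (z - x) \<longleftrightarrow> unit j (z - y)" if j: "j < k" for j
      proof (cases "j < i")
        case True
        have e: "(z - x) - (z - y) = y - x" by simp
        have "Pr (Suc j) dvd (z - x) - (z - y)"
          unfolding e using Pr_dvd_trans[of "Suc j" i] True xy by (simp add: dvd_diff_commute)
        then show ?thesis using unit_cong[OF j] by blast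
      next
        case False
        then show ?thesis using nz nz' Pr_dvd_trans[of i j] unfolding unit_def by auto
      qed
      then show False using \<open>Q (z - x) \<noteq> Q (z - y)\<close> unfolding Q_def by blast
    qed
    then have "card {z \<in> {0..<n}. Q (z - x) \<noteq> Q (z - y)} \<le> card {z \<in> {0..<n}. Pr i dvd z - x}"
      by (intro card_mono finite_Collect_conjI) auto
    then show "int (card {z \<in> {0..<n}. Q (z - x) \<noteq> Q (z - y)}) \<le> n div Pr i"
      using card_residue_class[OF Pr_pos dvd_n assms(4), of i x] assms(2) by simp }
  { assume le: "int (card {z \<in> {0..<n}. Q (z - x) \<noteq> Q (z - y)}) \<le> n div Pr i"
    show "Pr i dvd x - y"
    proof (rule ccontr)
      assume "\<not> Pr i dvd x - y"
      then obtain j a b where j: "j < i" and ab: "\<not> Pr (Suc j) dvd a - b"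
        and sep: "\<And>z. Pr (Suc j) dvd z - a \<or> Pr (Suc j) dvd z - b \<Longrightarrow> Q (z - x) \<noteq> Q (z - y)"
        using Q_separating_classes[OF assms(2) _ assms(1)] by blast
      let ?R = "\<lambda>c. {z \<in> {0..<n}. Pr (Suc j) dvd z - c}"
      have finR: "finite (?R c)" for c by (rule finite_subset[of _ "{0..<n}"]) auto
      have Sj: "Suc j \<le> k" using j assms(2) by simp
      have "?R a \<inter> ?R b = {}"
      proof (rule ccontr)
        assume "?R a \<inter> ?R b \<noteq> {}"
        then obtain z where "Pr (Suc j) dvd z - a" "Pr (Suc j) dvd z - b" by auto
        then have "Pr (Suc j) dvd (z - b) - (z - a)" by (metis dvd_diff)
        then show False using ab by simp
      qed
      then have "card (?R a) + card (?R b) = card (?R a \<union> ?R b)"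
        by (intro card_Un_disjoint [symmetric] finR)
      also have "\<dots> \<le> card {z \<in> {0..<n}. Q (z - x) \<noteq> Q (z - y)}"
        using sep by (intro card_mono finite_Collect_conjI) auto
      finally have "int (card (?R a)) + int (card (?R b)) \<le>
          int (card {z \<in> {0..<n}. Q (z - x) \<noteq> Q (z - y)})" by linarith
      then have "2 * (n div Pr (Suc j)) \<le> n div Pr i"
        using le unfolding card_residue_class[OF Pr_pos[OF Sj] dvd_n[OF Sj] assms(4)] by linarith
      moreover have "n div Pr i \<le> n div Pr (Suc j)"
        using Pr_dvd[of "Suc j" i] j Pr_pos[OF assms(2)] Pr_pos[OF Sj] assms(4)
        by (intro zdiv_mono2) (auto intro: zdvd_imp_le)
      moreover have "n div Pr (Suc j) > 0"
        using dvd_n[OF Sj] Pr_pos[OF Sj] assms(4) by (simp add: pos_imp_zdiv_pos_iff zdvd_imp_le)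
      ultimately show False by linarith
    qed }
qed

text \<open>In every class modulo \<open>Pr i\<close> a center is chosen, and digit \<open>i\<close>
  of the difference to the center is multiplied by \<open>\<mu>\<close>, which is \<open>e1\<close>
  modulo \<open>p i\<close> and \<open>e2\<close> modulo \<open>q i\<close>. Centers come from
  \<open>Y\<close> where possible. As no two elements of \<open>Y\<close> first differ at level
  \<open>i\<close>, the other elements of \<open>Y\<close> in the class have digit 0 relative to the
  center and stay fixed.\<close>

lemma flip:
  assumes i: "i < k" and Y: "\<And>x y. x \<in> Y \<Longrightarrow> y \<in> Y \<Longrightarrow> \<not> lev i (x - y)"
    and e: "e1 = 1 \<or> e1 = -1" "e2 = 1 \<or> e2 = (-1::int)"
  obtains f where "\<And>y. y \<in> Y \<Longrightarrow> f y = y"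
    and "\<And>x y j. j \<le> k \<Longrightarrow> Pr j dvd f x - f y \<longleftrightarrow> Pr j dvd x - y"
    and "\<And>x y j. j < k \<Longrightarrow> unit j (f x - f y) \<longleftrightarrow> unit j (x - y)"
    and "\<And>x y j. j < k \<Longrightarrow> unit j (x - y) \<Longrightarrow> s1 j (f x - f y) = (if j = i then e1 else 1) * s1 j (x - y)"
    and "\<And>x y j. j < k \<Longrightarrow> unit j (x - y) \<Longrightarrow> s2 j (f x - f y) = (if j = i then e2 else 1) * s2 j (x - y)"
proof -
  define n where "n = p i * q i"
  have npos: "n > 0" using pq[OF i] by (simp add: n_def)
  have Ppos: "Pr i > 0" using Pr_pos i by simp
  have PS: "Pr (Suc i) = Pr i * n" by (simp add: Pr_Suc n_def)
  obtain \<mu> where \<mu>: "[\<mu> = e1] (mod p i)" "[\<mu> = e2] (mod q i)"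
    using crt_int[of "p i" "q i" e1 e2] pq[OF i] by blast
  have "coprime (p i) \<mu>" "coprime (q i) \<mu>"
    using \<mu> e by (metis cong_imp_coprime cong_sym coprime_1_left coprime_commute coprime_minus_left_iff)+
  then have cop: "coprime n \<mu>" by (simp add: n_def)
  \<comment> \<open>Only the lowest digit in base \<open>n\<close> is multiplied by
    \<open>\<mu>\<close>; the higher digits are kept, so there is no carry.\<close>
  define w where "w u = u - u mod n + (\<mu> * u) mod n" for u
  have w0: "w u = u" if "n dvd u" for u using that by (simp add: w_def dvd_imp_mod_0)
  have w_cong: "[w u - w v = \<mu> * (u - v)] (mod n)" for u v
  proof -
    have "[w u = \<mu> * u] (mod n)" for u
      by (simp add: w_def cong_def mod_simps minus_mod_eq_mult_div)
    then show ?thesis using cong_diff by (metis right_diff_distrib)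
  qed
  have w_dvd: "n dvd w u - w v \<longleftrightarrow> n dvd u - v" for u v
    using cong_dvd_iff[OF w_cong] cop by (simp add: coprime_dvd_mult_right_iff)
  have w_eq: "w u - w v = u - v" if "n dvd u - v" for u v
  proof -
    have uv: "[u = v] (mod n)" using that by (simp add: cong_iff_dvd_diff)
    then have "[\<mu> * u = \<mu> * v] (mod n)" by (rule cong_scalar_left)
    with uv show ?thesis by (simp add: w_def cong_def)
  qed
  \<comment> \<open>The center is a function of the residue modulo \<open>Pr i\<close>, hence common
    to the whole class; classes without elements of \<open>Y\<close> use the residue itself.\<close>
  define cc where "cc \<rho> = (if \<exists>y\<in>Y. y mod Pr i = \<rho> then SOME y. y \<in> Y \<and> y mod Pr i = \<rho> else \<rho>)" for \<rho>
  define c where "c x = cc (x mod Pr i)" for x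
  have cc: "y \<in> Y \<Longrightarrow> c y \<in> Y \<and> c y mod Pr i = y mod Pr i" for y
    unfolding c_def cc_def using someI_ex[of "\<lambda>z. z \<in> Y \<and> z mod Pr i = y mod Pr i"] by auto
  have cm: "c x mod Pr i = x mod Pr i" for x
  proof (cases "\<exists>y\<in>Y. y mod Pr i = x mod Pr i")
    case True
    then obtain y where "y \<in> Y" "y mod Pr i = x mod Pr i" by blast
    then show ?thesis using cc[of y] by (simp add: c_def)
  qed (simp add: c_def cc_def)
  define u where "u x = dig i (x - c x)" for x
  have xcu: "x = c x + Pr i * u x" for x
    using cm[of x] Pr_dig[of i "x - c x"] by (simp add: u_def mod_eq_dvd_iff dvd_diff_commute)
  define f where "f x = c x + Pr i * w (u x)" for x
  have f_eq: "f x - x = Pr i * (w (u x) - u x)" for x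
    using xcu[of x] by (simp add: f_def right_diff_distrib)
  have same_c: "c x = c y" if "Pr i dvd x - y" for x y
    using that unfolding c_def mod_eq_dvd_iff[symmetric] by simp
  have xy: "x - y = Pr i * (u x - u y)" "f x - f y = Pr i * (w (u x) - w (u y))" if "Pr i dvd x - y" for x y
    using xcu[of x] xcu[of y] same_c[OF that] by (auto simp: f_def right_diff_distrib)
  have f_mod: "Pr i dvd (f x - f y) - (x - y)" for x y
  proof -
    have "(f x - f y) - (x - y) = (f x - x) - (f y - y)" by simp
    then show ?thesis unfolding f_eq by (metis dvd_triv_left right_diff_distrib)
  qed
  have Pi_iff: "Pr i dvd f x - f y \<longleftrightarrow> Pr i dvd x - y" for x y
    using f_mod[of x y] by (metis dvd_diff_left_iff dvd_diff_right_iff)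
  have eq_above: "f x - f y = x - y" if "Pr (Suc i) dvd x - y" for x y
  proof -
    have "Pr i dvd x - y" using that Pr_dvd_trans[of i "Suc i"] by simp
    note xy = xy[OF this]
    have "n dvd u x - u y" using that xy(1) Ppos by (simp add: PS)
    then show ?thesis using w_eq xy by simp
  qed
  have PSi_iff: "Pr (Suc i) dvd f x - f y \<longleftrightarrow> Pr (Suc i) dvd x - y" for x y
  proof (cases "Pr i dvd x - y")
    case True
    show ?thesis unfolding xy[OF True] PS using Ppos w_dvd by simp
  next
    case False
    then show ?thesis using Pi_iff Pr_dvd_trans[of i "Suc i"] by auto
  qed
  have P_iff: "Pr j dvd f x - f y \<longleftrightarrow> Pr j dvd x - y" for x y j
  proof (cases "j \<le> i")
    case True
    have "Pr j dvd (f x - f y) - (x - y)" using Pr_dvd_trans[OF True f_mod] .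
    then show ?thesis by (metis dvd_diff_left_iff dvd_diff_right_iff)
  next
    case False
    then have "Suc i \<le> j" by simp
    then show ?thesis using eq_above PSi_iff Pr_dvd_trans by metis
  qed
  have d_i: "[dig i (f x - f y) = e1 * dig i (x - y)] (mod p i)"
       "[dig i (f x - f y) = e2 * dig i (x - y)] (mod q i)" if "Pr i dvd x - y" for x y
  proof -
    have d: "dig i (x - y) = u x - u y" "dig i (f x - f y) = w (u x) - w (u y)"
      using xy[OF that] i by (simp_all add: dig_mult)
    have "[dig i (f x - f y) = \<mu> * dig i (x - y)] (mod n)" using w_cong d by simp
    then have "[dig i (f x - f y) = \<mu> * dig i (x - y)] (mod p i)" "[dig i (f x - f y) = \<mu> * dig i (x - y)] (mod q i)"
      using cong_modulus_mult by (auto simp: n_def mult.commute intro: cong_dvd_modulus)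
    then show "[dig i (f x - f y) = e1 * dig i (x - y)] (mod p i)"
       "[dig i (f x - f y) = e2 * dig i (x - y)] (mod q i)"
      using \<mu> cong_scalar_right cong_trans by blast+
  qed
  \<comment> \<open>Levels below \<open>i\<close> see the difference only modulo divisors of
    \<open>Pr i\<close>, and a difference with a unit above level \<open>i\<close> is literally
    unchanged.\<close>
  have other: "unit j (f x - f y) \<and> s1 j (f x - f y) = s1 j (x - y) \<and> s2 j (f x - f y) = s2 j (x - y)"
    if "j < k" "j \<noteq> i" "unit j (x - y)" for x y j
  proof (cases "j < i")
    case True
    have "Pr (Suc j) dvd (x - y) - (f x - f y)"
      using Pr_dvd_trans[of "Suc j" i] f_mod[of x y] True by (simp add: dvd_diff_commute)
    then show ?thesis using unit_signs_cong[OF that(1,3)] by blast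
  next
    case False
    then have "Pr (Suc i) dvd x - y" using that Pr_dvd_trans[of "Suc i" j] by (simp add: unit_def)
    then show ?thesis using eq_above that by simp
  qed
  have other': "unit j (f x - f y) \<longleftrightarrow> unit j (x - y)" if "j < k" "j \<noteq> i" for x y j
  proof (cases "j < i")
    case True
    have "Pr (Suc j) dvd (f x - f y) - (x - y)"
      using Pr_dvd_trans[of "Suc j" i] f_mod[of x y] True by simp
    then show ?thesis using unit_cong[OF that(1)] by blast
  next
    case False
    then show ?thesis using eq_above[of x y] that Pr_dvd_trans[of "Suc i" j] PSi_iff[of x y]
      unfolding unit_def by (metis Suc_leI linorder_neqE_nat)
  qed
  have at_i: "unit i (f x - f y) \<longleftrightarrow> unit i (x - y)" for x y
  proof (cases "Pr i dvd x - y")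
    case True
    have "p i dvd dig i (f x - f y) \<longleftrightarrow> p i dvd dig i (x - y)"
      using cong_dvd_iff[OF d_i(1)[OF True]] e(1) by auto
    moreover have "q i dvd dig i (f x - f y) \<longleftrightarrow> q i dvd dig i (x - y)"
      using cong_dvd_iff[OF d_i(2)[OF True]] e(2) by auto
    ultimately show ?thesis using Pi_iff by (simp add: unit_def)
  next
    case False
    then show ?thesis using Pi_iff by (simp add: unit_def)
  qed
  have sg_mult: "sg m t' = \<epsilon> * sg m t"
    if "[t' = \<epsilon> * t] (mod m)" "\<epsilon> = 1 \<or> \<epsilon> = -1" "odd m" "m > 0" "\<not> m dvd t" for m t t' \<epsilon>
    using that sg_cong[OF that(1)] sg_minus[of m t] by auto
  show ?thesis
  proof (rule that[of f])
    fix y assume y: "y \<in> Y"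
    have "\<not> lev i (y - c y)" using Y y cc by blast
    moreover have Pd: "Pr i dvd y - c y" using cc[OF y] by (metis mod_eq_dvd_iff)
    ultimately have "Pr (Suc i) dvd y - c y" by (simp add: lev_def)
    then have "n dvd u y" using Pr_Suc_dvd_iff[OF i Pd] by (simp add: u_def n_def)
    then show "f y = y" using w0 xcu[of y] by (simp add: f_def)
  next
    fix x y :: int and j assume j: "j < k" "unit j (x - y)"
    show "s1 j (f x - f y) = (if j = i then e1 else 1) * s1 j (x - y)"
      using other[of j x y] j sg_mult[OF d_i(1)[of x y] e(1)] pq[OF i]
      by (auto simp: s1_def unit_def)
    show "s2 j (f x - f y) = (if j = i then e2 else 1) * s2 j (x - y)"
      using other[of j x y] j sg_mult[OF d_i(2)[of x y] e(2)] pq[OF i]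
      by (auto simp: s2_def unit_def)
  qed (use P_iff at_i other' in metis)+
qed

section \<open>Branching positions\<close>

definition branch :: "int set \<Rightarrow> nat set" where
  "branch X = {i. i < k \<and> (\<exists>x\<in>X. \<exists>y\<in>X. lev i (x - y))}"

lemma lev_minus: "lev i (- d) \<longleftrightarrow> lev i d"
  by (simp add: lev_def)

lemma branch_mono: "X \<subseteq> Y \<Longrightarrow> branch X \<subseteq> branch Y"
  unfolding branch_def by blast

lemma finite_branch: "finite (branch X)"
  unfolding branch_def by simp

text \<open>The ultrametric property: if \<open>v\<close> first differs from \<open>x\<close> at
  level \<open>i\<close> and from \<open>y\<close> at a higher level, then \<open>x\<close> and
  \<open>y\<close> first differ at \<open>i\<close>. So of the levels at which \<open>v\<close>
  splits off from elements of \<open>X\<close>, all except the largest branch in \<open>X\<close>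
  already.\<close>

lemma branch_insert:
  obtains j where "branch (insert v X) \<subseteq> insert j (branch X)"
proof -
  define S where "S = {i. i < k \<and> (\<exists>x\<in>X. lev i (v - x))}"
  have lev0: "\<not> lev i 0" for i by (simp add: lev_def)
  have sub: "branch (insert v X) \<subseteq> branch X \<union> S"
  proof
    fix i assume "i \<in> branch (insert v X)"
    then obtain x y where "i < k" "x \<in> insert v X" "y \<in> insert v X" "lev i (x - y)"
      unfolding branch_def by blast
    moreover have "lev i (y - x)" using \<open>lev i (x - y)\<close> lev_minus[of i "x - y"] by simp
    ultimately show "i \<in> branch X \<union> S"
      using lev0[of i] unfolding branch_def S_def by auto
  qed
  have *: "i \<in> branch X" if "i \<in> S" "j \<in> S" "i < j" for i j
  proof -
    obtain x y where x: "x \<in> X" "lev i (v - x)" and y: "y \<in> X" "lev j (v - y)" and ik: "i < k"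
      using \<open>i \<in> S\<close> \<open>j \<in> S\<close> unfolding S_def by blast
    have "Pr (Suc i) dvd v - y" using y(2) that(3) Pr_dvd_trans[of "Suc i" j] by (simp add: lev_def)
    moreover have "(v - x) - (y - x) = v - y" by simp
    ultimately have "lev i (y - x)" using lev_cong[of i "v - x" "y - x"] x(2) by simp
    then show ?thesis using x y ik unfolding branch_def by blast
  qed
  have "\<exists>j. S \<subseteq> insert j (branch X)"
  proof (cases "S = {}")
    case False
    have "finite S" by (simp add: S_def)
    then have "S \<subseteq> insert (Max S) (branch X)"
      using * False by (metis Max_ge Max_in insertCI linorder_neqE_nat not_le subsetI)
    then show ?thesis by blast
  qed auto
  then show ?thesis using sub that by blast
qed

lemma card_branch: "finite X \<Longrightarrow> card (branch X) \<le> card X"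
proof (induction rule: finite_induct)
  case empty
  then show ?case by (simp add: branch_def)
next
  case (insert v X)
  obtain j where "branch (insert v X) \<subseteq> insert j (branch X)" using branch_insert .
  then have "card (branch (insert v X)) \<le> card (insert j (branch X))"
    by (intro card_mono) (auto simp: finite_branch)
  also have "\<dots> \<le> Suc (card (branch X))" by (simp add: card_insert_if finite_branch)
  finally show ?case using insert by simp
qed

lemma branch_image:
  assumes "\<And>x y j. x \<in> X \<Longrightarrow> y \<in> X \<Longrightarrow> j \<le> k \<Longrightarrow> Pr j dvd f x - f y \<longleftrightarrow> Pr j dvd x - y"
  shows "branch (f ` X) = branch X"
proof -
  have "lev i (f x - f y) \<longleftrightarrow> lev i (x - y)" if "i < k" "x \<in> X" "y \<in> X" for i x y
    using assms[of x y i] assms[of x y "Suc i"] that by (simp add: lev_def)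
  then show ?thesis unfolding branch_def by (simp cong: conj_cong)
qed

end

section \<open>Twisted circulant graphs over a toroidal wall\<close>

text \<open>
  The base graph: \<open>(True, r, c)\<close> and \<open>(False, c, r)\<close> are the two vertices where row \<open>r\<close> meets
  column \<open>c\<close>; the first lies on a cycle, the row, and the second on another one, the column.
  Edges are \<open>Inl v\<close>, joining \<open>v\<close> to its successor on the cycle, and \<open>Inr (r, c)\<close>, joining the
  two vertices above. The edges at \<open>v\<close> carry the labels \<open>c = 0, 1, 2\<close> (successor, predecessor,
  crossing), and \<open>inc h c v\<close> is the edge at \<open>v\<close> with label \<open>c\<close>.
\<close>

type_synonym anode = "bool \<times> nat \<times> nat"
type_synonym bnode = "anode + nat \<times> nat"

definition Anodes :: "nat \<Rightarrow> anode set" where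
  "Anodes h = UNIV \<times> {..<h} \<times> {..<h}"

definition Bnodes :: "nat \<Rightarrow> bnode set" where
  "Bnodes h = Inl ` Anodes h \<union> Inr ` ({..<h} \<times> {..<h})"

definition inc :: "nat \<Rightarrow> nat \<Rightarrow> anode \<Rightarrow> bnode" where
  "inc h c v = (case v of (d, i, l) \<Rightarrow>
     if c = 0 then Inl (d, i, l)
     else if c = 1 then Inl (d, i, if l = 0 then h - 1 else l - 1)
     else Inr (if d then (i, l) else (l, i)))"

lemma card_Anodes: "card (Anodes h) = 2 * h * h"
  by (simp add: Anodes_def card_cartesian_product)

lemma finite_Anodes: "finite (Anodes h)"
  by (simp add: Anodes_def)

lemma card_Bnodes: "card (Bnodes h) = 3 * h * h"
proof -
  have "card (Bnodes h) = card (Inl ` Anodes h :: bnode set) + card (Inr ` ({..<h} \<times> {..<h}) :: bnode set)"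
    unfolding Bnodes_def by (rule card_Un_disjoint) (auto simp: finite_Anodes)
  also have "\<dots> = 3 * h * h"
    by (simp add: card_image card_Anodes card_cartesian_product)
  finally show ?thesis .
qed

lemma finite_Bnodes: "finite (Bnodes h)"
  by (simp add: Bnodes_def finite_Anodes)

lemma inc_in_Bnodes: "v \<in> Anodes h \<Longrightarrow> inc h c v \<in> Bnodes h"
  by (auto simp: Anodes_def Bnodes_def inc_def split: prod.splits)

text \<open>For \<open>h = 1\<close> the edges to the successor and from the predecessor would
  coincide.\<close>

lemma inc_inj: "2 \<le> h \<Longrightarrow> v \<in> Anodes h \<Longrightarrow> c < 3 \<Longrightarrow> c' < 3 \<Longrightarrow> inc h c v = inc h c' v \<Longrightarrow> c = c'"
  by (auto simp: inc_def Anodes_def split: prod.splits if_splits)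

text \<open>A sign change at one edge therefore affects just the two equations at its ends.\<close>

lemma inc_two_ends:
  assumes "v \<in> Anodes h" "v' \<in> Anodes h" "u \<in> Anodes h" "c < 3" "c' < 3" "m < 3"
    and "inc h c v = inc h c' v'" "inc h m u = inc h c v" "(v, c) \<noteq> (v', c')"
  shows "(u, m) = (v, c) \<or> (u, m) = (v', c')"
proof -
  have c: "c = 0 \<or> c = 1 \<or> c = 2" "c' = 0 \<or> c' = 1 \<or> c' = 2" "m = 0 \<or> m = 1 \<or> m = 2"
    using assms by auto
  obtain d i l d' i' l' e j k where v: "v = (d, i, l)" "v' = (d', i', l')" "u = (e, j, k)"
    by (metis prod.exhaust)
  show ?thesis
    using assms c unfolding v
    by (elim disjE) (auto simp: inc_def Anodes_def split: if_splits)
qed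

text \<open>\<open>A.Pr kA\<close> and \<open>B.Pr kB\<close> are the orders of the two factors of
  the cyclic group; \<open>nA\<close> and \<open>nB\<close> assign positions in them to the vertices
  and edges of the wall.\<close>

locale cfi = A: ladder GA kA pA qA + B: ladder GB kB pB qB
  for GA kA pA qA GB kB pB qB +
  fixes h :: nat and nA :: "anode \<Rightarrow> nat" and nB :: "bnode \<Rightarrow> nat"
  assumes h: "3 \<le> h"
    and nA: "bij_betw nA (Anodes h) {..<kA}" and nB: "bij_betw nB (Bnodes h) {..<kB}"
    and cop: "coprime (A.Pr kA) (B.Pr kB)"
begin

section \<open>The cyclic group and the arc relation\<close>

definition n :: int where "n = A.Pr kA * B.Pr kB"
definition V :: "int set" where "V = {0..<n}"

text \<open>
  The signs at the two ends are chosen such that their product changes under \<open>d \<mapsto> - d\<close>. This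
  makes the arcs of \<open>cfi_rel\<close> one-way, and so distinguishes them from those of \<open>rook\<close>.
\<close>

definition signA :: "nat \<Rightarrow> anode \<Rightarrow> int \<Rightarrow> int" where
  "signA c v d = (if c = 0 then A.s1 (nA v) d else if c = 1 then A.s2 (nA v) d
     else A.s1 (nA v) d * A.s2 (nA v) d)"

definition signB :: "bnode \<Rightarrow> int \<Rightarrow> int" where
  "signB w d = (case w of Inl _ \<Rightarrow> B.s1 (nB w) d * B.s2 (nB w) d | Inr _ \<Rightarrow> B.s1 (nB w) d)"

definition linked :: "anode \<Rightarrow> nat \<Rightarrow> int \<Rightarrow> bool" where
  "linked v c d \<longleftrightarrow> A.unit (nA v) d \<and> B.unit (nB (inc h c v)) d"

text \<open>The Cai--Fuerer--Immerman equations: \<open>\<tau> v c\<close> is the right-hand side at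
  the incidence of \<open>v\<close> with its edge labelled \<open>c\<close>. The untwisted graph has
  all right-hand sides 1.\<close>

definition cfi_rel :: "(anode \<Rightarrow> nat \<Rightarrow> int) \<Rightarrow> int \<Rightarrow> bool" where
  "cfi_rel \<tau> d \<longleftrightarrow> (\<exists>v\<in>Anodes h. \<exists>c<3. linked v c d \<and> signA c v d * signB (inc h c v) d = \<tau> v c)"

text \<open>The difference vanishes in exactly one of the two coordinates, as for moves of a rook on
  the board \<open>A \<times> B\<close>. These arcs make the two factors recognizable.\<close>

definition rook :: "int \<Rightarrow> bool" where
  "rook d \<longleftrightarrow> (A.Pr kA dvd d) \<noteq> (B.Pr kB dvd d)"

definition arc :: "(anode \<Rightarrow> nat \<Rightarrow> int) \<Rightarrow> int \<Rightarrow> bool" where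
  "arc \<tau> d \<longleftrightarrow> rook d \<or> cfi_rel \<tau> d"

lemma n_pos: "n > 0"
  using A.Pr_pos[of kA] B.Pr_pos[of kB] by (simp add: n_def)

lemma finite_V: "finite V"
  by (simp add: V_def)

lemma n_dvd_iff: "n dvd d \<longleftrightarrow> A.Pr kA dvd d \<and> B.Pr kB dvd d"
  unfolding n_def using cop by (auto intro: divides_mult dvd_mult_left dvd_mult_right)

lemma V_eqI: "x \<in> V \<Longrightarrow> y \<in> V \<Longrightarrow> n dvd x - y \<Longrightarrow> x = y"
  unfolding V_def by (metis atLeastLessThan_iff mod_eq_dvd_iff mod_pos_pos_trivial)

lemma crt_V: obtains z where "z \<in> V" "A.Pr kA dvd z - a" "B.Pr kB dvd z - b"
proof -
  obtain x where x: "[x = a] (mod A.Pr kA)" "[x = b] (mod B.Pr kB)" using crt_int[OF cop] .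
  have "n dvd x mod n - x" by (simp add: dvd_diff_commute[of _ "x mod n"] minus_mod_eq_mult_div)
  then have d: "A.Pr kA dvd x mod n - x" "B.Pr kB dvd x mod n - x" by (simp_all add: n_dvd_iff)
  show ?thesis
  proof (rule that[of "x mod n"])
    show "x mod n \<in> V" using n_pos by (simp add: V_def)
    show "A.Pr kA dvd x mod n - a" "B.Pr kB dvd x mod n - b"
      using dvd_add[OF d(1), of "x - a"] dvd_add[OF d(2), of "x - b"] x by (auto simp: cong_iff_dvd_diff)
  qed
qed

lemma nA_less: "v \<in> Anodes h \<Longrightarrow> nA v < kA"
  using nA by (auto simp: bij_betw_def)

lemma nB_less: "w \<in> Bnodes h \<Longrightarrow> nB w < kB"
  using nB by (auto simp: bij_betw_def)

lemma nA_inj: "v \<in> Anodes h \<Longrightarrow> v' \<in> Anodes h \<Longrightarrow> nA v = nA v' \<Longrightarrow> v = v'"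
  using nA by (auto simp: bij_betw_def inj_on_def)

lemma nB_inj: "v \<in> Bnodes h \<Longrightarrow> v' \<in> Bnodes h \<Longrightarrow> nB v = nB v' \<Longrightarrow> v = v'"
  using nB by (auto simp: bij_betw_def inj_on_def)

text \<open>The level of \<open>d\<close> in \<open>A\<close> determines the vertex, its level in
  \<open>B\<close> determines the edge, and the edge has just one label at that vertex.\<close>

lemma linked_unique:
  assumes "v \<in> Anodes h" "v' \<in> Anodes h" "c < 3" "c' < 3" "linked v c d" "linked v' c' d"
  shows "v = v'" "c = c'"
proof -
  have "nA v = nA v'"
    using assms A.unit_lev nA_less A.lev_unique unfolding linked_def by meson
  then show v: "v = v'" using nA_inj assms by blast
  have "nB (inc h c v) = nB (inc h c' v')"
    using assms B.unit_lev nB_less inc_in_Bnodes B.lev_unique unfolding linked_def by meson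
  then have "inc h c v = inc h c' v'" using nB_inj inc_in_Bnodes assms by blast
  then show "c = c'" using inc_inj[of h v c c'] v h assms by simp
qed

lemma cfi_rel_iff:
  assumes "v \<in> Anodes h" "c < 3" "linked v c d"
  shows "cfi_rel \<tau> d \<longleftrightarrow> signA c v d * signB (inc h c v) d = \<tau> v c"
  unfolding cfi_rel_def using assms linked_unique by metis

lemma signA_cases: "signA c v d = 1 \<or> signA c v d = -1"
  using sg_cases unfolding signA_def A.s1_def A.s2_def by (auto simp: sg_def)

lemma signB_cases: "signB w d = 1 \<or> signB w d = -1"
  using sg_cases unfolding signB_def B.s1_def B.s2_def by (auto simp: sg_def split: sum.splits)

text \<open>Preserving every level, and not only the arcs, ensures that a pebbled set and its image
  have the same branching positions. Only the right-hand sides may change.\<close>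

definition level_iso :: "(anode \<Rightarrow> nat \<Rightarrow> int) \<Rightarrow> (anode \<Rightarrow> nat \<Rightarrow> int) \<Rightarrow> (int \<Rightarrow> int) \<Rightarrow> bool" where
  "level_iso \<tau> \<tau>' f \<longleftrightarrow> bij_betw f V V \<and>
     (\<forall>x\<in>V. \<forall>y\<in>V. (\<forall>j\<le>kA. A.Pr j dvd f x - f y \<longleftrightarrow> A.Pr j dvd x - y) \<and>
       (\<forall>j\<le>kB. B.Pr j dvd f x - f y \<longleftrightarrow> B.Pr j dvd x - y) \<and>
       (cfi_rel \<tau> (x - y) \<longleftrightarrow> cfi_rel \<tau>' (f x - f y)))"

lemma level_iso_in_V: "level_iso \<tau> \<tau>' f \<Longrightarrow> x \<in> V \<Longrightarrow> f x \<in> V"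
  by (auto simp: level_iso_def bij_betw_def)

lemma level_iso_comp:
  assumes "level_iso \<tau> \<tau>' f" "level_iso \<tau>' \<tau>'' g"
  shows "level_iso \<tau> \<tau>'' (g \<circ> f)"
  unfolding level_iso_def
proof (intro conjI ballI)
  show "bij_betw (g \<circ> f) V V" using assms bij_betw_trans unfolding level_iso_def by blast
  fix x y assume xy: "x \<in> V" "y \<in> V"
  have f: "f x \<in> V" "f y \<in> V" using level_iso_in_V[OF assms(1)] xy by auto
  show "\<forall>j\<le>kA. A.Pr j dvd (g \<circ> f) x - (g \<circ> f) y \<longleftrightarrow> A.Pr j dvd x - y"
    and "\<forall>j\<le>kB. B.Pr j dvd (g \<circ> f) x - (g \<circ> f) y \<longleftrightarrow> B.Pr j dvd x - y"
    and "cfi_rel \<tau> (x - y) \<longleftrightarrow> cfi_rel \<tau>'' ((g \<circ> f) x - (g \<circ> f) y)"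
    using assms xy f unfolding level_iso_def comp_def by blast+
qed

lemma cfi_rel_cong:
  assumes "\<And>v c. v \<in> Anodes h \<Longrightarrow> c < 3 \<Longrightarrow> \<tau> v c = \<tau>' v c"
  shows "cfi_rel \<tau> d \<longleftrightarrow> cfi_rel \<tau>' d"
  unfolding cfi_rel_def using assms by metis

lemma level_iso_cong:
  assumes "level_iso \<tau> \<tau>' f" "\<And>v c. v \<in> Anodes h \<Longrightarrow> c < 3 \<Longrightarrow> \<tau>' v c = \<tau>'' v c"
  shows "level_iso \<tau> \<tau>'' f"
  using assms(1) cfi_rel_cong[of \<tau>' \<tau>'', OF assms(2)] unfolding level_iso_def by simp

lemma level_iso_id: "level_iso \<tau> \<tau> (\<lambda>x. x)"
  by (simp add: level_iso_def bij_betw_def)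

text \<open>
  The effect on \<open>signA\<close> and \<open>signB\<close> of changing the signs modulo \<open>p\<close> and \<open>q\<close> on each level.
\<close>

definition epsA :: "(nat \<Rightarrow> int) \<Rightarrow> (nat \<Rightarrow> int) \<Rightarrow> nat \<Rightarrow> anode \<Rightarrow> int" where
  "epsA a1 a2 c v = (if c = 0 then a1 (nA v) else if c = 1 then a2 (nA v) else a1 (nA v) * a2 (nA v))"

definition epsB :: "(nat \<Rightarrow> int) \<Rightarrow> (nat \<Rightarrow> int) \<Rightarrow> bnode \<Rightarrow> int" where
  "epsB b1 b2 w = (case w of Inl _ \<Rightarrow> b1 (nB w) * b2 (nB w) | Inr _ \<Rightarrow> b1 (nB w))"

text \<open>The two factors can be changed independently: the Chinese remainder theorem combines
  \<open>fA\<close> and \<open>fB\<close> into one map modulo \<open>n\<close>. All levels and signs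
  depend on the residues modulo \<open>A.Pr kA\<close> and \<open>B.Pr kB\<close> only, so the sign
  changes show up as factors of the right-hand sides.\<close>

lemma lift_iso:
  assumes fA: "\<And>x y j. j \<le> kA \<Longrightarrow> A.Pr j dvd fA x - fA y \<longleftrightarrow> A.Pr j dvd x - y"
      "\<And>x y j. j < kA \<Longrightarrow> A.unit j (fA x - fA y) \<longleftrightarrow> A.unit j (x - y)"
      "\<And>x y j. j < kA \<Longrightarrow> A.unit j (x - y) \<Longrightarrow> A.s1 j (fA x - fA y) = a1 j * A.s1 j (x - y)"
      "\<And>x y j. j < kA \<Longrightarrow> A.unit j (x - y) \<Longrightarrow> A.s2 j (fA x - fA y) = a2 j * A.s2 j (x - y)"
    and fB: "\<And>x y j. j \<le> kB \<Longrightarrow> B.Pr j dvd fB x - fB y \<longleftrightarrow> B.Pr j dvd x - y"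
      "\<And>x y j. j < kB \<Longrightarrow> B.unit j (fB x - fB y) \<longleftrightarrow> B.unit j (x - y)"
      "\<And>x y j. j < kB \<Longrightarrow> B.unit j (x - y) \<Longrightarrow> B.s1 j (fB x - fB y) = b1 j * B.s1 j (x - y)"
      "\<And>x y j. j < kB \<Longrightarrow> B.unit j (x - y) \<Longrightarrow> B.s2 j (fB x - fB y) = b2 j * B.s2 j (x - y)"
    and Y: "\<And>y. y \<in> Y \<Longrightarrow> fA y = y \<and> fB y = y" "Y \<subseteq> V"
    and ab: "\<And>j. a1 j \<in> {1, -1}" "\<And>j. a2 j \<in> {1, -1}" "\<And>j. b1 j \<in> {1, -1}" "\<And>j. b2 j \<in> {1, -1}"
  obtains f where "\<And>y. y \<in> Y \<Longrightarrow> f y = y"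
    and "\<And>\<tau>. level_iso \<tau> (\<lambda>v c. epsA a1 a2 c v * epsB b1 b2 (inc h c v) * \<tau> v c) f"
proof -
  have "\<exists>z. z \<in> V \<and> A.Pr kA dvd z - fA x \<and> B.Pr kB dvd z - fB x" for x
    using crt_V[of "fA x" "fB x"] by blast
  then obtain f where f: "\<And>x. f x \<in> V" "\<And>x. A.Pr kA dvd f x - fA x" "\<And>x. B.Pr kB dvd f x - fB x"
    by metis
  have dA: "A.Pr kA dvd (fA x - fA y) - (f x - f y)" for x y
  proof -
    have "(fA x - fA y) - (f x - f y) = (f y - fA y) - (f x - fA x)" by simp
    then show ?thesis using f(2) by (metis dvd_diff)
  qed
  have dB: "B.Pr kB dvd (fB x - fB y) - (f x - f y)" for x y
  proof -
    have "(fB x - fB y) - (f x - f y) = (f y - fB y) - (f x - fB x)" by simp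
    then show ?thesis using f(3) by (metis dvd_diff)
  qed
  have A1: "A.Pr j dvd f x - f y \<longleftrightarrow> A.Pr j dvd x - y" if "j \<le> kA" for j x y
    using A.Pr_dvd_trans[OF that dA[of x y]] fA(1)[OF that, of x y]
    by (metis dvd_diff_left_iff dvd_diff_right_iff)
  have B1: "B.Pr j dvd f x - f y \<longleftrightarrow> B.Pr j dvd x - y" if "j \<le> kB" for j x y
    using B.Pr_dvd_trans[OF that dB[of x y]] fB(1)[OF that, of x y]
    by (metis dvd_diff_left_iff dvd_diff_right_iff)
  have dA': "A.Pr (Suc j) dvd (fA x - fA y) - (f x - f y)" if "j < kA" for j x y
    using A.Pr_dvd_trans[OF _ dA] that by simp
  have dB': "B.Pr (Suc j) dvd (fB x - fB y) - (f x - f y)" if "j < kB" for j x y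
    using B.Pr_dvd_trans[OF _ dB] that by simp
  have A2: "A.unit j (f x - f y) \<longleftrightarrow> A.unit j (x - y)" if "j < kA" for j x y
    using A.unit_cong[OF that dA'[OF that]] fA(2)[OF that] by blast
  have B2: "B.unit j (f x - f y) \<longleftrightarrow> B.unit j (x - y)" if "j < kB" for j x y
    using B.unit_cong[OF that dB'[OF that]] fB(2)[OF that] by blast
  have A3: "A.s1 j (f x - f y) = a1 j * A.s1 j (x - y)" "A.s2 j (f x - f y) = a2 j * A.s2 j (x - y)"
    if "j < kA" "A.unit j (x - y)" for j x y
    using A.unit_signs_cong[OF that(1) _ dA'[OF that(1)]] fA(2-4)[OF that(1)] that(2) by metis+
  have B3: "B.s1 j (f x - f y) = b1 j * B.s1 j (x - y)" "B.s2 j (f x - f y) = b2 j * B.s2 j (x - y)"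
    if "j < kB" "B.unit j (x - y)" for j x y
    using B.unit_signs_cong[OF that(1) _ dB'[OF that(1)]] fB(2-4)[OF that(1)] that(2) by metis+
  have ab0: "a1 j \<noteq> 0" "a2 j \<noteq> 0" "b1 j \<noteq> 0" "b2 j \<noteq> 0" for j
    using ab(1)[of j] ab(2)[of j] ab(3)[of j] ab(4)[of j] by (simp_all add: insert_iff) linarith+
  have inj: "inj_on f V"
  proof (rule inj_onI)
    fix x y assume xy: "x \<in> V" "y \<in> V" "f x = f y"
    then have "A.Pr kA dvd x - y" "B.Pr kB dvd x - y" using A1[of kA x y] B1[of kB x y] by auto
    then show "x = y" using V_eqI xy n_dvd_iff by blast
  qed
  have "f ` V = V" using f(1) inj finite_V by (intro endo_inj_surj) auto
  with inj have bij: "bij_betw f V V" by (simp add: bij_betw_def)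
  have "level_iso \<tau> (\<lambda>v c. epsA a1 a2 c v * epsB b1 b2 (inc h c v) * \<tau> v c) f" for \<tau>
    unfolding level_iso_def
  proof (intro conjI ballI allI impI)
    fix x y assume "x \<in> V" "y \<in> V"
    let ?\<tau> = "\<lambda>v c. epsA a1 a2 c v * epsB b1 b2 (inc h c v) * \<tau> v c"
    have "linked v c (f x - f y) \<and> signA c v (f x - f y) * signB (inc h c v) (f x - f y) = ?\<tau> v c \<longleftrightarrow>
      linked v c (x - y) \<and> signA c v (x - y) * signB (inc h c v) (x - y) = \<tau> v c"
      if v: "v \<in> Anodes h" for v c
    proof -
      have l: "nA v < kA" "nB (inc h c v) < kB" using nA_less nB_less inc_in_Bnodes v by auto
      have "linked v c (f x - f y) \<longleftrightarrow> linked v c (x - y)"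
        unfolding linked_def using A2 B2 l by blast
      moreover have "signA c v (f x - f y) * signB (inc h c v) (f x - f y) = ?\<tau> v c \<longleftrightarrow>
          signA c v (x - y) * signB (inc h c v) (x - y) = \<tau> v c" if "linked v c (x - y)"
      proof -
        have sA: "signA c v (f x - f y) = epsA a1 a2 c v * signA c v (x - y)"
          using that A3[OF l(1)] by (simp add: linked_def signA_def epsA_def)
        have sB: "signB (inc h c v) (f x - f y) = epsB b1 b2 (inc h c v) * signB (inc h c v) (x - y)"
          using that B3[OF l(2)]
          by (cases "inc h c v") (simp_all add: linked_def signB_def epsB_def)
        have nz: "epsA a1 a2 c v * epsB b1 b2 (inc h c v) \<noteq> 0"
          using ab0 by (cases "inc h c v") (simp_all add: epsA_def epsB_def)
        have "epsA a1 a2 c v * signA c v (x - y) * (epsB b1 b2 (inc h c v) * signB (inc h c v) (x - y)) =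
          epsA a1 a2 c v * epsB b1 b2 (inc h c v) * (signA c v (x - y) * signB (inc h c v) (x - y))"
          by (simp only: mult_ac)
        with nz show ?thesis unfolding sA sB by (metis mult_cancel_left)
      qed
      ultimately show ?thesis by blast
    qed
    then show "cfi_rel \<tau> (x - y) \<longleftrightarrow> cfi_rel ?\<tau> (f x - f y)"
      unfolding cfi_rel_def by blast
  qed (use bij A1 B1 in auto)
  moreover have "f y = y" if "y \<in> Y" for y
    using Y that f[of y] by (intro V_eqI) (auto simp: n_dvd_iff)
  ultimately show ?thesis using that by blast
qed

section \<open>Moving a twist through the wall\<close>

definition twist :: "anode \<times> nat \<Rightarrow> anode \<Rightarrow> nat \<Rightarrow> int" where
  "twist a v c = (if a = (v, c) then -1 else 1)"

text \<open>A twist moves between two labels at a vertex or between the two ends of an edge.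
  \<open>TA\<close> and \<open>TB\<close> stand for the positions pinned by pebbles, at which no
  sign may be changed.\<close>

definition step :: "nat set \<Rightarrow> nat set \<Rightarrow> anode \<times> nat \<Rightarrow> anode \<times> nat \<Rightarrow> bool" where
  "step TA TB a a' \<longleftrightarrow> fst a \<in> Anodes h \<and> fst a' \<in> Anodes h \<and> snd a < 3 \<and> snd a' < 3 \<and>
     (fst a = fst a' \<and> nA (fst a) \<notin> TA \<or>
      inc h (snd a) (fst a) = inc h (snd a') (fst a') \<and> nB (inc h (snd a) (fst a)) \<notin> TB)"

lemma step_sym: "step TA TB a a' \<Longrightarrow> step TA TB a' a"
  by (auto simp: step_def)

lemma rtranclp_step_sym:
  "(step TA TB)\<^sup>*\<^sup>* a b \<Longrightarrow> (step TA TB)\<^sup>*\<^sup>* b a"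
  by (induction rule: rtranclp_induct) (auto intro: step_sym converse_rtranclp_into_rtranclp)

text \<open>Sign changes at a vertex affect an even number of its three labels, and any two labels
  can be hit; a sign change at an edge affects the labels at both ends. In both cases the twist
  leaves \<open>a\<close> and appears at \<open>a'\<close>, and \<open>flip\<close> fixes
  \<open>Y\<close> because the position does not branch in \<open>Y\<close>.\<close>

lemma step_iso:
  assumes st: "step (A.branch Y) (B.branch Y) a a'" and Y: "Y \<subseteq> V"
  shows "\<exists>f. (\<forall>y\<in>Y. f y = y) \<and> (\<forall>\<tau>. level_iso (\<lambda>v c. twist a v c * \<tau> v c) (\<lambda>v c. twist a' v c * \<tau> v c) f)"
proof (cases "a = a'")
  case True
  then show ?thesis by (intro exI[of _ "\<lambda>x. x"] conjI allI ballI) (simp_all only: level_iso_id)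
next
  case False
  obtain v c v' c' where a: "a = (v, c)" "a' = (v', c')" by (metis prod.exhaust)
  have vc: "v \<in> Anodes h" "v' \<in> Anodes h" "c < 3" "c' < 3"
    using st by (auto simp: step_def a)
  consider "v = v'" "nA v \<notin> A.branch Y"
    | "inc h c v = inc h c' v'" "nB (inc h c v) \<notin> B.branch Y"
    using st by (auto simp: step_def a)
  then show ?thesis
  proof cases
    case 1
    \<comment> \<open>Labels 0, 1 and 2 carry the factors \<open>e1\<close>, \<open>e2\<close> and
      \<open>e1 * e2\<close>; this choice makes exactly those of \<open>c\<close> and
      \<open>c'\<close> equal to -1.\<close>
    define e1 :: int where "e1 = (if c = 0 \<or> c' = 0 then -1 else 1)"
    define e2 :: int where "e2 = (if c = 1 \<or> c' = 1 then -1 else 1)"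
    have e: "e1 = 1 \<or> e1 = -1" "e2 = 1 \<or> e2 = -1" by (auto simp: e1_def e2_def)
    have br: "\<not> A.lev (nA v) (x - y)" if "x \<in> Y" "y \<in> Y" for x y
      using 1(2) nA_less[OF vc(1)] that unfolding A.branch_def by blast
    obtain fA where fA: "\<And>y. y \<in> Y \<Longrightarrow> fA y = y"
      "\<And>x y j. j \<le> kA \<Longrightarrow> A.Pr j dvd fA x - fA y \<longleftrightarrow> A.Pr j dvd x - y"
      "\<And>x y j. j < kA \<Longrightarrow> A.unit j (fA x - fA y) \<longleftrightarrow> A.unit j (x - y)"
      "\<And>x y j. j < kA \<Longrightarrow> A.unit j (x - y) \<Longrightarrow> A.s1 j (fA x - fA y) = (if j = nA v then e1 else 1) * A.s1 j (x - y)"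
      "\<And>x y j. j < kA \<Longrightarrow> A.unit j (x - y) \<Longrightarrow> A.s2 j (fA x - fA y) = (if j = nA v then e2 else 1) * A.s2 j (x - y)"
    proof (rule A.flip[where Y = Y, OF nA_less[OF vc(1)] _ e])
      show "\<not> A.lev (nA v) (x - y)" if "x \<in> Y" "y \<in> Y" for x y by (rule br[OF that])
    qed (rule that)
    let ?a1 = "\<lambda>j. if j = nA v then e1 else 1" and ?a2 = "\<lambda>j. if j = nA v then e2 else 1"
    obtain f where f: "\<And>y. y \<in> Y \<Longrightarrow> f y = y"
      "\<And>\<tau>. level_iso \<tau> (\<lambda>v c. epsA ?a1 ?a2 c v * epsB (\<lambda>_. 1) (\<lambda>_. 1) (inc h c v) * \<tau> v c) f"
      by (rule lift_iso[where fA = fA and ?a1.0 = ?a1 and ?a2.0 = ?a2 and fB = id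
            and ?b1.0 = "\<lambda>_. 1" and ?b2.0 = "\<lambda>_. 1" and Y = Y])
        (use fA Y in \<open>auto simp: e1_def e2_def\<close>)
    have "epsA ?a1 ?a2 m u * epsB (\<lambda>_. 1) (\<lambda>_. 1) (inc h m u) * (twist a u m * \<tau> u m) = twist a' u m * \<tau> u m"
      if "u \<in> Anodes h" "m < 3" for u m \<tau>
    proof -
      have "epsB (\<lambda>_. 1) (\<lambda>_. 1) (inc h m u) = 1" by (simp add: epsB_def split: sum.splits)
      moreover have "epsA ?a1 ?a2 m u * twist a u m = twist a' u m"
      proof (cases "u = v")
        case True
        have "c = 0 \<or> c = 1 \<or> c = 2" "c' = 0 \<or> c' = 1 \<or> c' = 2" "m = 0 \<or> m = 1 \<or> m = 2"
          using vc that(2) by auto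
        then show ?thesis using True False 1(1)
          by (elim disjE) (simp_all add: a epsA_def twist_def e1_def e2_def)
      next
        case False
        then have "nA u \<noteq> nA v" using nA_inj that(1) vc(1) by blast
        then show ?thesis using False 1(1) by (auto simp: a epsA_def twist_def)
      qed
      ultimately show ?thesis by (metis mult.assoc mult_1_right)
    qed
    then have "level_iso (\<lambda>v c. twist a v c * \<tau> v c) (\<lambda>v c. twist a' v c * \<tau> v c) f" for \<tau>
      by (rule level_iso_cong[OF f(2)])
    with f(1) show ?thesis by (intro exI[of _ f] conjI ballI allI)
  next
    case 2
    let ?w = "inc h c v"
    have w: "?w \<in> Bnodes h" using inc_in_Bnodes vc(1) by blast
    \<comment> \<open>Only the first sign is changed: it occurs once in \<open>signB\<close>, for
      crossings as well as for the edges of rows and columns.\<close>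
    have e: "-1 = 1 \<or> -1 = (-1::int)" "1 = 1 \<or> 1 = (-1::int)" by auto
    have br: "\<not> B.lev (nB ?w) (x - y)" if "x \<in> Y" "y \<in> Y" for x y
      using 2(2) nB_less[OF w] that unfolding B.branch_def by blast
    obtain fB where fB: "\<And>y. y \<in> Y \<Longrightarrow> fB y = y"
      "\<And>x y j. j \<le> kB \<Longrightarrow> B.Pr j dvd fB x - fB y \<longleftrightarrow> B.Pr j dvd x - y"
      "\<And>x y j. j < kB \<Longrightarrow> B.unit j (fB x - fB y) \<longleftrightarrow> B.unit j (x - y)"
      "\<And>x y j. j < kB \<Longrightarrow> B.unit j (x - y) \<Longrightarrow> B.s1 j (fB x - fB y) = (if j = nB ?w then -1 else 1) * B.s1 j (x - y)"
      "\<And>x y j. j < kB \<Longrightarrow> B.unit j (x - y) \<Longrightarrow> B.s2 j (fB x - fB y) = (if j = nB ?w then 1 else 1) * B.s2 j (x - y)"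
    proof (rule B.flip[where Y = Y, OF nB_less[OF w] _ e])
      show "\<not> B.lev (nB ?w) (x - y)" if "x \<in> Y" "y \<in> Y" for x y by (rule br[OF that])
    qed (rule that)
    let ?b1 = "\<lambda>j. if j = nB ?w then -1 else 1 :: int"
    obtain f where f: "\<And>y. y \<in> Y \<Longrightarrow> f y = y"
      "\<And>\<tau>. level_iso \<tau> (\<lambda>v c. epsA (\<lambda>_. 1) (\<lambda>_. 1) c v * epsB ?b1 (\<lambda>_. 1) (inc h c v) * \<tau> v c) f"
      by (rule lift_iso[where fB = fB and ?b1.0 = ?b1 and ?b2.0 = "\<lambda>_. 1" and fA = id
            and ?a1.0 = "\<lambda>_. 1" and ?a2.0 = "\<lambda>_. 1" and Y = Y])
        (use fB Y in auto)
    have "epsA (\<lambda>_. 1) (\<lambda>_. 1) m u * epsB ?b1 (\<lambda>_. 1) (inc h m u) * (twist a u m * \<tau> u m) = twist a' u m * \<tau> u m"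
      if "u \<in> Anodes h" "m < 3" for u m \<tau>
    proof -
      have "epsA (\<lambda>_. 1) (\<lambda>_. 1) m u = 1" by (simp add: epsA_def)
      moreover have "epsB ?b1 (\<lambda>_. 1) (inc h m u) * twist a u m = twist a' u m"
      proof (cases "inc h m u = ?w")
        case True
        then have "(u, m) = a \<or> (u, m) = a'"
          using inc_two_ends[OF vc(1,2) that(1) vc(3,4) that(2) 2(1) True] False by (simp add: a)
        then show ?thesis using False True by (auto simp: epsB_def twist_def split: sum.splits)
      next
        case F: False
        then have "nB (inc h m u) \<noteq> nB ?w" using nB_inj w inc_in_Bnodes that(1) by blast
        then show ?thesis using F 2(1) by (auto simp: a epsB_def twist_def split: sum.splits)
      qed
      ultimately show ?thesis by (metis mult.assoc mult_1_left)
    qed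
    then have "level_iso (\<lambda>v c. twist a v c * \<tau> v c) (\<lambda>v c. twist a' v c * \<tau> v c) f" for \<tau>
      by (rule level_iso_cong[OF f(2)])
    with f(1) show ?thesis by (intro exI[of _ f] conjI ballI allI)
  qed
qed

lemma steps_iso:
  assumes "(step (A.branch Y) (B.branch Y))\<^sup>*\<^sup>* a a'" and Y: "Y \<subseteq> V"
  shows "\<exists>f. (\<forall>y\<in>Y. f y = y) \<and> (\<forall>\<tau>. level_iso (\<lambda>v c. twist a v c * \<tau> v c) (\<lambda>v c. twist a' v c * \<tau> v c) f)"
  using assms(1)
proof (induction rule: rtranclp_induct)
  case base
  then show ?case by (intro exI[of _ "\<lambda>x. x"] conjI allI ballI) (simp_all only: level_iso_id)
next
  case (step b c)
  then obtain f where f: "\<forall>y\<in>Y. f y = y" "\<And>\<tau>. level_iso (\<lambda>v c. twist a v c * \<tau> v c) (\<lambda>v c. twist b v c * \<tau> v c) f"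
    by blast
  obtain g where g: "\<forall>y\<in>Y. g y = y" "\<And>\<tau>. level_iso (\<lambda>v c. twist b v c * \<tau> v c) (\<lambda>v d. twist c v d * \<tau> v d) g"
    using step_iso[OF step.hyps(2) Y] by blast
  show ?case using f(1) g(1) level_iso_comp[OF f(2) g(2)]
    by (intro exI[of _ "g \<circ> f"] conjI allI ballI) (simp, blast)
qed

section \<open>Free rows and columns\<close>

definition freerow :: "nat set \<Rightarrow> nat set \<Rightarrow> nat \<Rightarrow> bool" where
  "freerow TA TB r \<longleftrightarrow> (\<forall>l<h. nA (True, r, l) \<notin> TA \<and> nB (Inl (True, r, l)) \<notin> TB \<and> nB (Inr (r, l)) \<notin> TB)"

text \<open>Crossing edges are left to \<open>freerow\<close>: a path from a free row to a free
  column uses one of them, and it belongs to the row.\<close>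

definition freecol :: "nat set \<Rightarrow> nat set \<Rightarrow> nat \<Rightarrow> bool" where
  "freecol TA TB i \<longleftrightarrow> (\<forall>l<h. nA (False, i, l) \<notin> TA \<and> nB (Inl (False, i, l)) \<notin> TB)"

lemma free_mono:
  "TA \<subseteq> TA' \<Longrightarrow> TB \<subseteq> TB' \<Longrightarrow> freerow TA' TB' r \<Longrightarrow> freerow TA TB r"
  "TA \<subseteq> TA' \<Longrightarrow> TB \<subseteq> TB' \<Longrightarrow> freecol TA' TB' r \<Longrightarrow> freecol TA TB r"
  unfolding freerow_def freecol_def by blast+

text \<open>Pigeonhole principle: a pinned node spoils at most one row and at most one column, and
  fewer than \<open>h\<close> nodes are pinned.\<close>

lemma free_exists:
  assumes fin: "finite TA" "finite TB" and lt: "card TA + card TB < h"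
  obtains r i where "r < h" "freerow TA TB r" "i < h" "freecol TA TB i"
proof -
  have key: False if all: "\<And>r. r < h \<Longrightarrow> \<exists>x\<in>TA <+> TB. P r x"
    and inj: "\<And>r r' x. r < h \<Longrightarrow> r' < h \<Longrightarrow> P r x \<Longrightarrow> P r' x \<Longrightarrow> r = r'" for P :: "nat \<Rightarrow> nat + nat \<Rightarrow> bool"
  proof -
    obtain g where g: "\<And>r. r < h \<Longrightarrow> g r \<in> TA <+> TB \<and> P r (g r)" using all by metis
    have "inj_on g {..<h}" using g inj by (intro inj_onI) (metis lessThan_iff)
    then have "card {..<h} \<le> card (TA <+> TB)"
      using g fin by (intro card_inj_on_le) auto
    then show False using lt fin by (simp add: card_Plus)
  qed
  have "\<exists>r<h. freerow TA TB r"
  proof (rule ccontr)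
    assume n: "\<not> ?thesis"
    show False
    proof (rule key[of "\<lambda>r x. \<exists>l<h. x = Inl (nA (True, r, l)) \<or> x = Inr (nB (Inl (True, r, l))) \<or> x = Inr (nB (Inr (r, l)))"])
      fix r assume "r < h"
      then show "\<exists>x\<in>TA <+> TB. \<exists>l<h. x = Inl (nA (True, r, l)) \<or> x = Inr (nB (Inl (True, r, l))) \<or> x = Inr (nB (Inr (r, l)))"
        using n unfolding freerow_def by (metis InlI InrI)
    next
      fix r r' x assume "r < h" "r' < h"
        "\<exists>l<h. x = Inl (nA (True, r, l)) \<or> x = Inr (nB (Inl (True, r, l))) \<or> x = Inr (nB (Inr (r, l)))"
        "\<exists>l<h. x = Inl (nA (True, r', l)) \<or> x = Inr (nB (Inl (True, r', l))) \<or> x = Inr (nB (Inr (r', l)))"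
      then show "r = r'"
        by (auto dest!: nA_inj[rotated 2] nB_inj[rotated 2] simp: Anodes_def Bnodes_def)
    qed
  qed
  moreover have "\<exists>i<h. freecol TA TB i"
  proof (rule ccontr)
    assume n: "\<not> ?thesis"
    show False
    proof (rule key[of "\<lambda>r x. \<exists>l<h. x = Inl (nA (False, r, l)) \<or> x = Inr (nB (Inl (False, r, l)))"])
      fix r assume "r < h"
      then show "\<exists>x\<in>TA <+> TB. \<exists>l<h. x = Inl (nA (False, r, l)) \<or> x = Inr (nB (Inl (False, r, l)))"
        using n unfolding freecol_def by (metis InlI InrI)
    next
      fix r r' x assume "r < h" "r' < h"
        "\<exists>l<h. x = Inl (nA (False, r, l)) \<or> x = Inr (nB (Inl (False, r, l)))"
        "\<exists>l<h. x = Inl (nA (False, r', l)) \<or> x = Inr (nB (Inl (False, r', l)))"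
      then show "r = r'"
        by (auto dest!: nA_inj[rotated 2] nB_inj[rotated 2] simp: Anodes_def Bnodes_def)
    qed
  qed
  ultimately show ?thesis using that by blast
qed

lemma line_steps:
  assumes "i < h" "\<And>l. l < h \<Longrightarrow> nA (d, i, l) \<notin> TA \<and> nB (Inl (d, i, l)) \<notin> TB" "l < h"
  shows "(step TA TB)\<^sup>*\<^sup>* ((d, i, 0), 0) ((d, i, l), 0)"
  using assms(3)
proof (induction l)
  case (Suc l)
  have "step TA TB ((d, i, l), 0) ((d, i, Suc l), 1)"
    using assms(1,2) Suc.prems by (auto simp: step_def Anodes_def inc_def)
  moreover have "step TA TB ((d, i, Suc l), 1) ((d, i, Suc l), 0)"
    using assms(1,2) Suc.prems by (auto simp: step_def Anodes_def)
  ultimately show ?case using Suc by (meson Suc_lessD rtranclp.rtrancl_into_rtrancl)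
qed simp

lemma row_col_steps:
  assumes "r < h" "freerow TA TB r" "i < h" "freecol TA TB i"
  shows "(step TA TB)\<^sup>*\<^sup>* ((True, r, 0), 0) ((False, i, 0), 0)"
proof -
  have sym: "(step TA TB)\<^sup>*\<^sup>* a b \<Longrightarrow> (step TA TB)\<^sup>*\<^sup>* b a" for a b
    using rtranclp_step_sym .
  have "(step TA TB)\<^sup>*\<^sup>* ((True, r, 0), 0) ((True, r, i), 0)"
    using assms by (intro line_steps) (auto simp: freerow_def)
  also have "step TA TB ((True, r, i), 0) ((True, r, i), 2)"
    using assms by (auto simp: step_def Anodes_def freerow_def)
  also have "step TA TB ((True, r, i), 2) ((False, i, r), 2)"
    using assms by (auto simp: step_def Anodes_def freerow_def inc_def)
  also have "step TA TB ((False, i, r), 2) ((False, i, r), 0)"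
    using assms by (auto simp: step_def Anodes_def freecol_def)
  also have "(step TA TB)\<^sup>*\<^sup>* ((False, i, r), 0) ((False, i, 0), 0)"
    using assms by (intro sym[OF line_steps]) (auto simp: freecol_def)
  finally show ?thesis .
qed

text \<open>Every row meets the free column, which connects the two.\<close>

lemma row_row_steps:
  assumes "r < h" "freerow TA TB r" "r' < h" "freerow TA TB r'" "i < h" "freecol TA TB i"
  shows "(step TA TB)\<^sup>*\<^sup>* ((True, r, 0), 0) ((True, r', 0), 0)"
proof -
  have "(step TA TB)\<^sup>*\<^sup>* ((False, i, 0), 0) ((True, r', 0), 0)"
    using row_col_steps[OF assms(3-6)] by (rule rtranclp_step_sym)
  with row_col_steps[OF assms(1,2,5,6)] show ?thesis by simp
qed

section \<open>The strategy of Duplicator\<close>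

definition row_loc :: "nat \<Rightarrow> anode \<times> nat" where "row_loc r = ((True, r, 0), 0)"

text \<open>
  After \<open>f\<close> the target graph has two twists: the one at row \<open>0\<close>, which Spoiler sees, and the one at
  row \<open>r\<close>, which the pebbles on \<open>X\<close> do not detect.
\<close>

definition pebble_pos :: "(int \<Rightarrow> int) \<Rightarrow> int set \<Rightarrow> bool" where
  "pebble_pos f X \<longleftrightarrow> X \<subseteq> V \<and> (\<exists>r<h. freerow (A.branch X) (B.branch X) r \<and>
     level_iso (\<lambda>_ _. 1) (\<lambda>v c. twist (row_loc r) v c * twist (row_loc 0) v c) f)"

text \<open>The twist at row \<open>r\<close> could only be noticed on a difference of pebbled
  elements that is linked at \<open>(True, r, 0)\<close>. Then this vertex would be a branching
  position of \<open>X\<close>, whereas row \<open>r\<close> is free.\<close>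

lemma pebble_pos_arc:
  assumes "pebble_pos f X" "x \<in> X" "y \<in> X"
  shows "f x \<in> V" "f x = f y \<longleftrightarrow> x = y" "arc (\<lambda>_ _. 1) (x - y) \<longleftrightarrow> arc (twist (row_loc 0)) (f x - f y)"
proof -
  obtain r where r: "r < h" "freerow (A.branch X) (B.branch X) r"
    and f: "level_iso (\<lambda>_ _. 1) (\<lambda>v c. twist (row_loc r) v c * twist (row_loc 0) v c) f" and X: "X \<subseteq> V"
    using assms(1) by (auto simp: pebble_pos_def)
  have xy: "x \<in> V" "y \<in> V" using X assms by auto
  show "f x \<in> V" using level_iso_in_V[OF f] xy by blast
  show "f x = f y \<longleftrightarrow> x = y" using f xy by (auto simp: level_iso_def bij_betw_def inj_on_def)
  have dA: "A.Pr j dvd f x - f y \<longleftrightarrow> A.Pr j dvd x - y" if "j \<le> kA" for j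
    using f xy that by (auto simp: level_iso_def)
  have dB: "B.Pr j dvd f x - f y \<longleftrightarrow> B.Pr j dvd x - y" if "j \<le> kB" for j
    using f xy that by (auto simp: level_iso_def)
  have "rook (f x - f y) \<longleftrightarrow> rook (x - y)" unfolding rook_def using dA dB by auto
  moreover have "cfi_rel (\<lambda>_ _. 1) (x - y) \<longleftrightarrow> cfi_rel (\<lambda>v c. twist (row_loc r) v c * twist (row_loc 0) v c) (f x - f y)"
    using f xy by (auto simp: level_iso_def)
  moreover have "cfi_rel (\<lambda>v c. twist (row_loc r) v c * twist (row_loc 0) v c) (f x - f y) \<longleftrightarrow> cfi_rel (twist (row_loc 0)) (f x - f y)"
  proof -
    have "twist (row_loc r) v c = 1" if v: "v \<in> Anodes h" "linked v c (f x - f y)" for v c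
    proof -
      have l: "nA v < kA" using nA_less v by blast
      have "A.lev (nA v) (f x - f y)" using v(2) A.unit_lev[OF l] by (auto simp: linked_def)
      then have "A.lev (nA v) (x - y)" using dA[of "nA v"] dA[of "Suc (nA v)"] l by (auto simp: A.lev_def)
      then have "nA v \<in> A.branch X" using l assms by (auto simp: A.branch_def)
      then have "v \<noteq> (True, r, 0)" using r h by (auto simp: freerow_def)
      then show ?thesis by (simp add: twist_def row_loc_def)
    qed
    then show ?thesis unfolding cfi_rel_def by (metis mult_1)
  qed
  ultimately show "arc (\<lambda>_ _. 1) (x - y) \<longleftrightarrow> arc (twist (row_loc 0)) (f x - f y)"
    unfolding arc_def by blast
qed

lemma pebble_pos_subset: "pebble_pos f X \<Longrightarrow> Y \<subseteq> X \<Longrightarrow> pebble_pos f Y"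
  unfolding pebble_pos_def using free_mono(1) A.branch_mono B.branch_mono by (meson order_trans)

text \<open>For \<open>r = 0\<close> the two twists are at the same place and cancel.\<close>

lemma pebble_pos_start: "pebble_pos (\<lambda>x. x) {}"
proof -
  have "level_iso (\<lambda>_ _. 1) (\<lambda>v c. twist (row_loc 0) v c * twist (row_loc 0) v c) (\<lambda>x. x)"
    by (rule level_iso_cong[OF level_iso_id]) (simp add: twist_def)
  then show ?thesis
    using h unfolding pebble_pos_def by (auto simp: freerow_def A.branch_def B.branch_def intro!: exI[of _ 0])
qed

text \<open>For each \<open>v\<close> the hidden twist is moved to a row that remains free with a
  pebble on \<open>v\<close>. The moved map depends only on the branching positions of
  \<open>insert v X\<close>, and these can be read off from the image as well. So equal images come
  from the same map, and the pieces fit together to a bijection \<open>g\<close>.\<close>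

lemma pebble_pos_extend:
  assumes twist: "pebble_pos f X" and X: "finite X" "2 * card X + 2 < h"
  shows "\<exists>g. bij_betw g V V \<and> (\<forall>v\<in>V. \<exists>f'. pebble_pos f' (insert v X) \<and> f' v = g v \<and> (\<forall>x\<in>X. f' x = f x))"
proof -
  obtain r where r: "r < h" "freerow (A.branch X) (B.branch X) r"
    and f: "level_iso (\<lambda>_ _. 1) (\<lambda>v c. twist (row_loc r) v c * twist (row_loc 0) v c) f" and XV: "X \<subseteq> V"
    using twist by (auto simp: pebble_pos_def)
  define cls where "cls v Z = (A.branch (insert v Z), B.branch (insert v Z))" for v Z
  define P where "P S f' \<longleftrightarrow> (\<exists>r'<h. freerow (fst S) (snd S) r' \<and>
      level_iso (\<lambda>_ _. 1) (\<lambda>v c. twist (row_loc r') v c * twist (row_loc 0) v c) f' \<and> (\<forall>x\<in>X. f' x = f x))" for S f'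
  have brA: "A.branch (f' ` Z) = A.branch Z" and brB: "B.branch (f' ` Z) = B.branch Z"
    if "level_iso \<tau> \<tau>' f'" "Z \<subseteq> V" for \<tau> \<tau>' f' Z
    using that by (auto simp: level_iso_def subset_iff intro!: A.branch_image B.branch_image)
  have ex: "\<exists>f'. P (cls v X) f'" if v: "v \<in> V" for v
  proof -
    let ?TA = "A.branch (insert v X)" and ?TB = "B.branch (insert v X)"
    have "card ?TA \<le> card X + 1" "card ?TB \<le> card X + 1"
      using A.card_branch[of "insert v X"] B.card_branch[of "insert v X"] X(1)
      by (auto simp: card_insert_if split: if_splits)
    \<comment> \<open>After the new pebble each factor has at most \<open>card X + 1\<close>
      branching positions, which explains the bound \<open>2 * card X + 2 < h\<close>.\<close>
    then have "card ?TA + card ?TB < h" using X(2) by linarith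
    then obtain r' i where r': "r' < h" "freerow ?TA ?TB r'" and i: "i < h" "freecol ?TA ?TB i"
      using free_exists[OF A.finite_branch B.finite_branch] by blast
    have sub: "A.branch X \<subseteq> ?TA" "B.branch X \<subseteq> ?TB"
      by (rule A.branch_mono B.branch_mono, rule subset_insertI)+
    have "(step (A.branch X) (B.branch X))\<^sup>*\<^sup>* (row_loc r) (row_loc r')"
      unfolding row_loc_def using row_row_steps[OF r r'(1) free_mono(1)[OF sub r'(2)] i(1) free_mono(2)[OF sub i(2)]] .
    then have st: "(step (A.branch (f ` X)) (B.branch (f ` X)))\<^sup>*\<^sup>* (row_loc r) (row_loc r')"
      using brA[OF f XV] brB[OF f XV] by simp
    have "f ` X \<subseteq> V" using level_iso_in_V[OF f] XV by auto
    from steps_iso[OF st this] obtain F where F: "\<forall>y\<in>f ` X. F y = y"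
      "\<forall>\<tau>. level_iso (\<lambda>v c. twist (row_loc r) v c * \<tau> v c) (\<lambda>v c. twist (row_loc r') v c * \<tau> v c) F"
      by (elim exE conjE)
    have "level_iso (\<lambda>_ _. 1) (\<lambda>v c. twist (row_loc r') v c * twist (row_loc 0) v c) (F \<circ> f)"
      using level_iso_comp[OF f F(2)[rule_format]] .
    moreover have "\<forall>x\<in>X. (F \<circ> f) x = f x" using F(1) by simp
    ultimately have "P (cls v X) (F \<circ> f)"
      unfolding P_def cls_def fst_conv snd_conv using r' by blast
    then show ?thesis by blast
  qed
  \<comment> \<open>The choice is made once for each class and not for each \<open>v\<close>, which
    the injectivity of \<open>g\<close> rests on.\<close>
  define FF where "FF S = (SOME f'. P S f')" for S
  have FF: "P (cls v X) (FF (cls v X))" if "v \<in> V" for v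
    unfolding FF_def using ex[OF that] someI_ex by metis
  define g where "g v = FF (cls v X) v" for v
  have twist': "pebble_pos (FF (cls v X)) (insert v X)" if "v \<in> V" for v
    using FF[OF that] that XV by (auto simp: P_def pebble_pos_def cls_def)
  have cls_g: "cls (g v) (f ` X) = cls v X" if v: "v \<in> V" for v
  proof -
    obtain \<tau> where i: "level_iso (\<lambda>_ _. 1) \<tau> (FF (cls v X))" and eq: "\<forall>x\<in>X. FF (cls v X) x = f x"
      using FF[OF v] by (auto simp: P_def)
    have im: "FF (cls v X) ` insert v X = insert (g v) (f ` X)"
      using eq by (auto simp: g_def)
    have "insert v X \<subseteq> V" using v XV by simp
    from brA[OF i this] brB[OF i this] show ?thesis unfolding im by (simp add: cls_def)
  qed
  have gV: "g v \<in> V" if v: "v \<in> V" for v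
    using FF[OF v] level_iso_in_V v by (auto simp: P_def g_def)
  have "inj_on g V"
  proof (rule inj_onI)
    fix v w assume vw: "v \<in> V" "w \<in> V" "g v = g w"
    then have c: "cls v X = cls w X" using cls_g by metis
    obtain \<tau> where "level_iso (\<lambda>_ _. 1) \<tau> (FF (cls v X))" using FF[OF vw(1)] by (auto simp: P_def)
    then have "inj_on (FF (cls v X)) V" by (auto simp: level_iso_def bij_betw_def)
    then show "v = w" using vw c by (auto simp: g_def dest: inj_onD)
  qed
  moreover from this have "g ` V = V" using gV finite_V by (intro endo_inj_surj) auto
  ultimately have "bij_betw g V V" by (simp add: bij_betw_def)
  moreover have "\<exists>f'. pebble_pos f' (insert v X) \<and> f' v = g v \<and> (\<forall>x\<in>X. f' x = f x)" if "v \<in> V" for v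
    using twist'[OF that] FF[OF that] by (intro exI[of _ "FF (cls v X)"]) (auto simp: g_def P_def)
  ultimately show ?thesis by blast
qed

section \<open>The two graphs and their equivalence\<close>

definition cfi_graph :: "(anode \<Rightarrow> nat \<Rightarrow> int) \<Rightarrow> int pair_pre_digraph" where
  "cfi_graph \<tau> = \<lparr>pverts = V, parcs = {(x, y). x \<in> V \<and> y \<in> V \<and> arc \<tau> (y - x)}\<rparr>"

text \<open>A copy on natural numbers, the vertex type that \<open>wl_identifies\<close> prescribes
  for the other graph.\<close>

definition cfi_graph_nat :: "(anode \<Rightarrow> nat \<Rightarrow> int) \<Rightarrow> nat pair_pre_digraph" where
  "cfi_graph_nat \<tau> = \<lparr>pverts = nat ` V,
     parcs = {(x, y). x \<in> nat ` V \<and> y \<in> nat ` V \<and> arc \<tau> (int y - int x)}\<rparr>"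

lemma wl_equivalent_twist:
  assumes m: "1 \<le> m" "2 * m + 2 < h"
  shows "wl_equivalent m (cfi_graph (\<lambda>_ _. 1)) (cfi_graph_nat (twist (row_loc 0)))"
proof -
  have natV: "bij_betw nat V (nat ` V)"
    by (rule bij_betw_imageI) (auto simp: V_def inj_on_def)
  have Vnn: "x \<in> V \<Longrightarrow> int (nat x) = x" for x by (simp add: V_def)
  interpret pebble_strategy "cfi_graph (\<lambda>_ _. 1)" "cfi_graph_nat (twist (row_loc 0))" m
    "\<lambda>F X. \<exists>f. pebble_pos f X \<and> (\<forall>x\<in>X. F x = nat (f x))"
  proof
    show "finite (pverts (cfi_graph (\<lambda>_ _. 1)))" "finite (pverts (cfi_graph_nat (twist (row_loc 0))))"
      using finite_V by (auto simp: cfi_graph_def cfi_graph_nat_def)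
    show "1 \<le> m" by fact
    show "\<exists>F f. pebble_pos f {} \<and> (\<forall>x\<in>{}. F x = nat (f x))" using pebble_pos_start by blast
  next
    fix F X and u v assume "\<exists>f. pebble_pos f X \<and> (\<forall>x\<in>X. F x = nat (f x))" and uv: "u \<in> X" "v \<in> X"
    then obtain f where f: "pebble_pos f X" "\<And>x. x \<in> X \<Longrightarrow> F x = nat (f x)" by blast
    have fV: "f u \<in> V" "f v \<in> V" using pebble_pos_arc(1)[OF f(1)] uv by auto
    have X: "u \<in> V" "v \<in> V" using f(1) uv by (auto simp: pebble_pos_def)
    have "nat (f u) = nat (f v) \<longleftrightarrow> f u = f v" using fV by (auto simp: V_def)
    then show "F u \<in> pverts (cfi_graph_nat (twist (row_loc 0))) \<and> (u = v \<longleftrightarrow> F u = F v) \<and>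
        ((u, v) \<in> parcs (cfi_graph (\<lambda>_ _. 1)) \<longleftrightarrow> (F u, F v) \<in> parcs (cfi_graph_nat (twist (row_loc 0))))"
      using f(2) uv fV X pebble_pos_arc(2,3)[OF f(1) uv(2,1)] Vnn
      by (auto simp: cfi_graph_def cfi_graph_nat_def)
  next
    fix F X Y assume "\<exists>f. pebble_pos f X \<and> (\<forall>x\<in>X. F x = nat (f x))" "Y \<subseteq> X"
    then show "\<exists>f. pebble_pos f Y \<and> (\<forall>x\<in>Y. F x = nat (f x))" using pebble_pos_subset by blast
  next
    fix F X assume "\<exists>f. pebble_pos f X \<and> (\<forall>x\<in>X. F x = nat (f x))" and X: "finite X" "card X \<le> m"
    then obtain f where f: "pebble_pos f X" "\<And>x. x \<in> X \<Longrightarrow> F x = nat (f x)" by blast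
    obtain g where g: "bij_betw g V V"
      and ext: "\<And>v. v \<in> V \<Longrightarrow> \<exists>f'. pebble_pos f' (insert v X) \<and> f' v = g v \<and> (\<forall>x\<in>X. f' x = f x)"
      using pebble_pos_extend[OF f(1) X(1)] X(2) m(2) by auto
    have "bij_betw (nat \<circ> g) V (nat ` V)" using bij_betw_trans[OF g natV] .
    moreover have "\<exists>F'. (\<exists>f'. pebble_pos f' (insert v X) \<and> (\<forall>x\<in>insert v X. F' x = nat (f' x))) \<and>
        F' v = (nat \<circ> g) v \<and> (\<forall>x\<in>X. F' x = F x)" if v: "v \<in> V" for v
    proof -
      obtain f' where f': "pebble_pos f' (insert v X)" "f' v = g v" "\<forall>x\<in>X. f' x = f x" using ext[OF v] by blast
      then show ?thesis using f(2) by (intro exI[of _ "nat \<circ> f'"]) auto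
    qed
    ultimately show "\<exists>g. bij_betw g (pverts (cfi_graph (\<lambda>_ _. 1))) (pverts (cfi_graph_nat (twist (row_loc 0)))) \<and>
        (\<forall>v\<in>pverts (cfi_graph (\<lambda>_ _. 1)). \<exists>F'. (\<exists>f'. pebble_pos f' (insert v X) \<and> (\<forall>x\<in>insert v X. F' x = nat (f' x))) \<and>
          F' v = g v \<and> (\<forall>x\<in>X. F' x = F x))"
      by (intro exI[of _ "nat \<circ> g"]) (simp add: cfi_graph_def cfi_graph_nat_def)
  qed
  show ?thesis by (rule equivalent)
qed

end

section \<open>The twist is visible to isomorphisms\<close>

lemma cyclic_integer_mod_group:
  assumes "n > 0"
  shows "cyclic_group (integer_mod_group n)"
proof -
  \<comment> \<open>Reducing the generator modulo \<open>n\<close> covers the trivial group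
    \<open>n = 1\<close>, where 1 itself is not an element.\<close>
  let ?x = "1 mod int n"
  have "carrier (integer_mod_group n) = range (\<lambda>k::int. ?x [^]\<^bsub>integer_mod_group n\<^esub> k)"
  proof (intro equalityI subsetI)
    fix y assume "y \<in> carrier (integer_mod_group n)"
    then have "y = ?x [^]\<^bsub>integer_mod_group n\<^esub> y"
      using assms by (simp add: int_pow_integer_mod_group carrier_integer_mod_group mod_mult_right_eq)
    then show "y \<in> range (\<lambda>k::int. ?x [^]\<^bsub>integer_mod_group n\<^esub> k)" by blast
  qed (use assms in \<open>auto simp: int_pow_integer_mod_group carrier_integer_mod_group\<close>)
  moreover have "?x \<in> carrier (integer_mod_group n)"
    using assms by (simp add: carrier_integer_mod_group)
  ultimately show ?thesis by (metis group.cyclic_group group_integer_mod_group)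
qed

lemma inc_surj:
  assumes "w \<in> Bnodes h"
  obtains v c where "v \<in> Anodes h" "c < 3" "w = inc h c v"
proof -
  consider v where "v \<in> Anodes h" "w = Inl v" | r i where "r < h" "i < h" "w = Inr (r, i)"
    using assms by (auto simp: Bnodes_def)
  then show ?thesis
  proof cases
    case 1
    then show ?thesis using that[of v 0] by (auto simp: inc_def split: prod.splits)
  next
    case 2
    then show ?thesis using that[of "(True, r, i)" 2] by (auto simp: inc_def Anodes_def)
  qed
qed

text \<open>Every edge has two ends, so every \<open>b w\<close> occurs squared. The predecessor
  edges are the successor edges shifted by the permutation \<open>pre\<close>, and each crossing is
  met once from its row and once from its column.\<close>

lemma prod_inc:
  fixes b :: "bnode \<Rightarrow> int"
  assumes "\<And>w. b w * b w = 1"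
  shows "(\<Prod>v\<in>Anodes h. b (inc h 0 v) * b (inc h 1 v) * b (inc h 2 v)) = 1"
proof -
  define pre where "pre v = (case v of (d, i, l) \<Rightarrow> (d, i, if l = 0 then h - 1 else l - 1))"
    for v :: anode
  have inj: "inj_on pre (Anodes h)"
    by (auto simp: inj_on_def pre_def Anodes_def split: if_splits)
  moreover have "pre ` Anodes h \<subseteq> Anodes h"
    by (auto simp: pre_def Anodes_def split: if_splits)
  ultimately have im: "pre ` Anodes h = Anodes h"
    using finite_Anodes by (intro endo_inj_surj)
  have "inc h 1 v = inc h 0 (pre v)" for v
    by (simp add: inc_def pre_def split: prod.splits)
  then have "(\<Prod>v\<in>Anodes h. b (inc h 1 v)) = (\<Prod>v\<in>pre ` Anodes h. b (inc h 0 v))"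
    by (simp only: prod.reindex[OF inj] comp_def)
  then have lines: "(\<Prod>v\<in>Anodes h. b (inc h 0 v)) * (\<Prod>v\<in>Anodes h. b (inc h 1 v)) = 1"
    unfolding im using assms by (simp add: prod.distrib [symmetric])
  have "(\<Prod>v\<in>Anodes h. b (inc h 2 v)) =
      (\<Prod>d\<in>UNIV. \<Prod>i<h. \<Prod>l<h. b (Inr (if d then (i, l) else (l, i))))"
    unfolding Anodes_def by (simp add: prod.cartesian_product inc_def case_prod_unfold)
  also have "\<dots> = (\<Prod>i<h. \<Prod>l<h. b (Inr (l, i))) * (\<Prod>i<h. \<Prod>l<h. b (Inr (i, l)))"
    by (simp add: UNIV_bool)
  also have "(\<Prod>i<h. \<Prod>l<h. b (Inr (l, i))) = (\<Prod>i<h. \<Prod>l<h. b (Inr (i, l)))"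
    by (rule prod.swap)
  also have "\<dots> * (\<Prod>i<h. \<Prod>l<h. b (Inr (i, l))) = 1"
    using assms by (simp add: prod.distrib [symmetric])
  finally have cross: "(\<Prod>v\<in>Anodes h. b (inc h 2 v)) = 1" .
  show ?thesis unfolding prod.distrib lines cross by simp
qed

context cfi
begin

section \<open>The graphs are circulant\<close>

lemma A_unit_signs_cong:
  assumes "j < kA" "A.unit j d" "A.Pr kA dvd d - d'"
  shows "A.unit j d'" "A.s1 j d' = A.s1 j d" "A.s2 j d' = A.s2 j d"
  using A.unit_signs_cong[OF assms(1,2) A.Pr_dvd_trans[OF _ assms(3)]] assms(1) by auto

lemma B_unit_signs_cong:
  assumes "j < kB" "B.unit j d" "B.Pr kB dvd d - d'"
  shows "B.unit j d'" "B.s1 j d' = B.s1 j d" "B.s2 j d' = B.s2 j d"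
  using B.unit_signs_cong[OF assms(1,2) B.Pr_dvd_trans[OF _ assms(3)]] assms(1) by auto

lemma linked_cong:
  assumes "v \<in> Anodes h" "linked v c d" "n dvd d - d'"
  shows "linked v c d'" "signA c v d' = signA c v d" "signB (inc h c v) d' = signB (inc h c v) d"
proof -
  have l: "nA v < kA" "nB (inc h c v) < kB" using nA_less nB_less inc_in_Bnodes assms by auto
  have u: "A.unit (nA v) d" "B.unit (nB (inc h c v)) d" using assms(2) by (auto simp: linked_def)
  have d: "A.Pr kA dvd d - d'" "B.Pr kB dvd d - d'" using assms(3) by (auto simp: n_dvd_iff)
  note A = A_unit_signs_cong[OF l(1) u(1) d(1)] and B = B_unit_signs_cong[OF l(2) u(2) d(2)]
  show "linked v c d'" using A B by (simp add: linked_def)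
  show "signA c v d' = signA c v d" using A by (simp add: signA_def)
  show "signB (inc h c v) d' = signB (inc h c v) d" using B by (cases "inc h c v") (simp_all add: signB_def)
qed

lemma arc_cong:
  assumes "n dvd d - d'"
  shows "arc \<tau> d \<longleftrightarrow> arc \<tau> d'"
proof -
  have "n dvd d' - d" using assms by (simp add: dvd_diff_commute)
  then have "cfi_rel \<tau> d \<longleftrightarrow> cfi_rel \<tau> d'"
    unfolding cfi_rel_def using linked_cong assms by metis
  moreover have "A.Pr kA dvd d \<longleftrightarrow> A.Pr kA dvd d'" "B.Pr kB dvd d \<longleftrightarrow> B.Pr kB dvd d'"
    using assms by (auto simp: n_dvd_iff dvd_diff_left_iff dvd_diff_right_iff)
  ultimately show ?thesis by (simp add: arc_def rook_def)
qed

lemma circulant: "circulant_graph (cfi_graph \<tau>)"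
proof -
  let ?Z = "integer_mod_group (nat n)"
  let ?X = "{d \<in> V. arc \<tau> d}"
  have car: "carrier ?Z = V" using n_pos by (simp add: carrier_integer_mod_group V_def)
  have op: "y \<otimes>\<^bsub>?Z\<^esub> inv\<^bsub>?Z\<^esub> x = (y - x) mod n" if "x \<in> V" for x y
    using that n_pos by (simp add: car mod_simps)
  have mem: "(y - x) mod n \<in> ?X \<longleftrightarrow> arc \<tau> (y - x)" for x y
  proof -
    have "n dvd (y - x) mod n - (y - x)"
      by (simp add: dvd_diff_commute[of _ "_ mod n"] minus_mod_eq_mult_div)
    then show ?thesis using arc_cong n_pos by (auto simp: V_def)
  qed
  have "parcs (cfi_graph \<tau>) = parcs (cayley_graph ?Z ?X)"
  proof (rule Set.set_eqI)
    fix e :: "int \<times> int"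
    obtain x y where e: "e = (x, y)" by force
    show "e \<in> parcs (cfi_graph \<tau>) \<longleftrightarrow> e \<in> parcs (cayley_graph ?Z ?X)"
      unfolding cfi_graph_def cayley_graph_def car e pair_pre_digraph.simps mem_Collect_eq prod.case
      using op[of x y] mem[of y x] by (metis (mono_tags, lifting) mem_Collect_eq)
  qed
  then have "cfi_graph \<tau> = cayley_graph ?Z ?X"
    by (simp add: cfi_graph_def cayley_graph_def car)
  moreover have "?X \<subseteq> carrier ?Z" by (auto simp: car)
  ultimately show ?thesis
    unfolding circulant_graph_def using cyclic_integer_mod_group[of "nat n"] n_pos
    by (intro exI[of _ ?Z] exI[of _ ?X] conjI group_integer_mod_group) simp_all
qed

section \<open>Reading relations off the arcs\<close>

definition Linked :: "int \<Rightarrow> bool" where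
  "Linked d \<longleftrightarrow> (\<exists>v\<in>Anodes h. \<exists>c<3. linked v c d)"

lemma linked_minus: "linked v c (- d) \<longleftrightarrow> linked v c d"
  by (simp add: linked_def A.unit_minus B.unit_minus)

text \<open>One of the two signs is a product of two elementary signs, hence even in
  \<open>d\<close>, and the other one is elementary, hence odd. The even one is \<open>signA\<close>
  for crossings and \<open>signB\<close> otherwise.\<close>

lemma sign_minus:
  assumes "v \<in> Anodes h" "c < 3" "linked v c d"
  shows "signA c v (- d) * signB (inc h c v) (- d) = - (signA c v d * signB (inc h c v) d)"
proof -
  have l: "nA v < kA" "nB (inc h c v) < kB" using nA_less nB_less inc_in_Bnodes assms by auto
  have u: "A.unit (nA v) d" "B.unit (nB (inc h c v)) d" using assms(3) by (auto simp: linked_def)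
  note s = A.s1_minus[OF l(1) u(1)] A.s2_minus[OF l(1) u(1)]
    B.s1_minus[OF l(2) u(2)] B.s2_minus[OF l(2) u(2)]
  show ?thesis
  proof (cases "c = 2")
    case True
    then obtain u where "inc h c v = Inr u"
      by (cases v; cases "inc h c v") (auto simp: inc_def split: if_splits)
    then show ?thesis using s True by (simp add: signA_def signB_def)
  next
    case False
    then have "c = 0 \<or> c = 1" using assms(2) by auto
    moreover from this obtain u where "inc h c v = Inl u"
      by (cases v; cases "inc h c v") (auto simp: inc_def split: if_splits)
    ultimately show ?thesis using s by (auto simp: signA_def signB_def)
  qed
qed

lemma Linked_not_dvd:
  assumes "Linked d"
  shows "\<not> A.Pr kA dvd d" "\<not> B.Pr kB dvd d"
proof -
  obtain v c where v: "v \<in> Anodes h" "linked v c d" using assms by (auto simp: Linked_def)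
  have l: "nA v < kA" "nB (inc h c v) < kB" using nA_less nB_less inc_in_Bnodes v by auto
  have "A.lev (nA v) d" "B.lev (nB (inc h c v)) d"
    using v A.unit_lev[OF l(1)] B.unit_lev[OF l(2)] by (auto simp: linked_def)
  then show "\<not> A.Pr kA dvd d" "\<not> B.Pr kB dvd d"
    using A.Pr_dvd_trans[of "Suc (nA v)" kA d] B.Pr_dvd_trans[of "Suc (nB (inc h c v))" kB d] l
    by (auto simp: A.lev_def B.lev_def)
qed

lemma cfi_rel_Linked: "cfi_rel \<tau> d \<Longrightarrow> Linked d"
  by (auto simp: cfi_rel_def Linked_def)

lemma Linked_minus: "Linked (- d) \<longleftrightarrow> Linked d"
  by (simp add: Linked_def linked_minus)

lemma cfi_rel_asym:
  assumes "\<And>v c. \<tau> v c = 1 \<or> \<tau> v c = -1" "Linked d"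
  shows "cfi_rel \<tau> d \<longleftrightarrow> \<not> cfi_rel \<tau> (- d)"
proof -
  obtain v c where v: "v \<in> Anodes h" "c < 3" "linked v c d"
    using assms(2) by (auto simp: Linked_def)
  have "linked v c (- d)" using v(3) by (simp add: linked_minus)
  then show ?thesis
    unfolding cfi_rel_iff[OF v] cfi_rel_iff[OF v(1,2) \<open>linked v c (- d)\<close>] sign_minus[OF v]
    using assms(1)[of v c] signA_cases[of c v d] signB_cases[of "inc h c v" d] by auto
qed

text \<open>Rook moves are arcs in both directions and linked differences in exactly one, whatever
  \<open>\<tau>\<close> is. So isomorphisms preserve both relations separately.\<close>

lemma arc_states:
  assumes "\<And>v c. \<tau> v c = 1 \<or> \<tau> v c = -1"
  shows "arc \<tau> d \<and> arc \<tau> (- d) \<longleftrightarrow> rook d" "arc \<tau> d \<noteq> arc \<tau> (- d) \<longleftrightarrow> Linked d"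
proof -
  have "rook (- d) \<longleftrightarrow> rook d" by (simp add: rook_def)
  moreover have "\<not> rook d" if "Linked d" using Linked_not_dvd[OF that] by (simp add: rook_def)
  ultimately show "arc \<tau> d \<and> arc \<tau> (- d) \<longleftrightarrow> rook d" "arc \<tau> d \<noteq> arc \<tau> (- d) \<longleftrightarrow> Linked d"
    using cfi_rel_asym[where \<tau> = \<tau> and d = d, OF assms] cfi_rel_Linked[of \<tau> d] cfi_rel_Linked[of \<tau> "- d"]
      Linked_minus[of d] by (auto simp: arc_def)
qed

text \<open>\<open>A.Q\<close> is the projection of \<open>Linked\<close> to the factor
  \<open>A\<close>: once the \<open>A\<close>-part is a unit at the position of \<open>v\<close>,
  the \<open>B\<close>-part can be chosen as a unit at an edge incident with \<open>v\<close>. The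
  right-hand side consists of relations that isomorphisms preserve.\<close>

lemma A_Q_iff:
  assumes "x \<in> V"
  shows "A.Q (z - x) \<longleftrightarrow> (\<exists>x'\<in>V. \<exists>z'\<in>V. A.Pr kA dvd x' - x \<and> A.Pr kA dvd z' - z \<and> Linked (z' - x'))"
proof
  assume "A.Q (z - x)"
  then obtain i where i: "i < kA" "A.unit i (z - x)" by (auto simp: A.Q_def)
  then obtain v where v: "v \<in> Anodes h" "nA v = i" using nA by (metis bij_betw_iff_bijections lessThan_iff)
  let ?j = "nB (inc h 0 v)"
  have j: "?j < kB" using v nB_less inc_in_Bnodes by blast
  obtain z' where z': "z' \<in> V" "A.Pr kA dvd z' - z" "B.Pr kB dvd z' - (x + B.Pr ?j)" using crt_V .
  have "A.Pr kA dvd (z - x) - (z' - x)" using z'(2) by (simp add: dvd_diff_commute)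
  then have "A.unit i (z' - x)" using A_unit_signs_cong(1)[OF i] by blast
  moreover have "B.Pr kB dvd B.Pr ?j - (z' - x)"
    using z'(3) by (metis diff_diff_eq dvd_diff_commute)
  then have "B.unit ?j (z' - x)" using B_unit_signs_cong(1)[OF j B.unit_Pr(1)[OF j]] by blast
  ultimately have "Linked (z' - x)" using v by (auto simp: Linked_def linked_def intro!: bexI[of _ v] exI[of _ 0])
  then show "\<exists>x'\<in>V. \<exists>z'\<in>V. A.Pr kA dvd x' - x \<and> A.Pr kA dvd z' - z \<and> Linked (z' - x')"
    using z' assms by (intro bexI[of _ x] bexI[of _ z']) auto
next
  assume "\<exists>x'\<in>V. \<exists>z'\<in>V. A.Pr kA dvd x' - x \<and> A.Pr kA dvd z' - z \<and> Linked (z' - x')"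
  then obtain x' z' v c where d: "A.Pr kA dvd x' - x" "A.Pr kA dvd z' - z"
    and v: "v \<in> Anodes h" "linked v c (z' - x')" by (auto simp: Linked_def)
  have "(z' - x') - (z - x) = (z' - z) - (x' - x)" by simp
  then have "A.Pr kA dvd (z' - x') - (z - x)" using d by (metis dvd_diff)
  then have "A.unit (nA v) (z - x)"
    using A_unit_signs_cong(1)[OF nA_less[OF v(1)]] v(2) by (auto simp: linked_def)
  then show "A.Q (z - x)" using nA_less[OF v(1)] by (auto simp: A.Q_def)
qed

lemma B_Q_iff:
  assumes "x \<in> V"
  shows "B.Q (z - x) \<longleftrightarrow> (\<exists>x'\<in>V. \<exists>z'\<in>V. B.Pr kB dvd x' - x \<and> B.Pr kB dvd z' - z \<and> Linked (z' - x'))"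
proof
  assume "B.Q (z - x)"
  then obtain j where j: "j < kB" "B.unit j (z - x)" by (auto simp: B.Q_def)
  then obtain w where w: "w \<in> Bnodes h" "nB w = j" using nB by (metis bij_betw_iff_bijections lessThan_iff)
  obtain v c where v: "v \<in> Anodes h" "c < 3" "w = inc h c v" using inc_surj[OF w(1)] .
  let ?i = "nA v"
  have i: "?i < kA" using v nA_less by blast
  obtain z' where z': "z' \<in> V" "A.Pr kA dvd z' - (x + A.Pr ?i)" "B.Pr kB dvd z' - z" using crt_V .
  have "B.Pr kB dvd (z - x) - (z' - x)" using z'(3) by (simp add: dvd_diff_commute)
  then have "B.unit j (z' - x)" using B_unit_signs_cong(1)[OF j] by blast
  moreover have "A.Pr kA dvd A.Pr ?i - (z' - x)"
    using z'(2) by (metis diff_diff_eq dvd_diff_commute)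
  then have "A.unit ?i (z' - x)" using A_unit_signs_cong(1)[OF i A.unit_Pr(1)[OF i]] by blast
  ultimately have "Linked (z' - x)" using v w(2) by (auto simp: Linked_def linked_def)
  then show "\<exists>x'\<in>V. \<exists>z'\<in>V. B.Pr kB dvd x' - x \<and> B.Pr kB dvd z' - z \<and> Linked (z' - x')"
    using z' assms by (intro bexI[of _ x] bexI[of _ z']) auto
next
  assume "\<exists>x'\<in>V. \<exists>z'\<in>V. B.Pr kB dvd x' - x \<and> B.Pr kB dvd z' - z \<and> Linked (z' - x')"
  then obtain x' z' v c where d: "B.Pr kB dvd x' - x" "B.Pr kB dvd z' - z"
    and v: "v \<in> Anodes h" "linked v c (z' - x')" by (auto simp: Linked_def)
  have "(z' - x') - (z - x) = (z' - z) - (x' - x)" by simp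
  then have "B.Pr kB dvd (z' - x') - (z - x)" using d by (metis dvd_diff)
  then have "B.unit (nB (inc h c v)) (z - x)"
    using B_unit_signs_cong(1)[OF nB_less[OF inc_in_Bnodes[OF v(1)]]] v(2) by (auto simp: linked_def)
  then show "B.Q (z - x)" using nB_less[OF inc_in_Bnodes[OF v(1)]] by (auto simp: B.Q_def)
qed

lemma Pr_gt_1: "A.Pr kA > 1" "B.Pr kB > 1"
proof -
  have v: "(True, 0, 0) \<in> Anodes h" using h by (simp add: Anodes_def)
  then have *: "0 < kA" "0 < kB" using nA_less nB_less[OF inc_in_Bnodes[OF v]] by fastforce+
  have "A.Pr 0 * (pA 0 * qA 0) \<le> A.Pr kA" "B.Pr 0 * (pB 0 * qB 0) \<le> B.Pr kB"
    using A.Pr_dvd[of "Suc 0" kA] B.Pr_dvd[of "Suc 0" kB] * A.Pr_pos[of kA] B.Pr_pos[of kB]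
    by (auto simp: A.Pr_Suc B.Pr_Suc intro: zdvd_imp_le)
  moreover have "A.Pr 0 * (pA 0 * qA 0) \<ge> 1 * (5 * 5)" "B.Pr 0 * (pB 0 * qB 0) \<ge> 1 * (5 * 5)"
    using A.pq[OF *(1)] B.pq[OF *(2)] A.Pr_pos[of 0] B.Pr_pos[of 0]
    by (intro mult_mono; simp)+
  ultimately show "A.Pr kA > 1" "B.Pr kB > 1" by linarith+
qed

text \<open>Two squares on one line of the board have as common rook neighbors just the other
  squares of that line.\<close>

lemma card_common_rook:
  assumes "x \<in> V" "y \<in> V" "x \<noteq> y"
  shows "A.Pr kA dvd x - y \<Longrightarrow> int (card {z \<in> V. rook (z - x) \<and> rook (z - y)}) + 2 = B.Pr kB"
    and "B.Pr kB dvd x - y \<Longrightarrow> int (card {z \<in> V. rook (z - x) \<and> rook (z - y)}) + 2 = A.Pr kA"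
proof -
  have *: "int (card {z \<in> V. rook (z - x) \<and> rook (z - y)}) + 2 = Q"
    if d: "P dvd x - y" and PQ: "n = P * Q" "P > 0" "coprime P Q" 
      and rk: "\<And>d. rook d \<longleftrightarrow> (P dvd d) \<noteq> (Q dvd d)" for P Q
  proof -
    have eq: "a = b" if "a \<in> V" "b \<in> V" "P dvd a - b" "Q dvd a - b" for a b
      using that PQ V_eqI[of a b] divides_mult[of P "a - b" Q] by simp
    have "{z \<in> V. rook (z - x) \<and> rook (z - y)} = {z \<in> V. P dvd z - x} - {x, y}"
    proof (intro equalityI subsetI)
      fix z assume z: "z \<in> {z \<in> V. rook (z - x) \<and> rook (z - y)}"
      have e: "(z - y) - (z - x) = x - y" by simp
      have P: "P dvd z - x \<longleftrightarrow> P dvd z - y" using d e by (metis dvd_diff_left_iff dvd_diff_right_iff)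
      have "\<not> (Q dvd z - x \<and> Q dvd z - y)"
        using eq[OF assms(1,2) d] assms(3) e by (metis dvd_diff)
      then show "z \<in> {z \<in> V. P dvd z - x} - {x, y}" using z P by (auto simp: rk)
    next
      fix z assume z: "z \<in> {z \<in> V. P dvd z - x} - {x, y}"
      have e: "(z - y) - (z - x) = x - y" by simp
      have P: "P dvd z - y" using z d e by (metis (no_types, lifting) DiffD1 dvd_diff_left_iff mem_Collect_eq)
      then show "z \<in> {z \<in> V. rook (z - x) \<and> rook (z - y)}"
        using z eq[of z x] eq[of z y] assms by (auto simp: rk)
    qed
    moreover have "{x, y} \<subseteq> {z \<in> V. P dvd z - x}" using assms d by (auto simp: dvd_diff_commute)
    moreover have "card {x, y} = 2" using assms(3) by simp
    ultimately have "card {z \<in> V. rook (z - x) \<and> rook (z - y)} + 2 = card {z \<in> V. P dvd z - x}"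
      using finite_V card_Diff_subset[of "{x, y}" "{z \<in> V. P dvd z - x}"] card_mono[of "{z \<in> V. P dvd z - x}" "{x, y}"]
      by simp
    moreover have "int (card {z \<in> V. P dvd z - x}) = n div P"
      unfolding V_def using card_residue_class PQ n_pos by simp
    ultimately show ?thesis using PQ by simp
  qed
  show "A.Pr kA dvd x - y \<Longrightarrow> int (card {z \<in> V. rook (z - x) \<and> rook (z - y)}) + 2 = B.Pr kB"
    using cop A.Pr_pos[of kA] by (intro *) (auto simp: n_def rook_def)
  show "B.Pr kB dvd x - y \<Longrightarrow> int (card {z \<in> V. rook (z - x) \<and> rook (z - y)}) + 2 = A.Pr kA"
    using cop B.Pr_pos[of kB] by (intro *) (auto simp: n_def rook_def coprime_commute)
qed

lemma card_Collect_bij: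
  assumes "bij_betw f V V" "\<And>z. z \<in> V \<Longrightarrow> R z \<longleftrightarrow> R' (f z)"
  shows "card {z \<in> V. R z} = card {z \<in> V. R' z}"
proof (rule bij_betw_same_card[of f])
  show "bij_betw f {z \<in> V. R z} {z \<in> V. R' z}"
    by (rule bij_betw_Collect[OF assms(1)]) (use assms(2) in auto)
qed

text \<open>The lines of the two directions have different lengths, being coprime and greater than
  1, so the number of common rook neighbors reveals the direction.\<close>

lemma Pr_iff_rook:
  assumes "x \<in> V" "y \<in> V"
  shows "A.Pr kA dvd x - y \<longleftrightarrow> x = y \<or> rook (x - y) \<and> int (card {z \<in> V. rook (z - x) \<and> rook (z - y)}) + 2 = B.Pr kB"
    and "B.Pr kB dvd x - y \<longleftrightarrow> x = y \<or> rook (x - y) \<and> int (card {z \<in> V. rook (z - x) \<and> rook (z - y)}) + 2 = A.Pr kA"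
proof -
  have ne: "A.Pr kA \<noteq> B.Pr kB" using cop Pr_gt_1 by auto
  have eq: "x = y" if "A.Pr kA dvd x - y" "B.Pr kB dvd x - y"
    using that assms V_eqI n_dvd_iff by blast
  note c = card_common_rook[OF assms]
  show "A.Pr kA dvd x - y \<longleftrightarrow> x = y \<or> rook (x - y) \<and> int (card {z \<in> V. rook (z - x) \<and> rook (z - y)}) + 2 = B.Pr kB"
    using c eq ne by (cases "x = y") (auto simp: rook_def)
  show "B.Pr kB dvd x - y \<longleftrightarrow> x = y \<or> rook (x - y) \<and> int (card {z \<in> V. rook (z - x) \<and> rook (z - y)}) + 2 = A.Pr kA"
    using c eq ne by (cases "x = y") (auto simp: rook_def)
qed

text \<open>Step by step \<open>f\<close> is seen to preserve rook moves, linked differences,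
  congruence in each factor, \<open>A.Q\<close> and \<open>B.Q\<close>, and by counting all levels.
  It thus respects every incidence \<open>(v, c)\<close>, and each \<open>\<tau> v c\<close> becomes
  a product of a sign depending on the vertex and label and a sign depending on the edge. Multiplied
  over all incidences these signs cancel, contradicting the product -1.\<close>

lemma not_isomorphic:
  assumes \<tau>: "\<And>v c. \<tau> v c = 1 \<or> \<tau> v c = -1"
    and odd: "(\<Prod>v\<in>Anodes h. \<tau> v 0 * \<tau> v 1 * \<tau> v 2) = -1"
    and f: "bij_betw f V V"
    and arcs: "\<And>x y. x \<in> V \<Longrightarrow> y \<in> V \<Longrightarrow> arc (\<lambda>_ _. 1) (y - x) \<longleftrightarrow> arc \<tau> (f y - f x)"
  shows False
proof -
  have fV: "f x \<in> V" if "x \<in> V" for x using f that by (auto simp: bij_betw_def)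
  have f_eq: "f x = f y \<longleftrightarrow> x = y" if "x \<in> V" "y \<in> V" for x y
    using f that by (auto simp: bij_betw_def inj_on_def)
  have f_img: "f ` V = V" using f by (simp add: bij_betw_def)
  have arcs': "arc (\<lambda>_ _. 1) (- (y - x)) \<longleftrightarrow> arc \<tau> (- (f y - f x))" if "x \<in> V" "y \<in> V" for x y
    using arcs[OF that(2,1)] by simp
  have one: "(1::int) = 1 \<or> (1::int) = -1" by simp
  have rook: "rook (y - x) \<longleftrightarrow> rook (f y - f x)" if "x \<in> V" "y \<in> V" for x y
    using arc_states(1)[where \<tau> = \<tau> and d = "f y - f x", OF \<tau>] arc_states(1)[of "\<lambda>_ _. 1", OF one, where d = "y - x"]
      arcs[OF that] arcs'[OF that] by blast
  have Lk: "Linked (y - x) \<longleftrightarrow> Linked (f y - f x)" if "x \<in> V" "y \<in> V" for x y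
    using arc_states(2)[where \<tau> = \<tau> and d = "f y - f x", OF \<tau>] arc_states(2)[of "\<lambda>_ _. 1", OF one, where d = "y - x"]
      arcs[OF that] arcs'[OF that] by blast
  have cr: "card {z \<in> V. rook (z - x) \<and> rook (z - y)} = card {z \<in> V. rook (z - f x) \<and> rook (z - f y)}"
    if "x \<in> V" "y \<in> V" for x y
    using rook that by (intro card_Collect_bij[OF f]) blast
  have PA: "A.Pr kA dvd x - y \<longleftrightarrow> A.Pr kA dvd f x - f y"
    and PB: "B.Pr kB dvd x - y \<longleftrightarrow> B.Pr kB dvd f x - f y" if "x \<in> V" "y \<in> V" for x y
    using Pr_iff_rook[OF that] Pr_iff_rook[OF fV[OF that(1)] fV[OF that(2)]]
      cr[OF that] rook[OF that(2,1)] f_eq[OF that] by simp_all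
  have bexf: "(\<exists>x\<in>V. \<exists>z\<in>V. R (f x) (f z)) \<longleftrightarrow> (\<exists>x\<in>V. \<exists>z\<in>V. R x z)" for R
  proof -
    have "(\<exists>x\<in>f ` V. \<exists>z\<in>f ` V. R x z) \<longleftrightarrow> (\<exists>x\<in>V. \<exists>z\<in>V. R (f x) (f z))" by simp
    then show ?thesis unfolding f_img by blast
  qed
  have QA: "A.Q (z - x) \<longleftrightarrow> A.Q (f z - f x)" and QB: "B.Q (z - x) \<longleftrightarrow> B.Q (f z - f x)"
    if "x \<in> V" "z \<in> V" for x z
  proof -
    have "(\<exists>x'\<in>V. \<exists>z'\<in>V. A.Pr kA dvd x' - x \<and> A.Pr kA dvd z' - z \<and> Linked (z' - x')) \<longleftrightarrow>
      (\<exists>x'\<in>V. \<exists>z'\<in>V. A.Pr kA dvd f x' - f x \<and> A.Pr kA dvd f z' - f z \<and> Linked (f z' - f x'))"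
      using PA[OF _ that(1)] PA[OF _ that(2)] Lk by (intro bex_cong refl) blast
    also have "\<dots> \<longleftrightarrow> (\<exists>x'\<in>V. \<exists>z'\<in>V. A.Pr kA dvd x' - f x \<and> A.Pr kA dvd z' - f z \<and> Linked (z' - x'))"
      by (rule bexf[where R = "\<lambda>s t. A.Pr kA dvd s - f x \<and> A.Pr kA dvd t - f z \<and> Linked (t - s)"])
    finally show "A.Q (z - x) \<longleftrightarrow> A.Q (f z - f x)"
      unfolding A_Q_iff[OF that(1)] A_Q_iff[OF fV[OF that(1)]] .
    have "(\<exists>x'\<in>V. \<exists>z'\<in>V. B.Pr kB dvd x' - x \<and> B.Pr kB dvd z' - z \<and> Linked (z' - x')) \<longleftrightarrow>
      (\<exists>x'\<in>V. \<exists>z'\<in>V. B.Pr kB dvd f x' - f x \<and> B.Pr kB dvd f z' - f z \<and> Linked (f z' - f x'))"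
      using PB[OF _ that(1)] PB[OF _ that(2)] Lk by (intro bex_cong refl) blast
    also have "\<dots> \<longleftrightarrow> (\<exists>x'\<in>V. \<exists>z'\<in>V. B.Pr kB dvd x' - f x \<and> B.Pr kB dvd z' - f z \<and> Linked (z' - x'))"
      by (rule bexf[where R = "\<lambda>s t. B.Pr kB dvd s - f x \<and> B.Pr kB dvd t - f z \<and> Linked (t - s)"])
    finally show "B.Q (z - x) \<longleftrightarrow> B.Q (f z - f x)"
      unfolding B_Q_iff[OF that(1)] B_Q_iff[OF fV[OF that(1)]] .
  qed
  have dvd_n: "A.Pr kA dvd n" "B.Pr kB dvd n" by (simp_all add: n_def)
  have PrA: "A.Pr i dvd x - y \<longleftrightarrow> A.Pr i dvd f x - f y" if i: "0 < i" "i \<le> kA" and xy: "x \<in> V" "y \<in> V" for i x y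
  proof -
    have "card {z \<in> V. A.Q (z - x) \<noteq> A.Q (z - y)} = card {z \<in> V. A.Q (z - f x) \<noteq> A.Q (z - f y)}"
      using QA xy by (intro card_Collect_bij[OF f]) blast
    then show ?thesis
      unfolding A.level_by_counting[OF i dvd_n(1) n_pos] V_def by simp
  qed
  have PrB: "B.Pr i dvd x - y \<longleftrightarrow> B.Pr i dvd f x - f y" if i: "0 < i" "i \<le> kB" and xy: "x \<in> V" "y \<in> V" for i x y
  proof -
    have "card {z \<in> V. B.Q (z - x) \<noteq> B.Q (z - y)} = card {z \<in> V. B.Q (z - f x) \<noteq> B.Q (z - f y)}"
      using QB xy by (intro card_Collect_bij[OF f]) blast
    then show ?thesis
      unfolding B.level_by_counting[OF i dvd_n(2) n_pos] V_def by simp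
  qed
  \<comment> \<open>Counting recovers divisibility by \<open>A.Pr i\<close> for positive
    \<open>i\<close> only. For \<open>i' = 0\<close> it is known because \<open>x - y\<close> has a
    level.\<close>
  have levA: "i' = i" if "i < kA" "i' < kA" "A.lev i (x - y)" "A.lev i' (f x - f y)" "x \<in> V" "y \<in> V" for i i' x y
  proof -
    have "A.Pr i' dvd x - y"
      using that PrA[of i' x y] A.Pr_dvd_trans[of 0 i "x - y"] by (cases "i' = 0") (auto simp: A.lev_def)
    then have "A.lev i' (x - y)" using that PrA[of "Suc i'" x y] by (auto simp: A.lev_def)
    then show ?thesis using that A.lev_unique by blast
  qed
  have levB: "i' = i" if "i < kB" "i' < kB" "B.lev i (x - y)" "B.lev i' (f x - f y)" "x \<in> V" "y \<in> V" for i i' x y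
  proof -
    have "B.Pr i' dvd x - y"
      using that PrB[of i' x y] B.Pr_dvd_trans[of 0 i "x - y"] by (cases "i' = 0") (auto simp: B.lev_def)
    then have "B.lev i' (x - y)" using that PrB[of "Suc i'" x y] by (auto simp: B.lev_def)
    then show ?thesis using that B.lev_unique by blast
  qed
  have V0: "0 \<in> V" using n_pos by (simp add: V_def)
  \<comment> \<open>Test elements with one prescribed part, compared with the base point 0:
    \<open>a v\<close> will depend on the vertex only and \<open>b w\<close> on the edge
    only.\<close>
  have "\<exists>z. z \<in> V \<and> A.Pr kA dvd z - A.Pr (nA v) \<and> B.Pr kB dvd z - 0" for v using crt_V by metis
  then obtain zA where zA: "\<And>v. zA v \<in> V" "\<And>v. A.Pr kA dvd zA v - A.Pr (nA v)" by metis
  have "\<exists>z. z \<in> V \<and> A.Pr kA dvd z - 0 \<and> B.Pr kB dvd z - B.Pr (nB w)" for w using crt_V by metis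
  then obtain zB where zB: "\<And>w. zB w \<in> V" "\<And>w. B.Pr kB dvd zB w - B.Pr (nB w)" by metis
  define a where "a v = f (zA v) - f 0" for v
  define b where "b w = signB w (f (zB w) - f 0)" for w
  have key: "\<tau> v c = signA c v (a v) * b (inc h c v)" if v: "v \<in> Anodes h" "c < 3" for v c
  proof -
    let ?w = "inc h c v"
    have w: "?w \<in> Bnodes h" using inc_in_Bnodes v by blast
    have l: "nA v < kA" "nB ?w < kB" using nA_less nB_less w v by auto
    \<comment> \<open>\<open>z\<close> combines the two test parts. Both of its signs are 1, so it
      satisfies the untwisted equation at \<open>(v, c)\<close>.\<close>
    obtain z where z: "z \<in> V" "A.Pr kA dvd z - A.Pr (nA v)" "B.Pr kB dvd z - B.Pr (nB ?w)" using crt_V .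
    note uA = A_unit_signs_cong[OF l(1) A.unit_Pr(1)[OF l(1)], of z]
    note uB = B_unit_signs_cong[OF l(2) B.unit_Pr(1)[OF l(2)], of z]
    have lz: "linked v c z" and s: "signA c v z = 1" "signB ?w z = 1"
      using uA uB z A.unit_Pr[OF l(1)] B.unit_Pr[OF l(2)]
      by (auto simp: linked_def signA_def signB_def dvd_diff_commute split: sum.splits)
    then have "Linked (z - 0)" using v by (auto simp: Linked_def)
    then have LD: "Linked (f z - f 0)" using Lk[OF V0 z(1)] by blast
    then obtain v' c' where v': "v' \<in> Anodes h" "c' < 3" "linked v' c' (f z - f 0)"
      by (auto simp: Linked_def)
    have l': "nA v' < kA" "nB (inc h c' v') < kB" using nA_less nB_less inc_in_Bnodes v' by auto
    have "A.lev (nA v) (z - 0)" "B.lev (nB ?w) (z - 0)"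
      using lz A.unit_lev[OF l(1)] B.unit_lev[OF l(2)] by (auto simp: linked_def)
    moreover have "A.lev (nA v') (f z - f 0)" "B.lev (nB (inc h c' v')) (f z - f 0)"
      using v'(3) A.unit_lev[OF l'(1)] B.unit_lev[OF l'(2)] by (auto simp: linked_def)
    ultimately have "nA v' = nA v" "nB (inc h c' v') = nB ?w"
      using levA[OF l(1) l'(1) _ _ z(1) V0] levB[OF l(2) l'(2) _ _ z(1) V0] by blast+
    then have "v' = v" "inc h c' v' = ?w" using nA_inj nB_inj v v' w inc_in_Bnodes by blast+
    then have "v' = v" "c' = c" using inc_inj[of h v c' c] h v v' by auto
    then have lD: "linked v c (f z - f 0)" using v' by simp
    have "cfi_rel (\<lambda>_ _. 1) (z - 0)" unfolding cfi_rel_iff[OF v, of "z - 0", unfolded diff_0_right, OF lz] diff_0_right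
      using s by simp
    then have "arc \<tau> (f z - f 0)" using arcs[OF V0 z(1)] by (simp add: arc_def)
    moreover have "\<not> rook (f z - f 0)" using Linked_not_dvd[OF LD] by (simp add: rook_def)
    ultimately have 1: "\<tau> v c = signA c v (f z - f 0) * signB ?w (f z - f 0)"
      using cfi_rel_iff[OF v lD] by (simp add: arc_def)
    have "A.Pr kA dvd z - zA v"
      using dvd_diff[OF z(2) zA(2)[of v]] by simp
    then have "A.Pr kA dvd f z - f (zA v)" using PA[OF z(1) zA(1)] by blast
    then have "A.Pr kA dvd (f z - f 0) - a v" by (simp add: a_def)
    then have 2: "signA c v (a v) = signA c v (f z - f 0)"
      using A_unit_signs_cong[OF l(1), of "f z - f 0" "a v"] lD by (simp add: linked_def signA_def)
    have "B.Pr kB dvd z - zB ?w"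
      using dvd_diff[OF z(3) zB(2)[of ?w]] by simp
    then have "B.Pr kB dvd f z - f (zB ?w)" using PB[OF z(1) zB(1)] by blast
    then have "B.Pr kB dvd (f z - f 0) - (f (zB ?w) - f 0)" by simp
    then have 3: "b ?w = signB ?w (f z - f 0)"
      using B_unit_signs_cong[OF l(2), of "f z - f 0" "f (zB ?w) - f 0"] lD
      by (cases ?w) (simp_all add: linked_def signB_def b_def)
    show ?thesis using 1 2 3 by simp
  qed
  have "\<tau> v 0 * \<tau> v 1 * \<tau> v 2 = b (inc h 0 v) * b (inc h 1 v) * b (inc h 2 v)" if v: "v \<in> Anodes h" for v
  proof -
    have k: "\<tau> v 0 = signA 0 v (a v) * b (inc h 0 v)" "\<tau> v 1 = signA 1 v (a v) * b (inc h 1 v)"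
      "\<tau> v 2 = signA 2 v (a v) * b (inc h 2 v)" by (rule key[OF v], simp)+
    \<comment> \<open>Label 2 carries the product of the signs of labels 0 and 1, so each elementary
      sign occurs twice.\<close>
    have "signA 0 v (a v) * signA 1 v (a v) * signA 2 v (a v) =
       (A.s1 (nA v) (a v) * A.s1 (nA v) (a v)) * (A.s2 (nA v) (a v) * A.s2 (nA v) (a v))"
      by (simp add: signA_def)
    also have "\<dots> = 1" by (simp only: A.s1_sq A.s2_sq)
    finally have s: "signA 0 v (a v) * signA 1 v (a v) * signA 2 v (a v) = 1" .
    have "\<tau> v 0 * \<tau> v 1 * \<tau> v 2 = (signA 0 v (a v) * signA 1 v (a v) * signA 2 v (a v)) *
       (b (inc h 0 v) * b (inc h 1 v) * b (inc h 2 v))"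
      unfolding k by (simp only: mult_ac)
    with s show ?thesis by simp
  qed
  then have "(\<Prod>v\<in>Anodes h. \<tau> v 0 * \<tau> v 1 * \<tau> v 2) = (\<Prod>v\<in>Anodes h. b (inc h 0 v) * b (inc h 1 v) * b (inc h 2 v))"
    by simp
  also have "\<dots> = 1"
  proof (rule prod_inc)
    show "b w * b w = 1" for w using signB_cases[of w "f (zB w) - f 0"] by (auto simp: b_def)
  qed
  finally show False using odd by simp
qed

section \<open>Non-isomorphism and the dimension of the wall graph\<close>

lemma not_digraph_iso_twist:
  "\<not> digraph_iso (with_proj (cfi_graph (\<lambda>_ _. 1))) (with_proj (cfi_graph_nat (twist (row_loc 0))))"
proof
  assume "digraph_iso (with_proj (cfi_graph (\<lambda>_ _. 1))) (with_proj (cfi_graph_nat (twist (row_loc 0))))"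
  then obtain f where f: "bij_betw f V (nat ` V)"
    and arcs: "\<And>u v. u \<in> V \<Longrightarrow> v \<in> V \<Longrightarrow> (u, v) \<in> parcs (cfi_graph (\<lambda>_ _. 1)) \<longleftrightarrow>
      (f u, f v) \<in> parcs (cfi_graph_nat (twist (row_loc 0)))"
    by (rule digraph_iso_with_projD) (simp add: cfi_graph_def cfi_graph_nat_def)
  have "bij_betw int (nat ` V) V"
    by (rule bij_betw_byWitness[where f' = nat]) (auto simp: V_def)
  with f have b: "bij_betw (int \<circ> f) V V" by (rule bij_betw_trans)
  have "(\<Prod>v\<in>Anodes h. twist (row_loc 0) v 0 * twist (row_loc 0) v 1 * twist (row_loc 0) v 2) =
      (\<Prod>v\<in>Anodes h. if v = (True, 0, 0) then -1 else 1)"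
    by (rule prod.cong) (auto simp: twist_def row_loc_def)
  also have "\<dots> = -1" using h by (simp add: finite_Anodes prod.delta) (simp add: Anodes_def)
  finally have odd: "(\<Prod>v\<in>Anodes h. twist (row_loc 0) v 0 * twist (row_loc 0) v 1 * twist (row_loc 0) v 2) = -1" .
  have fV: "f x \<in> nat ` V" if "x \<in> V" for x using f that by (auto simp: bij_betw_def)
  show False
  proof (rule not_isomorphic[OF _ odd b])
    show "twist (row_loc 0) v c = 1 \<or> twist (row_loc 0) v c = -1" for v c by (simp add: twist_def)
    fix x y assume "x \<in> V" "y \<in> V"
    then show "arc (\<lambda>_ _. 1) (y - x) \<longleftrightarrow> arc (twist (row_loc 0)) ((int \<circ> f) y - (int \<circ> f) x)"
      using arcs[of x y] fV by (simp add: cfi_graph_def cfi_graph_nat_def)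
  qed
qed

lemma pair_fin_digraph_cfi: "pair_fin_digraph (cfi_graph \<tau>)" "pair_fin_digraph (cfi_graph_nat \<tau>)"
proof -
  have "finite {(x, y). x \<in> S \<and> y \<in> S \<and> R x y}" if "finite S" for S :: "'a set" and R
    by (rule finite_subset[of _ "S \<times> S"]) (use that in auto)
  then show "pair_fin_digraph (cfi_graph \<tau>)"
    using finite_V by unfold_locales (auto simp: cfi_graph_def)
next
  have "finite {(x, y). x \<in> S \<and> y \<in> S \<and> R x y}" if "finite S" for S :: "nat set" and R
    by (rule finite_subset[of _ "S \<times> S"]) (use that in auto)
  then show "pair_fin_digraph (cfi_graph_nat \<tau>)"
    using finite_V by unfold_locales (auto simp: cfi_graph_nat_def)
qed

lemma wl_dimension_cfi: "h \<le> 2 * wl_dimension (cfi_graph (\<lambda>_ _. 1)) + 2"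
proof -
  have "(h - 1) div 2 \<le> wl_dimension (cfi_graph (\<lambda>_ _. 1))"
  proof (rule wl_dimension_geI)
    show "pair_fin_digraph (cfi_graph (\<lambda>_ _. 1))" by (rule pair_fin_digraph_cfi)
    show "pverts (cfi_graph (\<lambda>_ _. 1)) \<noteq> {}" using n_pos by (simp add: cfi_graph_def V_def)
    fix m :: nat assume m: "1 \<le> m" "wl_identifies m (cfi_graph (\<lambda>_ _. 1))"
    show "(h - 1) div 2 \<le> m"
    proof (rule ccontr)
      assume "\<not> (h - 1) div 2 \<le> m"
      then have "2 * m + 2 < h" by linarith
      from wl_equivalent_twist[OF m(1) this] m(2) not_digraph_iso_twist pair_fin_digraph_cfi(2)
      show False unfolding wl_identifies_def by blast
    qed
  qed
  then show ?thesis by linarith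
qed

lemma card_cfi: "card (pverts (cfi_graph \<tau>)) = nat n"
  by (simp add: cfi_graph_def V_def)

end

section \<open>The lower bound\<close>

text \<open>The wall has \<open>2 * h * h\<close> vertices and \<open>3 * h * h\<close> edges, so
  under the bound on \<open>b\<close> they fit into the \<open>b\<close> positions available in each
  factor.\<close>

lemma circulant_large_wl_dimension:
  fixes b h :: nat and ns :: "nat \<Rightarrow> nat"
  assumes h: "3 \<le> h" "3 * h * h \<le> b"
    and ns: "\<And>i. i \<in> {1..2 * b} \<Longrightarrow> \<exists>p q. prime p \<and> prime q \<and> p \<noteq> q \<and> 5 \<le> p \<and> 5 \<le> q \<and> ns i = p * q"
    and cop: "coprime (\<Prod>i = 1..b. ns i) (\<Prod>i = b + 1..2 * b. ns i)"
  obtains \<Gamma> :: "int pair_pre_digraph" where "circulant_graph \<Gamma>"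
    "card (pverts \<Gamma>) = (\<Prod>i = 1..2 * b. ns i)" "h \<le> 2 * wl_dimension \<Gamma> + 2"
proof -
  obtain p q where pq: "\<And>i. i \<in> {1..2 * b} \<Longrightarrow> prime (p i) \<and> prime (q i) \<and> p i \<noteq> q i \<and> 5 \<le> p i \<and> 5 \<le> q i \<and> ns i = p i * (q i :: nat)"
    using ns by metis
  define kA where "kA = 2 * h * h"
  define kB where "kB = 3 * h * h"
  have k: "kA \<le> b" "kB \<le> b" using h by (auto simp: kA_def kB_def)
  \<comment> \<open>The surplus moduli, which encode no node of the wall, become the lowest modulus
    of the respective ladder.\<close>
  define GA where "GA = int (\<Prod>i = kA + 1..b. ns i)"
  define GB where "GB = int (\<Prod>i = b + kB + 1..2 * b. ns i)"
  obtain nA where nA: "bij_betw nA (Anodes h) {..<kA}"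
    using ex_bij_betw_finite_nat[OF finite_Anodes[of h]] by (auto simp: card_Anodes kA_def atLeast0LessThan)
  obtain nB where nB: "bij_betw nB (Bnodes h) {..<kB}"
    using ex_bij_betw_finite_nat[OF finite_Bnodes[of h]] by (auto simp: card_Bnodes kB_def atLeast0LessThan)
  have odd5: "odd (int r)" if "prime r" "5 \<le> r" for r :: nat
    using that prime_odd_nat[of r] by simp
  have ok: "5 \<le> int (p i) \<and> 5 \<le> int (q i) \<and> odd (int (p i)) \<and> odd (int (q i)) \<and> coprime (int (p i)) (int (q i))"
    if "i \<in> {1..2 * b}" for i
    using pq[OF that] odd5[of "p i"] odd5[of "q i"] primes_coprime[of "p i" "q i"] by (simp add: coprime_int_iff)
  have pos: "ns i > 0" if "i \<in> {1..2 * b}" for i using pq[OF that] by (simp add: prime_gt_0_nat)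
  interpret A: ladder GA kA "\<lambda>t. int (p (t + 1))" "\<lambda>t. int (q (t + 1))"
  proof
    have "(\<Prod>i = kA + 1..b. ns i) > 0" using pos by (intro prod_pos) auto
    then show "GA > 0" by (simp only: GA_def of_nat_0_less_iff)
  qed (use ok k in auto)
  interpret B: ladder GB kB "\<lambda>t. int (p (b + t + 1))" "\<lambda>t. int (q (b + t + 1))"
  proof
    have "(\<Prod>i = b + kB + 1..2 * b. ns i) > 0" using pos by (intro prod_pos) auto
    then show "GB > 0" by (simp only: GB_def of_nat_0_less_iff)
  qed (use ok k in auto)
  have "A.Pr kA = GA * (\<Prod>t<kA. int (ns (t + 1)))"
    unfolding A.Pr_def using pq k by (intro arg_cong2[of _ _ _ _ "(*)"] prod.cong) auto
  also have "(\<Prod>t<kA. int (ns (t + 1))) = (\<Prod>i = 1..kA. int (ns i))"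
    using prod.atLeast_Suc_lessThan_Suc_shift[of "\<lambda>i. int (ns i)" 0 kA]
    by (simp add: atLeast0LessThan atLeastLessThanSuc_atLeastAtMost)
  also have "GA * \<dots> = int ((\<Prod>i = 1..kA. ns i) * (\<Prod>i = kA + 1..b. ns i))"
    by (simp add: GA_def)
  also have "(\<Prod>i = 1..kA. ns i) * (\<Prod>i = kA + 1..b. ns i) = (\<Prod>i = 1..b. ns i)"
    using k by (subst prod.union_disjoint [symmetric]) (auto intro: prod.cong)
  finally have PA: "A.Pr kA = int (\<Prod>i = 1..b. ns i)" .
  have "B.Pr kB = GB * (\<Prod>t<kB. int (ns (b + t + 1)))"
    unfolding B.Pr_def using pq k by (intro arg_cong2[of _ _ _ _ "(*)"] prod.cong) auto
  also have "(\<Prod>t<kB. int (ns (b + t + 1))) = (\<Prod>i = b + 1..b + kB. int (ns i))"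
    by (rule prod.reindex_bij_witness[of _ "\<lambda>i. i - b - 1" "\<lambda>t. b + t + 1"]) auto
  also have "GB * \<dots> = int ((\<Prod>i = b + 1..b + kB. ns i) * (\<Prod>i = b + kB + 1..2 * b. ns i))"
    by (simp add: GB_def)
  also have "(\<Prod>i = b + 1..b + kB. ns i) * (\<Prod>i = b + kB + 1..2 * b. ns i) = (\<Prod>i = b + 1..2 * b. ns i)"
    using k by (subst prod.union_disjoint [symmetric]) (auto intro: prod.cong)
  finally have PB: "B.Pr kB = int (\<Prod>i = b + 1..2 * b. ns i)" .
  interpret cfi GA kA "\<lambda>t. int (p (t + 1))" "\<lambda>t. int (q (t + 1))"
    GB kB "\<lambda>t. int (p (b + t + 1))" "\<lambda>t. int (q (b + t + 1))" h nA nB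
    by unfold_locales (use h nA nB cop in \<open>simp_all only: PA PB coprime_int_iff\<close>)
  have "(\<Prod>i = 1..b. ns i) * (\<Prod>i = b + 1..2 * b. ns i) = (\<Prod>i = 1..2 * b. ns i)"
    by (subst prod.union_disjoint [symmetric]) (auto intro: prod.cong)
  then have "nat n = (\<Prod>i = 1..2 * b. ns i)"
    by (simp only: n_def PA PB of_nat_mult [symmetric] nat_int)
  then show ?thesis
    using that[of "cfi_graph (\<lambda>_ _. 1)"] circulant card_cfi wl_dimension_cfi by simp
qed

text \<open>Serves small parameters, for which the bound to be shown is at most 0.\<close>

lemma circulant_exists:
  assumes "n > 0"
  obtains \<Gamma> :: "int pair_pre_digraph" where "circulant_graph \<Gamma>" "card (pverts \<Gamma>) = n"
proof (rule that[of "cayley_graph (integer_mod_group n) {}"])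
  show "circulant_graph (cayley_graph (integer_mod_group n) {})"
    unfolding circulant_graph_def using cyclic_integer_mod_group[OF assms]
    by (intro exI[of _ "integer_mod_group n"] exI[of _ "{}"] conjI group_integer_mod_group) simp_all
  show "card (pverts (cayley_graph (integer_mod_group n) {})) = n"
    using assms by (simp add: cayley_graph_def carrier_integer_mod_group)
qed

theorem theorem1p1:
  "\<forall>\<epsilon>::real. \<epsilon> > 0 \<longrightarrow> (\<exists>c::real. c > 0 \<and>
     (\<forall>(a::nat) (b::nat) (ns :: nat \<Rightarrow> nat) (n::nat).
        b > 0 \<and> a = 2 * b \<and>
        (\<exists>K :: nat pair_pre_digraph. K \<in> bip_cubic_3conn a \<and> expander \<epsilon> K) \<and>
        (\<forall>i \<in> {1..a}. \<exists>p q. prime p \<and> prime q \<and> p \<noteq> q \<and> 5 \<le> p \<and> 5 \<le> q \<and> ns i = p * q) \<and>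
        n = (\<Prod>i = 1..a. ns i) \<and>
        coprime (\<Prod>i = 1..b. ns i) (\<Prod>i = b + 1..2 * b. ns i) \<longrightarrow>
        (\<exists>\<Gamma> :: int pair_pre_digraph. circulant_graph \<Gamma> \<and> card (pverts \<Gamma>) = n \<and>
           \<lfloor>c * sqrt (real a)\<rfloor> \<le> int (wl_dimension \<Gamma>))))"
proof (intro allI impI exI[of _ "1 / 20 :: real"] conjI; (elim conjE)?)
  fix a b :: nat and ns :: "nat \<Rightarrow> nat" and n :: nat
  assume a: "a = 2 * b"
    and ns: "\<forall>i \<in> {1..a}. \<exists>p q. prime p \<and> prime q \<and> p \<noteq> q \<and> 5 \<le> p \<and> 5 \<le> q \<and> ns i = p * q"
    and n: "n = (\<Prod>i = 1..a. ns i)"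
    and cop: "coprime (\<Prod>i = 1..b. ns i) (\<Prod>i = b + 1..2 * b. ns i)"
  \<comment> \<open>\<open>h\<close> is the largest number with
    \<open>3 * h * h \<le> b\<close>.\<close>
  define s where "s = sqrt (real b / 3)"
  define h where "h = nat \<lfloor>s\<rfloor>"
  have "0 \<le> s" by (simp add: s_def)
  then have hs: "real h \<le> s" "s < real h + 1" by (auto simp: h_def)
  have "real h * real h \<le> s * s" using hs(1) by (intro mult_mono) auto
  also have "s * s = real b / 3" by (simp add: s_def)
  finally have "real (3 * h * h) \<le> real b" by simp
  then have hb: "3 * h * h \<le> b" by (simp only: of_nat_le_iff)
  have "sqrt (real a) = sqrt 6 * s" by (simp add: a s_def real_sqrt_mult [symmetric])
  also have "\<dots> \<le> 3 * (real h + 1)"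
    using hs \<open>0 \<le> s\<close> by (intro mult_mono) (auto intro: real_le_lsqrt)
  finally have sqrt_a: "1 / 20 * sqrt (real a) \<le> 3 * (real h + 1) / 20" by simp
  show "\<exists>\<Gamma> :: int pair_pre_digraph. circulant_graph \<Gamma> \<and> card (pverts \<Gamma>) = n \<and>
           \<lfloor>1 / 20 * sqrt (real a)\<rfloor> \<le> int (wl_dimension \<Gamma>)"
  \<comment> \<open>The constant 1/20 suits both cases: \<open>3 * (h + 1) / 20\<close> is below 1
    for \<open>h \<le> 5\<close>, and at most \<open>(h - 2) / 2\<close>, the lower bound for the
    dimension, for larger \<open>h\<close>.\<close>
  proof (cases "h \<le> 5")
    case True
    have "0 < ns i" if "i \<in> {1..a}" for i using ns that by (fastforce simp: prime_gt_0_nat)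
    then have "n > 0" unfolding n by (intro prod_pos) auto
    then obtain \<Gamma> :: "int pair_pre_digraph" where "circulant_graph \<Gamma>" "card (pverts \<Gamma>) = n"
      using circulant_exists by blast
    moreover have "1 / 20 * sqrt (real a) < 1" using sqrt_a True by simp
    then have "\<lfloor>1 / 20 * sqrt (real a)\<rfloor> \<le> 0" by linarith
    then have "\<lfloor>1 / 20 * sqrt (real a)\<rfloor> \<le> int (wl_dimension \<Gamma>)" by linarith
    ultimately show ?thesis by (intro exI[of _ \<Gamma>] conjI)
  next
    case False
    then have "3 \<le> h" by simp
    then obtain \<Gamma> :: "int pair_pre_digraph" where \<Gamma>: "circulant_graph \<Gamma>" "card (pverts \<Gamma>) = n"
        "h \<le> 2 * wl_dimension \<Gamma> + 2"
      using circulant_large_wl_dimension[OF _ hb, of ns] ns cop unfolding n a by blast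
    have "real h \<le> 2 * real (wl_dimension \<Gamma>) + 2" using \<Gamma>(3) by linarith
    then have "1 / 20 * sqrt (real a) \<le> real (wl_dimension \<Gamma>)" using sqrt_a False by simp
    then have "\<lfloor>1 / 20 * sqrt (real a)\<rfloor> \<le> int (wl_dimension \<Gamma>)" by linarith
    with \<Gamma> show ?thesis by blast
  qed
qed simp

end
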